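(* Let $d,N\ge 1$ be integers, let $\mathrm{X}=(X(t),t\ge 0)$ be the barycentric Brownian bees process with $N$ particles in $\mathbb{R}^d$, and let $\overline{X}(t)=N^{-1}\sum_{i=1}^N X_i(t)$ be its barycenter. Then the process $\mathrm{X}-\overline{\mathrm{X}}=(X(t)-\overline{X}(t),t\ge 0)$ is Harris recurrent. That is, writing $\Phi_t=X(t)-\overline{X}(t)=(X_i(t)-\overline{X}(t))_{i\in[N]}$, there exists a $\sigma$-finite and nonzero Borel measure $\varphi$ on $\mathbb{R}^{d\times N}$ such that for every Borel set $A\subset\mathbb{R}^{d\times N}$ with $\varphi(A)>0$ and every $x\in\mathbb{R}^{d\times N}$, $$\mathbf{P}_x\left(\int_0^\infty \mathbf{1}_{\{\Phi_t\in A\}}\,dt=\infty\right)=1,$$ where $\mathbf{P}_x$ is the law under which $X(0)=x$.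
   Context: Write $[N]=\{1,\dots,N\}$; $|\cdot|$ is the Euclidean norm; elements of $\mathbb{R}^{d\times N}$ are configurations $x=(x_i)_{i\in[N]}$ with $x_i\in\mathbb{R}^d$. Barycentric Brownian bees (BBB) process $X(t)=(X_j(t))_{j\in[N]}$ started from $x\in\mathbb{R}^{d\times N}$: let $0=J_0<J_1<J_2<\cdots$ where $(J_i)_{i\ge1}$ are the successive points of a Poisson point process of rate $N$ on $[0,\infty)$; let $(\mathcal{U}_i)_{i\ge 1}$ be i.i.d. uniform on $[N]$; let $B_1,\dots,B_N$ be independent standard $d$-dimensional Brownian motions started at the origin; all these objects are independent. Set $X_j(0)=x_j$. For $i\ge 1$, $j\in[N]$ and $t\in[J_{i-1},J_i)$, $X_j(t)=X_j(J_{i-1})+B_j(t)-B_j(J_{i-1})$. At time $J_i$ particle $\mathcal{U}_i$ branches and the particle furthest from the barycenter (computed including the newborn particle) is removed: with $$k=\operatorname*{argmax}_{j\in[N]}\left|X_j(J_i-)-\frac{1}{N+1}\Big(X_{\mathcal{U}_i}(J_i-)+\sum_{l\in[N]}X_l(J_i-)\Big)\right|$$ (ties have probability $0$), set $X_k(J_i)=X_{\mathcal{U}_i}(J_i-)$ and $X_j(J_i)=X_j(J_i-)$ for $j\ne k$. *)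

theory Defs
  imports "HOL-Probability.Probability"
begin

type_synonym ('d, 'n) config = "real ^ 'd ^ 'n"

definition barycenter :: "('d::finite, 'n::finite) config \<Rightarrow> real ^ 'd" where
  "barycenter c = (1 / real CARD('n)) *\<^sub>R (\<Sum>j\<in>UNIV. c $ j)"

definition centered :: "('d::finite, 'n::finite) config \<Rightarrow> ('d, 'n) config" where
  "centered c = (\<chi> i. c $ i - barycenter c)"

definition barycenter_with_newborn :: "('d::finite, 'n::finite) config \<Rightarrow> 'n \<Rightarrow> real ^ 'd" where
  "barycenter_with_newborn c u = (1 / real (CARD('n) + 1)) *\<^sub>R (c $ u + (\<Sum>l\<in>UNIV. c $ l))"

text \<open>
  A path of the process, driven by jump times \<open>J\<close>, labels \<open>U\<close> and continuous motions \<open>b\<close>.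
  The configuration \<open>Y\<close> is the left limit at a jump time. Ties may be broken in any way,
  since they almost surely do not occur.
\<close>

definition bbb_path ::
  "('d::finite, 'n::finite) config \<Rightarrow> (nat \<Rightarrow> real) \<Rightarrow> (nat \<Rightarrow> 'n) \<Rightarrow> ('n \<Rightarrow> real \<Rightarrow> real ^ 'd)
    \<Rightarrow> (real \<Rightarrow> ('d, 'n) config) \<Rightarrow> bool" where
  "bbb_path x J U b X \<longleftrightarrow>
     X 0 = x \<and>
     (\<forall>i j. \<forall>t\<in>{J i..<J (Suc i)}. X t $ j = X (J i) $ j + b j t - b j (J i)) \<and>
     (\<forall>i\<ge>1. \<exists>Y k. (X \<longlongrightarrow> Y) (at_left (J i)) \<and>
        is_arg_max (\<lambda>j. norm (Y $ j - barycenter_with_newborn Y (U i))) (\<lambda>_. True) k \<and>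
        X (J i) $ k = Y $ U i \<and>
        (\<forall>j. j \<noteq> k \<longrightarrow> X (J i) $ j = Y $ j))"

context prob_space
begin

text \<open>
  A simple point process on \<open>[0, \<infinity>)\<close> is given by its random locally finite set of points. The
  Poisson probabilities are written out, as \<^const>\<open>poisson_pmf\<close> excludes parameter \<open>0\<close>,
  which occurs for null sets. A finite family of disjoint sets is extended to a sequence by empty sets.
\<close>

definition poisson_point_process :: "real \<Rightarrow> ('a \<Rightarrow> real set) \<Rightarrow> bool" where
  "poisson_point_process r P \<longleftrightarrow>
     (AE \<omega> in M. P \<omega> \<subseteq> {0..} \<and> (\<forall>t. finite (P \<omega> \<inter> {0..t}))) \<and>
     (\<forall>A k. A \<in> sets borel \<longrightarrow> bounded A \<longrightarrow> A \<subseteq> {0..} \<longrightarrow>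
        prob {\<omega> \<in> space M. card (P \<omega> \<inter> A) = k} =
          (r * measure lborel A) ^ k / fact k * exp (- (r * measure lborel A))) \<and>
     (\<forall>A :: nat \<Rightarrow> real set.
        (\<forall>m. A m \<in> sets borel \<and> bounded (A m) \<and> A m \<subseteq> {0..}) \<longrightarrow> disjoint_family A \<longrightarrow>
        indep_vars (\<lambda>_. count_space UNIV) (\<lambda>m \<omega>. card (P \<omega> \<inter> A m)) UNIV)"

definition std_brownian_motion :: "(real \<Rightarrow> 'a \<Rightarrow> real) \<Rightarrow> bool" where
  "std_brownian_motion W \<longleftrightarrow>
     (\<forall>t\<ge>0. random_variable borel (W t)) \<and>
     (AE \<omega> in M. W 0 \<omega> = 0) \<and>
     (\<forall>s t. 0 \<le> s \<longrightarrow> s < t \<longrightarrow>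
        distributed M lborel (\<lambda>\<omega>. W t \<omega> - W s \<omega>) (normal_density 0 (sqrt (t - s)))) \<and>
     (\<forall>t :: nat \<Rightarrow> real. 0 \<le> t 0 \<longrightarrow> mono t \<longrightarrow>
        indep_vars (\<lambda>_. borel) (\<lambda>m \<omega>. W (t (Suc m)) \<omega> - W (t m) \<omega>) UNIV) \<and>
     (AE \<omega> in M. continuous_on {0..} (\<lambda>t. W t \<omega>))"

definition std_brownian_motion_vec :: "(real \<Rightarrow> 'a \<Rightarrow> real ^ 'd::finite) \<Rightarrow> bool" where
  "std_brownian_motion_vec W \<longleftrightarrow>
     (\<forall>i. std_brownian_motion (\<lambda>t \<omega>. W t \<omega> $ i)) \<and>
     indep_vars (\<lambda>_. Pi\<^sub>M {0..} (\<lambda>_. borel)) (\<lambda>i \<omega>. \<lambda>t\<in>{0..}. W t \<omega> $ i) UNIV"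

end

text \<open>
  The random objects driving the process have different types, so their joint independence is
  expressed through the \<open>\<sigma>\<close>-algebras they generate, indexed by the following type.
\<close>

datatype 'n source = Jumps | Label nat | Motion 'n

fun source_events ::
  "'w measure \<Rightarrow> (nat \<Rightarrow> 'w \<Rightarrow> real) \<Rightarrow> (nat \<Rightarrow> 'w \<Rightarrow> 'n) \<Rightarrow> ('n \<Rightarrow> real \<Rightarrow> 'w \<Rightarrow> real ^ 'd::finite)
    \<Rightarrow> 'n source \<Rightarrow> 'w set set" where
  "source_events M J U B Jumps =
     sets (vimage_algebra (space M) (\<lambda>\<omega> i. J i \<omega>) (Pi\<^sub>M UNIV (\<lambda>_. borel)))"
| "source_events M J U B (Label i) =
     sets (vimage_algebra (space M) (U i) (count_space UNIV))"
| "source_events M J U B (Motion j) =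
     sets (vimage_algebra (space M) (\<lambda>\<omega>. \<lambda>t\<in>{0..}. B j t \<omega>) (Pi\<^sub>M {0..} (\<lambda>_. borel)))"

text \<open>The labels are \<open>U 1, U 2, \<dots>\<close>; the value \<open>U 0\<close> plays no role.\<close>

locale bbb_process = prob_space M
  for M :: "'w measure" +
  fixes J :: "nat \<Rightarrow> 'w \<Rightarrow> real"
    and U :: "nat \<Rightarrow> 'w \<Rightarrow> 'n::finite"
    and B :: "'n \<Rightarrow> real \<Rightarrow> 'w \<Rightarrow> real ^ 'd::finite"
    and x :: "('d, 'n) config"
    and X :: "real \<Rightarrow> 'w \<Rightarrow> ('d, 'n) config"
  assumes jumps_ordered: "AE \<omega> in M. J 0 \<omega> = 0 \<and> strict_mono (\<lambda>i. J i \<omega>)"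
    and jumps_poisson: "poisson_point_process (real CARD('n)) (\<lambda>\<omega>. {J i \<omega> | i. i \<ge> 1})"
    and labels_uniform:
      "\<And>i. i \<ge> 1 \<Longrightarrow> distr M (count_space UNIV) (U i) = uniform_count_measure UNIV"
    and brownian: "\<And>j. std_brownian_motion_vec (B j)"
    and independent:
      "indep_sets (source_events M J U B) ({Jumps} \<union> Label ` {1..} \<union> range Motion)"
    and path: "AE \<omega> in M. bbb_path x (\<lambda>i. J i \<omega>) (\<lambda>i. U i \<omega>) (\<lambda>j t. B j t \<omega>) (\<lambda>t. X t \<omega>)"

end

theory Submission
  imports Defs
begin

text \<open>
  Let \<open>V\<close> be the sum of the squared distances to the barycenter. Between jumps its mean grows linearly.
  At a jump, duplicating a uniformly chosen particle multiplies \<open>V\<close> on average by \<open>1 + 1 / (N + 1)\<close>, and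
  the furthest of the \<open>N + 1\<close> particles contributes at least the average squared distance, so removing
  it multiplies \<open>V\<close> by at most \<open>1 - 1 / N\<close>. The product of the two factors is less than \<open>1\<close>. Hence,
  conditionally on the jump times, the mean of \<open>V\<close> at the jumps stays bounded along infinitely many
  gaps of length at least \<open>2\<close>, and by Fatou's lemma \<open>V\<close> itself is almost surely bounded along
  infinitely many of them.

  Within such a gap the particles are independent Brownian motions. For a fixed offset \<open>s\<close> the Gaussian
  density therefore bounds from below the probability that the centered configuration is in \<open>A\<close> at
  time \<open>s\<close> after the jump, and by a conditional Borel-Cantelli argument this happens in infinitely
  many gaps. Integrating over \<open>s\<close> between \<open>1 / 2\<close> and \<open>1\<close> shows that the occupation time is
  infinite. Using one offset for all gaps, only the Brownian increments over a fixed sequence of times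
  matter. For \<open>\<phi>\<close> one can take the image under centering of Lebesgue measure on the unit ball.
\<close>

text \<open>The main obstacle is the conditioning on the jump times. Independence of Brownian
  increments is given over deterministic sequences of times only, and the exceptional null sets
  depend on these times. So the jump times are replaced by an arbitrary fixed sequence satisfying
  \<open>good_times\<close>, and Fubini's theorem (\<open>AE_freeze\<close>) leads back to the
  random ones, which are independent of labels and motions. This exchange requires predicates that
  are measurable jointly in times and chance. Hence the motions are replaced by the version
  \<open>W\<close> and the configurations at jumps by the explicit functional
  \<open>skeleton\<close>, with which \<open>X\<close> is identified path by path only at the end.

  Once the times are fixed, the gaps are unbounded, and so may be the mean of \<open>V\<close> at
  the jumps. A bound along a subsequence is all that survives; it needs no more than a linear bound
  on the jump times along a subsequence, and Fatou's lemma supplies this from their means.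

  A gap of length at least \<open>2\<close> has room for every offset below \<open>1\<close>; the
  motion after the observation is what rules out ties.\<close>

subsection \<open>The geometry of a jump\<close>

text \<open>The parallel axis identity: the cross term contains the sum of the deviations from the
  barycenter, which vanishes. The reference point \<open>p\<close> is arbitrary because at a jump
  distances are measured from the barycenter of \<open>N + 1\<close> particles.\<close>

lemma norm_centered_sq:
  fixes y :: "('d::finite, 'n::finite) config"
  shows "(norm (centered y))\<^sup>2 =
    (\<Sum>j\<in>UNIV. (norm (y $ j - p))\<^sup>2) - real CARD('n) * (norm (barycenter y - p))\<^sup>2"
proof -
  let ?b = "barycenter y"
  have sum0: "(\<Sum>j\<in>UNIV. y $ j - ?b) = 0"
    by (simp add: barycenter_def sum_subtractf sum_constant_scaleR del: sum_constant)
  have "(norm (y $ j - p))\<^sup>2 =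
      (norm (y $ j - ?b))\<^sup>2 + 2 * ((y $ j - ?b) \<bullet> (?b - p)) + (norm (?b - p))\<^sup>2" for j
    unfolding power2_norm_eq_inner by (simp add: algebra_simps inner_commute)
  then have "(\<Sum>j\<in>UNIV. (norm (y $ j - p))\<^sup>2) =
      (\<Sum>j\<in>UNIV. (norm (y $ j - ?b))\<^sup>2) + 2 * ((\<Sum>j\<in>UNIV. y $ j - ?b) \<bullet> (?b - p)) +
      real CARD('n) * (norm (?b - p))\<^sup>2"
    by (simp add: sum.distrib inner_sum_left sum_distrib_left)
  moreover have "(norm (centered y))\<^sup>2 = (\<Sum>j\<in>UNIV. (norm (y $ j - ?b))\<^sup>2)"
    by (simp add: norm_vec_def L2_set_def centered_def sum_nonneg)
  ultimately show ?thesis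
    using sum0 by simp
qed

lemma linear_barycenter: "linear barycenter"
  by (rule linearI) (simp_all add: barycenter_def sum.distrib scaleR_add_right scaleR_sum_right mult.commute)

lemma linear_centered: "linear centered"
  by (rule linearI)
    (simp_all add: centered_def vec_eq_iff linear_add[OF linear_barycenter]
      linear_scale[OF linear_barycenter] right_diff_distrib)

lemma barycenter_centered: "barycenter (centered y) = 0"
proof -
  have "(\<Sum>j\<in>UNIV. centered y $ j) = (\<Sum>j\<in>UNIV. y $ j) - real CARD('b) *\<^sub>R barycenter y"
    by (simp add: centered_def sum_subtractf sum_constant_scaleR del: sum_constant)
  then show ?thesis
    by (simp add: barycenter_def)
qed

lemma centered_centered: "centered (centered y) = centered y"
  by (simp add: centered_def[of "centered y"] barycenter_centered vec_eq_iff)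

lemma norm_centered_le: "norm (centered y) \<le> norm y"
proof -
  have "(norm y)\<^sup>2 = (\<Sum>j\<in>UNIV. (norm (y $ j))\<^sup>2)"
    unfolding norm_vec_def[of y] L2_set_def by (simp add: sum_nonneg)
  then have "(norm (centered y))\<^sup>2 \<le> (norm y)\<^sup>2"
    using norm_centered_sq[of y 0] by simp
  then show ?thesis
    by (rule power2_le_imp_le) simp
qed

lemma continuous_centered: "continuous_on UNIV centered"
  by (rule linear_continuous_on[OF linear_centered[unfolded linear_conv_bounded_linear]])

lemma borel_measurable_centered [measurable]: "centered \<in> borel_measurable borel"
  by (rule borel_measurable_continuous_onI[OF continuous_centered])

text \<open>The inequality is strict, unlike the \<open>is_arg_max\<close> in
  \<open>bbb_path\<close>. This makes \<open>k\<close> unique, so that a jump becomes a function of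
  configuration and label.\<close>

definition farthest :: "('d::finite, 'n::finite) config \<Rightarrow> 'n \<Rightarrow> 'n \<Rightarrow> bool" where
  "farthest y u k \<longleftrightarrow> (\<forall>j. j \<noteq> k \<longrightarrow>
     norm (y $ j - barycenter_with_newborn y u) < norm (y $ k - barycenter_with_newborn y u))"

definition replace :: "('d::finite, 'n::finite) config \<Rightarrow> 'n \<Rightarrow> 'n \<Rightarrow> ('d, 'n) config" where
  "replace y u k = (\<chi> j. if j = k then y $ u else y $ j)"

text \<open>The value is the junk configuration \<open>0\<close> when the maximal distance is attained twice.\<close>

definition bee_jump :: "('d::finite, 'n::finite) config \<Rightarrow> 'n \<Rightarrow> ('d, 'n) config" where
  "bee_jump y u = (\<Sum>k\<in>UNIV. if farthest y u k then replace y u k else 0)"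

lemma farthest_unique:
  assumes "farthest y u k" "farthest y u l"
  shows "k = l"
proof (rule ccontr)
  assume "k \<noteq> l"
  then show False
    using assms[unfolded farthest_def, rule_format, of l] assms[unfolded farthest_def, rule_format, of k]
    by simp
qed

lemma bee_jump_eq:
  assumes "farthest y u k"
  shows "bee_jump y u = replace y u k"
proof -
  have "farthest y u l \<longleftrightarrow> l = k" for l
    using assms farthest_unique by blast
  then show ?thesis
    by (simp add: bee_jump_def)
qed

lemma sum_replace:
  fixes f :: "real ^ 'd::finite \<Rightarrow> 'b::ab_group_add"
  shows "(\<Sum>j\<in>UNIV. f (replace y u k $ j)) = (\<Sum>j\<in>UNIV. f (y $ j)) - f (y $ k) + f (y $ u)"
proof -
  have "(\<Sum>j\<in>UNIV - {k}. f (replace y u k $ j)) = (\<Sum>j\<in>UNIV - {k}. f (y $ j))"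
    by (intro sum.cong) (auto simp: replace_def)
  moreover have "f (replace y u k $ k) = f (y $ u)"
    by (simp add: replace_def)
  ultimately have "(\<Sum>j\<in>UNIV. f (replace y u k $ j)) = f (y $ u) + (\<Sum>j\<in>UNIV - {k}. f (y $ j))"
    by (metis finite_class.finite_UNIV UNIV_I sum.remove)
  moreover have "(\<Sum>j\<in>UNIV. f (y $ j)) = f (y $ k) + (\<Sum>j\<in>UNIV - {k}. f (y $ j))"
    by (rule sum.remove) auto
  ultimately show ?thesis
    by (metis add.commute add_diff_cancel_left')
qed

text \<open>Let \<open>T\<close> be the sum of the squared distances of all \<open>N + 1\<close>
  particles to their barycenter \<open>m\<close>. Duplicating \<open>u\<close> adds
  \<open>N / (N + 1)\<close> times its squared distance to the old barycenter. Deleting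
  \<open>k\<close> loses \<open>D\<close>, and a further \<open>D / N\<close> because the barycenter
  moves by \<open>(y $ k - m) / N\<close>. As \<open>D\<close> is at least the average
  \<open>T / (N + 1)\<close>, the total loss is at least \<open>T / N\<close>.\<close>

lemma norm_centered_replace:
  fixes y :: "('d::finite, 'n::finite) config"
  assumes k: "farthest y u k"
  shows "(norm (centered (replace y u k)))\<^sup>2 \<le> (1 - 1 / real CARD('n)) *
    ((norm (centered y))\<^sup>2 + real CARD('n) / (real CARD('n) + 1) * (norm (centered y $ u))\<^sup>2)"
proof -
  define N where "N = real CARD('n)"
  have N: "N \<ge> 1" unfolding N_def by simp
  define m where "m = barycenter_with_newborn y u"
  define D where "D = (norm (y $ k - m))\<^sup>2"
  define T where "T = (\<Sum>j\<in>UNIV. (norm (y $ j - m))\<^sup>2) + (norm (y $ u - m))\<^sup>2"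
  have le: "(norm (y $ j - m))\<^sup>2 \<le> D" for j
    using k unfolding farthest_def D_def m_def
    by (cases "j = k") (auto intro!: power_mono less_imp_le)
  have "T \<le> N * D + D"
    unfolding T_def using sum_bounded_above[of UNIV "\<lambda>j. (norm (y $ j - m))\<^sup>2" D] le
    by (auto simp: N_def intro!: add_mono)
  then have TD: "T / N \<le> D + D / N"
    using N by (simp add: field_simps)
  have sum_y: "(\<Sum>j\<in>UNIV. y $ j) = N *\<^sub>R barycenter y"
    by (simp add: barycenter_def N_def)
  have m: "m = (1 / (N + 1)) *\<^sub>R (y $ u + N *\<^sub>R barycenter y)"
    by (simp add: m_def barycenter_with_newborn_def sum_y N_def add.commute)
  define e where "e = centered y $ u"
  have u: "y $ u = barycenter y + e" by (simp add: e_def centered_def)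
  have m': "m = barycenter y + (1 / (N + 1)) *\<^sub>R e"
    unfolding m u using N
    by (simp add: algebra_simps add_divide_distrib[symmetric] flip: scaleR_add_left)
  have um: "y $ u - m = (N / (N + 1)) *\<^sub>R e"
  proof -
    have "N / (N + 1) = 1 - 1 / (N + 1)" using N by (simp add: field_simps)
    then show ?thesis unfolding u m' by (simp add: scaleR_left_diff_distrib)
  qed
  have bm: "barycenter y - m = - ((1 / (N + 1)) *\<^sub>R e)"
    unfolding m' by simp
  have "T = (norm (centered y))\<^sup>2 + N * (norm (barycenter y - m))\<^sup>2 + (norm (y $ u - m))\<^sup>2"
    unfolding T_def norm_centered_sq[of y m] N_def by simp
  also have "\<dots> = (norm (centered y))\<^sup>2 + (N * (1 / (N + 1))\<^sup>2 + (N / (N + 1))\<^sup>2) * (norm e)\<^sup>2"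
    unfolding bm um norm_minus_cancel norm_scaleR power_mult_distrib power2_abs
    by (simp add: distrib_right)
  also have "N * (1 / (N + 1))\<^sup>2 + (N / (N + 1))\<^sup>2 = N / (N + 1)"
  proof -
    have "N * (1 / (N + 1))\<^sup>2 + (N / (N + 1))\<^sup>2 = N * (N + 1) / ((N + 1) * (N + 1))"
      unfolding power_divide power2_eq_square by (simp add: add_divide_distrib[symmetric] algebra_simps)
    then show ?thesis using N by simp
  qed
  finally have T: "T = (norm (centered y))\<^sup>2 + N / (N + 1) * (norm e)\<^sup>2" .
  have "barycenter (replace y u k) = (1 / N) *\<^sub>R (N *\<^sub>R barycenter y - y $ k + y $ u)"
    unfolding barycenter_def[of "replace y u k"] N_def[symmetric]
    using sum_replace[of "\<lambda>z. z" y u k] sum_y by simp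
  also have "N *\<^sub>R barycenter y + y $ u = (N + 1) *\<^sub>R m"
    unfolding m using N by simp
  then have "N *\<^sub>R barycenter y - y $ k + y $ u = N *\<^sub>R m - (y $ k - m)"
    by (simp add: algebra_simps)
  finally have br: "barycenter (replace y u k) - m = - ((1 / N) *\<^sub>R (y $ k - m))"
    using N by (simp add: algebra_simps)
  have "(norm (centered (replace y u k)))\<^sup>2 = T - D - N * (norm (barycenter (replace y u k) - m))\<^sup>2"
    unfolding norm_centered_sq[of "replace y u k" m] T_def D_def N_def
    using sum_replace[of "\<lambda>z. (norm (z - m))\<^sup>2" y u k] by simp
  also have "\<dots> = T - (D + D / N)"
    unfolding br D_def norm_minus_cancel norm_scaleR power_mult_distrib power2_abs
    using N by (simp add: power2_eq_square)
  also have "\<dots> \<le> T - T / N"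
    using TD by simp
  finally show ?thesis
    unfolding T e_def N_def by (simp add: left_diff_distrib)
qed

text \<open>The factor \<open>1 - 1 / N\<close> of \<open>norm_centered_replace\<close> times
  \<open>1 + 1 / (N + 1)\<close>, which arises when its second term is averaged over
  \<open>u\<close>. The product is \<open>1 - 2 / (N * (N + 1))\<close>; for a single particle it is
  \<open>0\<close>.\<close>

definition contraction :: "'n::finite itself \<Rightarrow> real" where
  "contraction _ = (real CARD('n) - 1) * (real CARD('n) + 2) / (real CARD('n) * (real CARD('n) + 1))"

lemma contraction_bounds: "0 \<le> contraction TYPE('n::finite)" "contraction TYPE('n) < 1"
proof -
  define N where "N = real CARD('n)"
  have N: "N \<ge> 1" unfolding N_def by simp
  have "N * (N + 1) > 0" "(N - 1) * (N + 2) \<ge> 0"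
    using N by (auto intro!: mult_pos_pos mult_nonneg_nonneg simp del: distrib_left_numeral)
  moreover have "(N - 1) * (N + 2) < N * (N + 1)"
    by (simp add: algebra_simps)
  ultimately show "0 \<le> contraction TYPE('n::finite)" "contraction TYPE('n) < 1"
    unfolding contraction_def N_def[symmetric] by (auto intro: divide_nonneg_pos simp: divide_less_eq)
qed

lemma sum_norm_centered_bee_jump:
  fixes y :: "('d::finite, 'n::finite) config"
  shows "(\<Sum>u\<in>UNIV. (norm (centered (bee_jump y u)))\<^sup>2) \<le>
    real CARD('n) * contraction TYPE('n) * (norm (centered y))\<^sup>2"
proof -
  define N where "N = real CARD('n)"
  have N: "N \<ge> 1" unfolding N_def by simp
  have bound: "(norm (centered (bee_jump y u)))\<^sup>2 \<le> (1 - 1 / N) *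
    ((norm (centered y))\<^sup>2 + N / (N + 1) * (norm (centered y $ u))\<^sup>2)" (is "_ \<le> ?r u") for u
  proof (cases "\<exists>k. farthest y u k")
    case True
    then show ?thesis
      using norm_centered_replace bee_jump_eq unfolding N_def by metis
  next
    \<comment> \<open>At a tie the junk value \<open>0\<close> has centered norm \<open>0\<close>,
      so the bound persists.\<close>
    case False
    then have "bee_jump y u = 0" by (simp add: bee_jump_def)
    then show ?thesis
      using N by (simp add: linear_0[OF linear_centered])
  qed
  have "(\<Sum>u\<in>UNIV. (norm (centered (bee_jump y u)))\<^sup>2) \<le> (\<Sum>u\<in>UNIV. ?r u)"
    by (intro sum_mono bound)
  also have "\<dots> = (1 - 1 / N) *
      (N * (norm (centered y))\<^sup>2 + N / (N + 1) * (\<Sum>u\<in>UNIV. (norm (centered y $ u))\<^sup>2))"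
    by (simp only: sum_distrib_left[symmetric] sum.distrib) (simp add: N_def)
  also have "(\<Sum>u\<in>UNIV. (norm (centered y $ u))\<^sup>2) = (norm (centered y))\<^sup>2"
    by (simp add: norm_vec_def L2_set_def sum_nonneg)
  also have "(1 - 1 / N) * (N * (norm (centered y))\<^sup>2 + N / (N + 1) * (norm (centered y))\<^sup>2) =
      N * ((N - 1) * (N + 2) / (N * (N + 1))) * (norm (centered y))\<^sup>2"
    using N by (simp add: field_simps)
  finally show ?thesis
    unfolding contraction_def N_def .
qed

section \<open>Measurability of the jump map\<close>

lemma borel_measurable_barycenter_with_newborn [measurable]:
  "(\<lambda>y. barycenter_with_newborn y u) \<in> borel_measurable borel"
  unfolding barycenter_with_newborn_def
  by (intro borel_measurable_continuous_onI continuous_intros)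

lemma measurable_bee_jump [measurable]:
  "(\<lambda>(y, u). bee_jump y u) \<in> (borel :: ('d::finite, 'n::finite) config measure) \<Otimes>\<^sub>M count_space UNIV \<rightarrow>\<^sub>M borel"
proof -
  have [measurable]: "(\<lambda>y :: ('d, 'n) config. y $ j) \<in> borel_measurable borel" for j
    by (intro borel_measurable_continuous_onI continuous_intros)
  have [measurable]: "(\<lambda>y :: ('d, 'n) config. replace y u k) \<in> borel_measurable borel" for u k
  proof -
    have "continuous_on UNIV (\<lambda>y :: ('d, 'n) config. if j = k then y $ u else y $ j)" for j
      by (cases "j = k") (auto intro!: continuous_intros)
    then show ?thesis
      unfolding replace_def
      by (intro borel_measurable_continuous_onI continuous_on_vec_lambda)
  qed
  have [measurable]: "Measurable.pred borel (\<lambda>y :: ('d, 'n) config. farthest y u k)" for u k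
  proof -
    have "farthest y u k \<longleftrightarrow> (\<forall>j\<in>UNIV - {k}. norm (y $ j - barycenter_with_newborn y u) <
        norm (y $ k - barycenter_with_newborn y u))" for y :: "('d, 'n) config"
      by (auto simp: farthest_def)
    then show ?thesis
      by (simp only:) (intro pred_intros_finite, simp, measurable)
  qed
  have *: "(\<lambda>y :: ('d, 'n) config. bee_jump y u) \<in> borel_measurable borel" for u
    unfolding bee_jump_def
    by (intro borel_measurable_sum measurable_If) measurable
  have "(\<lambda>p :: ('d, 'n) config \<times> 'n. bee_jump (fst p) (snd p)) \<in> borel \<Otimes>\<^sub>M count_space UNIV \<rightarrow>\<^sub>M borel"
    by (rule measurable_compose_countable[where f = "\<lambda>u p. bee_jump (fst p) u"])
       (rule measurable_compose[OF measurable_fst *], rule measurable_snd)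
  then show ?thesis
    unfolding split_beta' .
qed

lemma measurable_bee_jump_compose [measurable (raw)]:
  assumes "f \<in> N \<rightarrow>\<^sub>M borel" "g \<in> N \<rightarrow>\<^sub>M count_space UNIV"
  shows "(\<lambda>p. bee_jump (f p :: ('d::finite, 'n::finite) config) (g p)) \<in> N \<rightarrow>\<^sub>M borel"
  using measurable_compose[OF measurable_Pair[OF assms] measurable_bee_jump] by simp

subsection \<open>Ties are negligible\<close>

text \<open>By translation invariance the measure of \<open>A\<close> is also the average over
  \<open>t\<close> in the unit interval of the measures of its translates along \<open>e\<close>.
  After exchanging the integrals, the inner one runs over countably many \<open>t\<close> and
  vanishes. This avoids splitting the space into a line and a complement.\<close>

lemma null_sets_lborel_lines:
  fixes A :: "'a::euclidean_space set"
  assumes [measurable]: "A \<in> sets borel" and lines: "\<And>y. countable {t. y + t *\<^sub>R e \<in> A}"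
  shows "A \<in> null_sets lborel"
proof -
  have shift: "(\<integral>\<^sup>+y. indicator A (y + t *\<^sub>R e) \<partial>lborel) = emeasure lborel A" for t :: real
  proof -
    have "emeasure lborel A = (\<integral>\<^sup>+y. indicator A y \<partial>distr lborel borel ((+) (t *\<^sub>R e)))"
      by (simp add: lborel_distr_plus)
    also have "\<dots> = (\<integral>\<^sup>+y. indicator A (y + t *\<^sub>R e) \<partial>lborel)"
      by (subst nn_integral_distr) (simp_all add: add.commute)
    finally show ?thesis ..
  qed
  have "emeasure lborel A = (\<integral>\<^sup>+t. emeasure lborel A * indicator {0..1::real} t \<partial>lborel)"
    by (subst nn_integral_cmult_indicator) auto
  also have "\<dots> = (\<integral>\<^sup>+t. (\<integral>\<^sup>+y. indicator A (y + t *\<^sub>R e) * indicator {0..1} t \<partial>lborel) \<partial>lborel)"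
    by (subst nn_integral_multc) (simp_all add: shift)
  also have "\<dots> = (\<integral>\<^sup>+y. (\<integral>\<^sup>+t. indicator A (y + t *\<^sub>R e) * indicator {0..1} t \<partial>lborel) \<partial>lborel)"
    by (rule lborel_pair.Fubini') measurable
  also have "\<dots> = (\<integral>\<^sup>+y. 0 \<partial>(lborel :: 'a measure))"
  proof (intro nn_integral_cong)
    fix y :: 'a
    have "AE t in lborel. y + t *\<^sub>R e \<notin> A"
      using lines[of y] countable_imp_null_set_lborel AE_not_in by fastforce
    then have "AE t in lborel. indicator A (y + t *\<^sub>R e) * indicator {0..1} t = (0 :: ennreal)"
      by eventually_elim simp
    then show "(\<integral>\<^sup>+t. indicator A (y + t *\<^sub>R e) * indicator {0..1} t \<partial>lborel) = 0"
      by (subst nn_integral_0_iff_AE) auto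
  qed
  finally show ?thesis by (auto simp: null_sets_def)
qed

definition tie :: "('d::finite, 'n::finite) config \<Rightarrow> 'n \<Rightarrow> 'n \<Rightarrow> 'n \<Rightarrow> bool" where
  "tie y u j k \<longleftrightarrow> norm (y $ j - barycenter_with_newborn y u) = norm (y $ k - barycenter_with_newborn y u)"

lemma borel_measurable_vec_component [measurable]:
  "(\<lambda>y :: 'a::euclidean_space ^ 'n. y $ j) \<in> borel_measurable borel"
  by (intro borel_measurable_continuous_onI continuous_intros)

text \<open>When only particle \<open>k\<close> moves along a line, a tie is a quadratic equation with nonzero leading term.\<close>

lemma null_sets_tie_aux:
  fixes u :: "'n::finite"
  assumes jk: "j \<noteq> k" and ku: "k \<noteq> u"
  shows "{y :: ('d::finite, 'n) config. tie y u j k} \<in> null_sets lborel"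
proof (rule null_sets_lborel_lines)
  show "{y :: ('d, 'n) config. tie y u j k} \<in> sets borel"
    unfolding tie_def by measurable
  define v :: "real ^ 'd" where "v = (\<chi> i. 1)"
  define e :: "('d, 'n) config" where "e = axis k v"
  \<comment> \<open>\<open>a\<close> is the share of the displacement of \<open>k\<close> that the
    barycenter takes up: as \<open>k\<close> differs from \<open>u\<close>, it occurs once among the
    \<open>N + 1\<close> particles. Relative to the barycenter, \<open>j\<close> moves by
    \<open>- a v\<close> and \<open>k\<close> by \<open>(1 - a) v\<close>, so the leading
    coefficient is \<open>a^2 - (1 - a)^2 = 2 a - 1\<close> times \<open>v \<bullet> v\<close>. It
    is nonzero because two distinct particles force \<open>N \<ge> 2\<close>.\<close>
  define a where "a = 1 / (real CARD('n) + 1)"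
  have "card {j, k} \<le> CARD('n)"
    by (rule card_mono) auto
  then have "2 * a < 1"
    using jk by (simp add: a_def divide_simps)
  have "v \<noteq> 0"
    by (simp add: v_def vec_eq_iff)
  fix y :: "('d, 'n) config"
  define m where "m = barycenter_with_newborn y u"
  define w where "w = y $ j - m"
  define z where "z = y $ k - m"
  have m: "barycenter_with_newborn (y + t *\<^sub>R e) u = m + (t * a) *\<^sub>R v" for t
    using ku by (simp add: barycenter_with_newborn_def m_def e_def a_def axis_def sum.distrib
        algebra_simps if_distrib[of "\<lambda>x. _ *\<^sub>R x"] cong: if_cong)
  have e: "e $ j = 0" "e $ k = v"
    using jk by (simp_all add: e_def axis_def)
  have eq: "tie (y + t *\<^sub>R e) u j k \<longleftrightarrow>
      poly [:w \<bullet> w - z \<bullet> z, - 2 * (a * (w \<bullet> v) + (1 - a) * (z \<bullet> v)), (2 * a - 1) * (v \<bullet> v):] t = 0" for t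
  proof -
    have "(y + t *\<^sub>R e) $ j - barycenter_with_newborn (y + t *\<^sub>R e) u = w - (t * a) *\<^sub>R v"
      by (simp add: m w_def e)
    moreover have "(y + t *\<^sub>R e) $ k - barycenter_with_newborn (y + t *\<^sub>R e) u = z + (t * (1 - a)) *\<^sub>R v"
      by (simp add: m z_def e algebra_simps)
    ultimately have "tie (y + t *\<^sub>R e) u j k \<longleftrightarrow>
        (w - (t * a) *\<^sub>R v) \<bullet> (w - (t * a) *\<^sub>R v) =
        (z + (t * (1 - a)) *\<^sub>R v) \<bullet> (z + (t * (1 - a)) *\<^sub>R v)"
      unfolding tie_def by (simp add: norm_eq)
    then show ?thesis
      by (simp add: inner_commute algebra_simps power2_eq_square)
  qed
  have "[:w \<bullet> w - z \<bullet> z, - 2 * (a * (w \<bullet> v) + (1 - a) * (z \<bullet> v)), (2 * a - 1) * (v \<bullet> v):] \<noteq> 0"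
    using \<open>2 * a < 1\<close> \<open>v \<noteq> 0\<close> by simp
  then show "countable {t. y + t *\<^sub>R e \<in> {y. tie y u j k}}"
    unfolding mem_Collect_eq eq by (intro countable_finite poly_roots_finite)
qed

text \<open>Ties are symmetric in \<open>j\<close> and \<open>k\<close>, and at most one of the two
  is \<open>u\<close>, so the other one can be moved. Moving \<open>u\<close> itself would count
  twice in the barycenter, and for \<open>N = 3\<close> the leading coefficient would
  cancel.\<close>

lemma null_sets_tie:
  fixes u :: "'n::finite"
  assumes "j \<noteq> k"
  shows "{y :: ('d::finite, 'n) config. tie y u j k} \<in> null_sets lborel"
proof (cases "k = u")
  case True
  then have "{y :: ('d, 'n) config. tie y u k j} \<in> null_sets lborel"
    using assms by (intro null_sets_tie_aux) auto
  then show ?thesis by (simp add: tie_def eq_commute)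
qed (use assms null_sets_tie_aux in blast)

lemma ex_farthest:
  assumes "\<And>j k. j \<noteq> k \<Longrightarrow> \<not> tie y u j k"
    and "is_arg_max (\<lambda>j. norm (y $ j - barycenter_with_newborn y u)) (\<lambda>_. True) k"
  shows "farthest y u k"
  using assms unfolding farthest_def tie_def is_arg_max_def
  by (metis linorder_less_linear)

subsection \<open>Gaussian measures\<close>

text \<open>\<open>v\<close> is the variance of each coordinate, that is, the elapsed time of the
  motion. The product form mirrors the construction of \<open>lborel\<close>, from which
  \<open>gauss_eq_density\<close> reads off the density.\<close>

definition gauss :: "real \<Rightarrow> 'a::euclidean_space measure" where
  "gauss v = distr (\<Pi>\<^sub>M b\<in>Basis. density lborel (normal_density 0 (sqrt v))) borel
     (\<lambda>f. \<Sum>b\<in>Basis. f b *\<^sub>R b)"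

lemma sets_gauss [simp, measurable_cong]: "sets (gauss v) = sets borel"
  by (simp add: gauss_def)

lemma space_gauss [simp]: "space (gauss v) = UNIV"
  by (simp add: gauss_def)

lemma measurable_sum_Basis:
  assumes "\<And>b. b \<in> Basis \<Longrightarrow> sets (N b) = sets (borel :: real measure)"
  shows "(\<lambda>f. \<Sum>b\<in>Basis. f b *\<^sub>R b) \<in> PiM Basis N \<rightarrow>\<^sub>M (borel :: 'a::euclidean_space measure)"
proof (intro borel_measurable_sum borel_measurable_scaleR borel_measurable_const)
  fix b :: 'a assume "b \<in> Basis"
  then show "(\<lambda>f. f b) \<in> borel_measurable (PiM Basis N)"
    using measurable_component_singleton[of b Basis N] assms[of b] by (simp cong: measurable_cong_sets)
qed

lemma prob_space_gauss:
  assumes "0 < v"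
  shows "prob_space (gauss v)"
  unfolding gauss_def using assms
  by (intro prob_space.prob_space_distr prob_space_PiM prob_space_normal_density measurable_sum_Basis)
     auto

lemma PiM_density:
  fixes f :: "real \<Rightarrow> ennreal"
  assumes "finite I" and [measurable]: "f \<in> borel_measurable borel"
    and "sigma_finite_measure (density lborel f)"
  shows "(\<Pi>\<^sub>M i\<in>I. density lborel f) = density (\<Pi>\<^sub>M i\<in>I. lborel) (\<lambda>x. \<Prod>i\<in>I. f (x i))"
proof -
  interpret L: product_sigma_finite "\<lambda>_. lborel :: real measure"
    by standard
  interpret D: product_sigma_finite "\<lambda>_. density lborel f"
    using assms(3) by (simp add: product_sigma_finite_def)
  have [measurable]: "(\<lambda>x. \<Prod>i\<in>I. f (x i)) \<in> borel_measurable (\<Pi>\<^sub>M i\<in>I. lborel)"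
    by (intro borel_measurable_prod_ennreal) measurable
  show ?thesis
  proof (rule D.PiM_eqI[symmetric, OF \<open>finite I\<close>])
    show "sets (density (\<Pi>\<^sub>M i\<in>I. lborel) (\<lambda>x. \<Prod>i\<in>I. f (x i))) = sets (\<Pi>\<^sub>M i\<in>I. density lborel f)"
      by (simp cong: sets_PiM_cong)
  next
    fix A assume A: "\<And>i. i \<in> I \<Longrightarrow> A i \<in> sets (density lborel f)"
    then have [measurable]: "Pi\<^sub>E I A \<in> sets (\<Pi>\<^sub>M i\<in>I. lborel)"
      using \<open>finite I\<close> by (intro sets_PiM_I_finite) auto
    have "emeasure (density (\<Pi>\<^sub>M i\<in>I. lborel) (\<lambda>x. \<Prod>i\<in>I. f (x i))) (Pi\<^sub>E I A) =
        (\<integral>\<^sup>+x. (\<Prod>i\<in>I. f (x i)) * indicator (Pi\<^sub>E I A) x \<partial>(\<Pi>\<^sub>M i\<in>I. lborel))"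
      by (subst emeasure_density) auto
    also have "\<dots> = (\<integral>\<^sup>+x. (\<Prod>i\<in>I. f (x i) * indicator (A i) (x i)) \<partial>(\<Pi>\<^sub>M i\<in>I. lborel))"
    proof (rule nn_integral_cong)
      fix x assume "x \<in> space (\<Pi>\<^sub>M i\<in>I. lborel :: real measure)"
      then have "indicator (Pi\<^sub>E I A) x = (\<Prod>i\<in>I. indicator (A i) (x i) :: ennreal)"
        using \<open>finite I\<close>
        by (auto simp: indicator_def space_PiM PiE_iff prod_zero_iff intro!: prod.neutral[symmetric])
      then show "(\<Prod>i\<in>I. f (x i)) * indicator (Pi\<^sub>E I A) x = (\<Prod>i\<in>I. f (x i) * indicator (A i) (x i))"
        by (simp add: prod.distrib)
    qed
    also have "\<dots> = (\<Prod>i\<in>I. \<integral>\<^sup>+x. f x * indicator (A i) x \<partial>lborel)"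
      using A \<open>finite I\<close> by (intro L.product_nn_integral_prod) auto
    also have "\<dots> = (\<Prod>i\<in>I. emeasure (density lborel f) (A i))"
      using A by (intro prod.cong) (auto simp: emeasure_density)
    finally show "emeasure (density (\<Pi>\<^sub>M i\<in>I. lborel) (\<lambda>x. \<Prod>i\<in>I. f (x i))) (Pi\<^sub>E I A) =
        (\<Prod>i\<in>I. emeasure (density lborel f) (A i))" .
  qed
qed

lemma lborel_eq_distr_PiM:
  "(lborel :: 'a::euclidean_space measure) = distr (\<Pi>\<^sub>M b\<in>Basis. lborel) borel (\<lambda>f. \<Sum>b\<in>Basis. f b *\<^sub>R b)"
  by (subst lborel_def) (simp add: lborel_eq_real)

lemma gauss_eq_density:
  assumes v: "0 < v"
  shows "(gauss v :: 'a::euclidean_space measure) =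
    density lborel (\<lambda>y. \<Prod>b\<in>Basis. ennreal (normal_density 0 (sqrt v) (y \<bullet> b)))"
proof -
  let ?n = "\<lambda>x. ennreal (normal_density 0 (sqrt v) x)"
  let ?T = "\<lambda>f. \<Sum>b\<in>(Basis :: 'a set). f b *\<^sub>R b"
  have "gauss v = distr (density (\<Pi>\<^sub>M b\<in>(Basis :: 'a set). lborel) (\<lambda>x. \<Prod>b\<in>Basis. ?n (x b))) borel ?T"
    unfolding gauss_def using v
    by (subst PiM_density) (auto intro!: prob_space_imp_sigma_finite prob_space_normal_density)
  also have "density (\<Pi>\<^sub>M b\<in>(Basis :: 'a set). lborel) (\<lambda>x. \<Prod>b\<in>Basis. ?n (x b)) =
      density (\<Pi>\<^sub>M b\<in>(Basis :: 'a set). lborel) ((\<lambda>y. \<Prod>b\<in>Basis. ?n (y \<bullet> b)) \<circ> ?T)"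
    by (intro arg_cong[where f = "density _"] ext) (simp add: inner_sum_left_Basis)
  also have "distr \<dots> borel ?T = density (distr (\<Pi>\<^sub>M b\<in>(Basis :: 'a set). lborel) borel ?T) (\<lambda>y. \<Prod>b\<in>Basis. ?n (y \<bullet> b))"
    unfolding comp_def by (rule density_distr[symmetric]) (auto intro!: measurable_sum_Basis borel_measurable_prod_ennreal)
  also have "distr (\<Pi>\<^sub>M b\<in>(Basis :: 'a set). lborel) borel ?T = lborel"
    by (rule lborel_eq_distr_PiM[symmetric])
  finally show ?thesis .
qed

lemma null_sets_gauss:
  assumes "0 < v" "A \<in> null_sets lborel"
  shows "A \<in> null_sets (gauss v)"
  using assms absolutely_continuousI_density[of "\<lambda>y. \<Prod>b\<in>Basis. ennreal (normal_density 0 (sqrt v) (y \<bullet> b))" lborel]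
  by (auto simp: gauss_eq_density absolutely_continuous_def intro!: borel_measurable_prod_ennreal)

text \<open>On the ball every coordinate is at most \<open>r\<close> in absolute value, and the
  one-dimensional density decreases in the absolute value. So each factor of the density is at least
  its value at \<open>r\<close>.\<close>

lemma gauss_lower_bound:
  fixes D :: "'a::euclidean_space set"
  assumes v: "0 < v" and [measurable]: "D \<in> sets borel" and D: "D \<subseteq> cball 0 r"
  shows "ennreal (normal_density 0 (sqrt v) r ^ DIM('a)) * emeasure lborel D \<le> emeasure (gauss v) D"
proof -
  have "ennreal (normal_density 0 (sqrt v) r ^ DIM('a)) \<le> (\<Prod>b\<in>Basis. ennreal (normal_density 0 (sqrt v) (y \<bullet> b)))"
    if "y \<in> D" for y
  proof -
    have "normal_density 0 (sqrt v) r \<le> normal_density 0 (sqrt v) (y \<bullet> b)" if "b \<in> Basis" for b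
    proof -
      have "\<bar>y \<bullet> b\<bar> \<le> r"
        using D \<open>y \<in> D\<close> Basis_le_norm[OF that, of y] by auto
      then have "(y \<bullet> b)\<^sup>2 \<le> r\<^sup>2"
        by (rule power2_le_iff_abs_le[THEN iffD2, rotated]) (use \<open>\<bar>y \<bullet> b\<bar> \<le> r\<close> in linarith)
      then show ?thesis
        using v by (auto simp: normal_density_def intro!: mult_left_mono divide_right_mono)
    qed
    then have "(\<Prod>b\<in>(Basis :: 'a set). normal_density 0 (sqrt v) r) \<le> (\<Prod>b\<in>Basis. normal_density 0 (sqrt v) (y \<bullet> b))"
      by (intro prod_mono) auto
    then show ?thesis
      by (simp add: prod_ennreal ennreal_leI)
  qed
  then have "(\<integral>\<^sup>+y. ennreal (normal_density 0 (sqrt v) r ^ DIM('a)) * indicator D y \<partial>lborel) \<le>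
      (\<integral>\<^sup>+y. (\<Prod>b\<in>Basis. ennreal (normal_density 0 (sqrt v) (y \<bullet> b))) * indicator D y \<partial>lborel)"
    by (intro nn_integral_mono) (auto simp: indicator_def)
  then show ?thesis
    using v by (simp add: gauss_eq_density emeasure_density nn_integral_cmult_indicator borel_measurable_prod_ennreal)
qed

lemma nn_integral_gauss_norm_sq:
  assumes v: "0 < v"
  shows "(\<integral>\<^sup>+y. ennreal ((norm y)\<^sup>2) \<partial>(gauss v :: 'a::euclidean_space measure)) = ennreal (real DIM('a) * v)"
proof -
  let ?N = "density lborel (normal_density 0 (sqrt v))"
  let ?P = "\<Pi>\<^sub>M b\<in>(Basis :: 'a set). ?N"
  have second: "(\<integral>\<^sup>+x. ennreal (x\<^sup>2) \<partial>?N) = ennreal v"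
  proof -
    have "has_bochner_integral lborel (\<lambda>x. normal_density 0 (sqrt v) x * x\<^sup>2) v"
      using normal_moment_even[of "sqrt v" 0 1] v by (simp add: fact_numeral)
    then have "(\<integral>\<^sup>+x. ennreal (normal_density 0 (sqrt v) x * x\<^sup>2) \<partial>lborel) = ennreal v"
      using nn_integral_eq_integral[of lborel "\<lambda>x. normal_density 0 (sqrt v) x * x\<^sup>2"]
      by (simp add: has_bochner_integral_iff)
    then show ?thesis
      by (simp add: nn_integral_density ennreal_mult')
  qed
  have comp: "(\<integral>\<^sup>+f. ennreal ((f b)\<^sup>2) \<partial>?P) = ennreal v" if "b \<in> Basis" for b :: 'a
  proof -
    have "distr ?P ?N (\<lambda>f. f b) = ?N"
      using that v by (intro distr_PiM_component prob_space_normal_density) auto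
    then have "(\<integral>\<^sup>+x. ennreal (x\<^sup>2) \<partial>?N) = (\<integral>\<^sup>+x. ennreal (x\<^sup>2) \<partial>distr ?P ?N (\<lambda>f. f b))"
      by simp
    also have "\<dots> = (\<integral>\<^sup>+f. ennreal ((f b)\<^sup>2) \<partial>?P)"
      using that by (intro nn_integral_distr) auto
    finally show ?thesis using second by simp
  qed
  have meas: "(\<lambda>f. ennreal ((f b)\<^sup>2)) \<in> borel_measurable ?P" if "b \<in> Basis" for b :: 'a
    using measurable_compose[OF measurable_component_singleton[OF that, of "\<lambda>_. ?N"], of "\<lambda>x. ennreal (x\<^sup>2)" borel]
    by simp
  have "(\<integral>\<^sup>+y. ennreal ((norm y)\<^sup>2) \<partial>(gauss v :: 'a measure)) = (\<integral>\<^sup>+f. ennreal ((norm (\<Sum>b\<in>(Basis :: 'a set). f b *\<^sub>R b))\<^sup>2) \<partial>?P)"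
    unfolding gauss_def by (intro nn_integral_distr) (auto intro!: measurable_sum_Basis)
  also have "\<dots> = (\<integral>\<^sup>+f. (\<Sum>b\<in>(Basis :: 'a set). ennreal ((f b)\<^sup>2)) \<partial>?P)"
  proof (rule nn_integral_cong)
    fix f :: "'a \<Rightarrow> real"
    have "(norm (\<Sum>b\<in>(Basis :: 'a set). f b *\<^sub>R b))\<^sup>2 = (\<Sum>b\<in>(Basis :: 'a set). (f b)\<^sup>2)"
      unfolding power2_norm_eq_inner by (subst euclidean_inner) (simp add: inner_sum_left_Basis power2_eq_square)
    then show "ennreal ((norm (\<Sum>b\<in>(Basis :: 'a set). f b *\<^sub>R b))\<^sup>2) = (\<Sum>b\<in>Basis. ennreal ((f b)\<^sup>2))"
      by (simp add: sum_ennreal)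
  qed
  also have "\<dots> = (\<Sum>b\<in>(Basis :: 'a set). ennreal v)"
    by (subst nn_integral_sum) (auto simp: comp meas simp del: sum_constant intro!: sum.cong)
  also have "\<dots> = ennreal (real DIM('a) * v)"
    using v by (simp add: ennreal_mult' flip: ennreal_of_nat_eq_real_of_nat)
  finally show ?thesis .
qed

lemma nn_integral_gauss_uminus:
  fixes f :: "'a::euclidean_space \<Rightarrow> ennreal"
  assumes v: "0 < v" and [measurable]: "f \<in> borel_measurable borel"
  shows "(\<integral>\<^sup>+y. f (- y) \<partial>gauss v) = (\<integral>\<^sup>+y. f y \<partial>gauss v)"
proof -
  let ?g = "\<lambda>y::'a. \<Prod>b\<in>Basis. ennreal (normal_density 0 (sqrt v) (y \<bullet> b))"
  have [measurable]: "?g \<in> borel_measurable borel"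
    by (intro borel_measurable_prod_ennreal) measurable
  have "lborel = distr lborel borel (\<lambda>x::'a. - x)"
    using lborel_affine[of "-1" "0::'a"] by (simp add: density_1)
  then have "(\<integral>\<^sup>+y. ?g y * f y \<partial>lborel) = (\<integral>\<^sup>+y. ?g y * f y \<partial>distr lborel borel (\<lambda>x::'a. - x))"
    by simp
  also have "\<dots> = (\<integral>\<^sup>+y. ?g (- y) * f (- y) \<partial>lborel)"
    by (intro nn_integral_distr) auto
  also have "(\<lambda>y. ?g (- y)) = ?g"
    by (simp add: normal_density_def fun_eq_iff)
  finally show ?thesis
    using v by (simp add: gauss_eq_density nn_integral_density fun_eq_iff)
qed

text \<open>The Gaussian law is symmetric, so \<open>y\<close> and \<open>- y\<close> may be
  averaged. The parallelogram law then removes the cross term, whose sign is indefinite and which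
  would not fit into a nonnegative integral.\<close>

lemma nn_integral_gauss_norm_centered:
  fixes z :: "('d::finite, 'n::finite) config"
  assumes v: "0 < v"
  shows "(\<integral>\<^sup>+y. ennreal ((norm (centered (z + y)))\<^sup>2) \<partial>gauss v) \<le>
    ennreal ((norm (centered z))\<^sup>2 + real DIM(('d, 'n) config) * v)"
proof -
  interpret prob_space "gauss v :: ('d, 'n) config measure"
    using v by (rule prob_space_gauss)
  let ?I = "\<integral>\<^sup>+y. ennreal ((norm (centered (z + y)))\<^sup>2) \<partial>gauss v"
  have "?I = (\<integral>\<^sup>+y. ennreal ((norm (centered (z - y)))\<^sup>2) \<partial>gauss v)"
    using nn_integral_gauss_uminus[OF v, of "\<lambda>y. ennreal ((norm (centered (z + y)))\<^sup>2)"] by simp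
  then have "2 * ?I = ?I + (\<integral>\<^sup>+y. ennreal ((norm (centered (z - y)))\<^sup>2) \<partial>gauss v)"
    by (simp add: mult_2)
  also have "\<dots> = (\<integral>\<^sup>+y. ennreal ((norm (centered (z + y)))\<^sup>2) + ennreal ((norm (centered (z - y)))\<^sup>2) \<partial>gauss v)"
    by (rule nn_integral_add[symmetric]) auto
  also have "\<dots> \<le> (\<integral>\<^sup>+y. 2 * (ennreal ((norm (centered z))\<^sup>2) + ennreal ((norm y)\<^sup>2)) \<partial>(gauss v :: ('d, 'n) config measure))"
  proof (intro nn_integral_mono)
    fix y :: "('d, 'n) config"
    have "(norm (centered (z + y)))\<^sup>2 + (norm (centered (z - y)))\<^sup>2 = 2 * ((norm (centered z))\<^sup>2 + (norm (centered y))\<^sup>2)"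
      unfolding linear_add[OF linear_centered] linear_diff[OF linear_centered] power2_norm_eq_inner
      by (simp add: algebra_simps inner_commute)
    also have "\<dots> \<le> 2 * ((norm (centered z))\<^sup>2 + (norm y)\<^sup>2)"
      using norm_centered_le[of y] by (simp add: power_mono)
    finally show "ennreal ((norm (centered (z + y)))\<^sup>2) + ennreal ((norm (centered (z - y)))\<^sup>2) \<le>
        2 * (ennreal ((norm (centered z))\<^sup>2) + ennreal ((norm y)\<^sup>2))"
      by (simp add: ennreal_leI flip: ennreal_plus ennreal_numeral ennreal_mult)
  qed
  also have "\<dots> = 2 * (ennreal ((norm (centered z))\<^sup>2) + ennreal (real DIM(('d, 'n) config) * v))"
    by (simp add: nn_integral_cmult nn_integral_add nn_integral_gauss_norm_sq[OF v] emeasure_space_1[simplified])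
  finally have "2 * ?I \<le> 2 * ennreal ((norm (centered z))\<^sup>2 + real DIM(('d, 'n) config) * v)"
    using v by simp
  then show ?thesis
    by (simp add: ennreal_mult_le_mult_iff)
qed

lemma (in prob_space) distr_eq_gauss:
  fixes X :: "'a \<Rightarrow> 'b::euclidean_space"
  assumes [measurable]: "random_variable borel X"
    and indep: "indep_vars (\<lambda>_. borel) (\<lambda>b \<omega>. X \<omega> \<bullet> b) Basis"
    and normal: "\<And>b. b \<in> Basis \<Longrightarrow> distributed M lborel (\<lambda>\<omega>. X \<omega> \<bullet> b) (normal_density 0 (sqrt v))"
  shows "distr M borel X = gauss v"
proof -
  let ?T = "\<lambda>f. \<Sum>b\<in>(Basis :: 'b set). f b *\<^sub>R b"
  have "distr M borel X = distr M borel (?T \<circ> (\<lambda>\<omega>. \<lambda>b\<in>Basis. X \<omega> \<bullet> b))"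
    by (intro distr_cong) (auto simp: euclidean_representation)
  also have "\<dots> = distr (distr M (\<Pi>\<^sub>M b\<in>Basis. borel) (\<lambda>\<omega>. \<lambda>b\<in>Basis. X \<omega> \<bullet> b)) borel ?T"
    by (rule distr_distr[symmetric]) (auto intro!: measurable_sum_Basis)
  also have "distr M (\<Pi>\<^sub>M b\<in>Basis. borel) (\<lambda>\<omega>. \<lambda>b\<in>Basis. X \<omega> \<bullet> b) = (\<Pi>\<^sub>M b\<in>Basis. distr M borel (\<lambda>\<omega>. X \<omega> \<bullet> b))"
    using indep by (subst (asm) indep_vars_iff_distr_eq_PiM') auto
  also have "\<dots> = (\<Pi>\<^sub>M b\<in>(Basis :: 'b set). density lborel (normal_density 0 (sqrt v)))"
  proof (rule PiM_cong[OF refl])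
    fix b :: 'b assume "b \<in> Basis"
    then have "distr M lborel (\<lambda>\<omega>. X \<omega> \<bullet> b) = density lborel (normal_density 0 (sqrt v))"
      by (rule distributed_distr_eq_density[OF normal])
    then show "distr M borel (\<lambda>\<omega>. X \<omega> \<bullet> b) = density lborel (normal_density 0 (sqrt v))"
      by (simp cong: distr_cong)
  qed
  finally show ?thesis
    by (simp add: gauss_def)
qed

subsection \<open>Independence\<close>

text \<open>A finite intersection is factored first over the groups and then inside each group;
  \<open>G i\<close> is a \<sigma>-algebra so that it contains the partial intersections. This joins
  the separate independence assumptions on sources, coordinates and increments.\<close>

lemma (in prob_space) indep_sets_nested:
  assumes outer: "indep_sets G I"
    and inner: "\<And>i. i \<in> I \<Longrightarrow> indep_sets (F i) (K i)"
    and sub: "\<And>i k. i \<in> I \<Longrightarrow> k \<in> K i \<Longrightarrow> F i k \<subseteq> G i"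
    and sigma: "\<And>i. i \<in> I \<Longrightarrow> sigma_algebra (space M) (G i)"
  shows "indep_sets (\<lambda>(i, k). F i k) (Sigma I K)"
  unfolding indep_sets_def
proof (intro conjI ballI allI impI)
  fix p assume "p \<in> Sigma I K"
  then show "(case p of (i, k) \<Rightarrow> F i k) \<subseteq> events"
    using inner by (auto simp: indep_sets_def)
next
  fix L A
  assume L: "L \<subseteq> Sigma I K" "L \<noteq> {}" "finite L" and A: "A \<in> (\<Pi> p\<in>L. case p of (i, k) \<Rightarrow> F i k)"
  define L1 where "L1 = fst ` L"
  define L2 where "L2 i = {k. (i, k) \<in> L}" for i
  define B where "B i = (\<Inter>k\<in>L2 i. A (i, k))" for i
  have L_eq: "L = Sigma L1 L2"
    by (force simp: L1_def L2_def)
  have fin: "finite L1" "\<And>i. finite (L2 i)"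
    using \<open>finite L\<close> finite_vimageI[OF \<open>finite L\<close>, of "Pair i" for i]
    by (auto simp: L1_def L2_def vimage_def inj_on_def)
  have L1: "L1 \<subseteq> I" "L1 \<noteq> {}"
    using L by (auto simp: L1_def)
  have L2: "L2 i \<subseteq> K i" "L2 i \<noteq> {}" if "i \<in> L1" for i
    using L that by (force simp: L1_def L2_def)+
  have A_in: "A (i, k) \<in> F i k" if "i \<in> L1" "k \<in> L2 i" for i k
    using A that by (auto simp: L_eq Pi_iff)
  have B_prob: "prob (B i) = (\<Prod>k\<in>L2 i. prob (A (i, k)))" if "i \<in> L1" for i
    unfolding B_def using inner[of i] L1 L2[OF that] fin A_in[OF that] that
    by (intro indep_setsD[of "F i" "K i"]) auto
  have B_in: "B i \<in> G i" if "i \<in> L1" for i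
  proof -
    interpret sigma_algebra "space M" "G i"
      using L1 that by (intro sigma) auto
    show ?thesis
      unfolding B_def using fin L1 L2[OF that] that
      by (intro finite_INT) (auto intro!: subsetD[OF sub] A_in)
  qed
  have "(\<Inter>p\<in>L. A p) = (\<Inter>i\<in>L1. B i)"
    by (auto simp: L_eq B_def)
  then have "prob (\<Inter>p\<in>L. A p) = prob (\<Inter>i\<in>L1. B i)"
    by simp
  also have "\<dots> = (\<Prod>i\<in>L1. prob (B i))"
    using L1 fin B_in by (intro indep_setsD[OF outer]) auto
  also have "\<dots> = (\<Prod>i\<in>L1. \<Prod>k\<in>L2 i. prob (A (i, k)))"
    by (intro prod.cong B_prob refl)
  also have "\<dots> = (\<Prod>p\<in>L. prob (A p))"
    unfolding L_eq using fin by (subst prod.Sigma) auto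
  finally show "prob (\<Inter>p\<in>L. A p) = (\<Prod>p\<in>L. prob (A p))" .
qed

section \<open>Past, innovation and freezing\<close>

definition (in prob_space) history :: "('i \<Rightarrow> 'a set set) \<Rightarrow> 'i set \<Rightarrow> 'a measure" where
  "history G P = sigma (space M) (\<Union>i\<in>P. G i)"

lemma (in prob_space) space_history [simp]: "space (history G P) = space M"
  by (simp add: history_def space_measure_of_conv)

lemma (in prob_space) sets_history:
  assumes "indep_sets G I" "P \<subseteq> I"
  shows "sets (history G P) = sigma_sets (space M) (\<Union>i\<in>P. G i)"
proof -
  have "(\<Union>i\<in>P. G i) \<subseteq> Pow (space M)"
    using assms sets.space_closed[of M] by (fastforce simp: indep_sets_def)
  then show ?thesis
    by (simp add: history_def)
qed

lemma (in prob_space) subalgebra_history: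
  assumes "indep_sets G I" "P \<subseteq> I"
  shows "subalgebra M (history G P)"
proof -
  have "(\<Union>i\<in>P. G i) \<subseteq> events"
    using assms by (auto simp: indep_sets_def)
  then show ?thesis
    unfolding subalgebra_def sets_history[OF assms] by (simp add: sets.sigma_sets_subset)
qed

lemma (in prob_space) sets_history_mono:
  assumes "indep_sets G I" "Q \<subseteq> I" "P \<subseteq> Q"
  shows "sets (history G P) \<subseteq> sets (history G Q)"
proof -
  have "P \<subseteq> I" using assms by blast
  then show ?thesis
    unfolding sets_history[OF assms(1) \<open>P \<subseteq> I\<close>] sets_history[OF assms(1,2)]
    using assms(3) by (intro sigma_sets_mono') blast
qed

lemma (in prob_space) indep_set_history:
  assumes indep: "indep_sets G I" and PQ: "P \<subseteq> I" "Q \<subseteq> I" "P \<inter> Q = {}"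
    and stable: "\<And>i. i \<in> I \<Longrightarrow> Int_stable (G i)"
  shows "indep_set (sets (history G P)) (sets (history G Q))"
proof -
  have PQ_b: "case_bool P Q b \<subseteq> I" for b
    using PQ by (cases b) auto
  have "indep_sets (\<lambda>b. sigma_sets (space M) (\<Union>i\<in>case_bool P Q b. G i)) UNIV"
  proof (rule indep_sets_collect_sigma)
    show "indep_sets G (\<Union>b\<in>UNIV. case_bool P Q b)"
      using PQ_b by (intro indep_sets_mono_index[OF _ indep]) blast
    show "disjoint_family_on (case_bool P Q) UNIV"
      using PQ by (auto simp: disjoint_family_on_def split: bool.splits)
    show "Int_stable (G i)" if "i \<in> case_bool P Q b" for i b
      using that PQ_b[of b] by (intro stable) blast
  qed
  moreover have "(\<lambda>b. sigma_sets (space M) (\<Union>i\<in>case_bool P Q b. G i)) =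
      case_bool (sets (history G P)) (sets (history G Q))"
    unfolding sets_history[OF indep PQ(1)] sets_history[OF indep PQ(2)]
    by (rule ext) (simp split: bool.split)
  ultimately show ?thesis
    unfolding indep_set_def by simp
qed

text \<open>Independence lets one freeze the past while integrating over the next innovation.\<close>

lemma (in prob_space) distr_pair_freeze:
  assumes F: "subalgebra M F" and H: "subalgebra M H" and indep: "indep_set (sets F) (sets H)"
    and Y: "Y \<in> H \<rightarrow>\<^sub>M S"
  shows "distr M (F \<Otimes>\<^sub>M S) (\<lambda>\<omega>. (\<omega>, Y \<omega>)) = distr M F (\<lambda>\<omega>. \<omega>) \<Otimes>\<^sub>M distr M S Y"
proof -
  \<comment> \<open>Seen as a random element of the coarser space \<open>F\<close>, the identity
    carries the whole past, and independence becomes a statement about the law of a pair.\<close>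
  have idF: "(\<lambda>\<omega>. \<omega>) \<in> M \<rightarrow>\<^sub>M F"
    using F by (intro measurable_from_subalg[OF F] measurable_ident_sets) simp
  have YM: "Y \<in> M \<rightarrow>\<^sub>M S"
    using H Y by (rule measurable_from_subalg)
  have [measurable]: "(\<lambda>\<omega>. (\<omega>, Y \<omega>)) \<in> M \<rightarrow>\<^sub>M F \<Otimes>\<^sub>M S"
    using idF YM by measurable
  show ?thesis
  proof (rule pair_measure_eqI[symmetric])
    show "sigma_finite_measure (distr M F (\<lambda>\<omega>. \<omega>))" "sigma_finite_measure (distr M S Y)"
      using prob_space_distr[OF idF] prob_space_distr[OF YM] by (auto intro: prob_space_imp_sigma_finite)
    show "sets (distr M F (\<lambda>\<omega>. \<omega>) \<Otimes>\<^sub>M distr M S Y) = sets (distr M (F \<Otimes>\<^sub>M S) (\<lambda>\<omega>. (\<omega>, Y \<omega>)))"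
      by (simp cong: sets_pair_measure_cong)
  next
    fix A B assume "A \<in> sets (distr M F (\<lambda>\<omega>. \<omega>))" "B \<in> sets (distr M S Y)"
    then have A: "A \<in> sets F" and B: "B \<in> sets S" by auto
    have spaceF: "space F = space M" and spaceH: "space H = space M"
      using F H by (auto simp: subalgebra_def)
    have A': "A \<subseteq> space M"
      using sets.sets_into_space[OF A] spaceF by simp
    have "Y -` B \<inter> space M \<in> sets H"
      using measurable_sets[OF Y B] spaceH by simp
    then have "prob (A \<inter> (Y -` B \<inter> space M)) = prob A * prob (Y -` B \<inter> space M)"
      by (intro indep_setD[OF indep] A)
    moreover have "(\<lambda>\<omega>. (\<omega>, Y \<omega>)) -` (A \<times> B) \<inter> space M = A \<inter> (Y -` B \<inter> space M)"
      using A' by auto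
    ultimately show "emeasure (distr M F (\<lambda>\<omega>. \<omega>)) A * emeasure (distr M S Y) B =
        emeasure (distr M (F \<Otimes>\<^sub>M S) (\<lambda>\<omega>. (\<omega>, Y \<omega>))) (A \<times> B)"
      using A B A' idF YM
      by (simp add: emeasure_distr emeasure_eq_measure ennreal_mult'' Int_absorb2)
  qed
qed

lemma (in prob_space) nn_integral_freeze:
  assumes F: "subalgebra M F" and H: "subalgebra M H" and indep: "indep_set (sets F) (sets H)"
    and Y: "Y \<in> H \<rightarrow>\<^sub>M S" and f: "f \<in> borel_measurable (F \<Otimes>\<^sub>M S)"
  shows "(\<integral>\<^sup>+\<omega>. f (\<omega>, Y \<omega>) \<partial>M) = (\<integral>\<^sup>+\<omega>. \<integral>\<^sup>+y. f (\<omega>, y) \<partial>distr M S Y \<partial>M)"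
proof -
  have idF: "(\<lambda>\<omega>. \<omega>) \<in> M \<rightarrow>\<^sub>M F"
    using F by (intro measurable_from_subalg[OF F] measurable_ident_sets) simp
  have YM: "Y \<in> M \<rightarrow>\<^sub>M S"
    using H Y by (rule measurable_from_subalg)
  interpret Y: prob_space "distr M S Y"
    using YM by (rule prob_space_distr)
  have f': "f \<in> borel_measurable (distr M F (\<lambda>\<omega>. \<omega>) \<Otimes>\<^sub>M distr M S Y)"
    using f by (simp cong: measurable_cong_sets sets_pair_measure_cong)
  have g: "(\<lambda>\<omega>. \<integral>\<^sup>+y. f (\<omega>, y) \<partial>distr M S Y) \<in> borel_measurable F"
    using f by (intro Y.borel_measurable_nn_integral) (simp cong: measurable_cong_sets sets_pair_measure_cong)
  have "(\<integral>\<^sup>+\<omega>. f (\<omega>, Y \<omega>) \<partial>M) = (\<integral>\<^sup>+p. f p \<partial>distr M (F \<Otimes>\<^sub>M S) (\<lambda>\<omega>. (\<omega>, Y \<omega>)))"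
    using idF YM f by (subst nn_integral_distr) auto
  also have "\<dots> = (\<integral>\<^sup>+p. f p \<partial>(distr M F (\<lambda>\<omega>. \<omega>) \<Otimes>\<^sub>M distr M S Y))"
    unfolding distr_pair_freeze[OF F H indep Y] ..
  also have "\<dots> = (\<integral>\<^sup>+\<omega>. \<integral>\<^sup>+y. f (\<omega>, y) \<partial>distr M S Y \<partial>distr M F (\<lambda>\<omega>. \<omega>))"
    using f' by (rule Y.nn_integral_fst[symmetric])
  also have "\<dots> = (\<integral>\<^sup>+\<omega>. \<integral>\<^sup>+y. f (\<omega>, y) \<partial>distr M S Y \<partial>M)"
    using idF g by (subst nn_integral_distr) auto
  finally show ?thesis .
qed

text \<open>Null sets of a product can be tested on the sections at fixed \<open>y\<close>. This is
  the passage from fixed to random jump times, with \<open>Y\<close> the whole sequence of jump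
  times.\<close>

lemma (in prob_space) AE_freeze:
  assumes F: "subalgebra M F" and H: "subalgebra M H" and indep: "indep_set (sets F) (sets H)"
    and Y: "Y \<in> H \<rightarrow>\<^sub>M S" and P: "Measurable.pred (F \<Otimes>\<^sub>M S) P"
    and AE: "AE y in distr M S Y. AE \<omega> in M. P (\<omega>, y)"
  shows "AE \<omega> in M. P (\<omega>, Y \<omega>)"
proof -
  have idF: "(\<lambda>\<omega>. \<omega>) \<in> M \<rightarrow>\<^sub>M F"
    using F by (intro measurable_from_subalg[OF F] measurable_ident_sets) simp
  have YM: "Y \<in> M \<rightarrow>\<^sub>M S"
    using H Y by (rule measurable_from_subalg)
  have pF: "prob_space (distr M F (\<lambda>\<omega>. \<omega>))" and pY: "prob_space (distr M S Y)"
    using idF YM by (auto intro: prob_space_distr)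
  interpret yf: pair_sigma_finite "distr M S Y" "distr M F (\<lambda>\<omega>. \<omega>)"
    unfolding pair_sigma_finite_def using pF pY by (auto intro: prob_space_imp_sigma_finite)
  interpret fy: pair_sigma_finite "distr M F (\<lambda>\<omega>. \<omega>)" "distr M S Y"
    unfolding pair_sigma_finite_def using pF pY by (auto intro: prob_space_imp_sigma_finite)
  have [measurable]: "Measurable.pred (distr M F (\<lambda>\<omega>. \<omega>) \<Otimes>\<^sub>M distr M S Y) P"
    using P by (simp cong: measurable_cong_sets sets_pair_measure_cong)
  have "AE y in distr M S Y. AE \<omega> in distr M F (\<lambda>\<omega>. \<omega>). P (\<omega>, y)"
    using AE AE_space
  proof eventually_elim
    case (elim y)
    then have "(\<lambda>\<omega>. (\<omega>, y)) \<in> F \<rightarrow>\<^sub>M F \<Otimes>\<^sub>M S"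
      by simp
    then have "{\<omega> \<in> space F. P (\<omega>, y)} \<in> sets F"
      using P by measurable
    then show ?case
      using elim(1) by (subst AE_distr_iff[OF idF]) auto
  qed
  moreover have "Measurable.pred (distr M S Y \<Otimes>\<^sub>M distr M F (\<lambda>\<omega>. \<omega>)) (\<lambda>p. P (snd p, fst p))"
    by measurable
  then have "(AE y in distr M S Y. AE \<omega> in distr M F (\<lambda>\<omega>. \<omega>). P (\<omega>, y)) \<longleftrightarrow>
      (AE \<omega> in distr M F (\<lambda>\<omega>. \<omega>). AE y in distr M S Y. P (\<omega>, y))"
    by (intro yf.AE_commute) (simp add: pred_def)
  ultimately have "AE \<omega> in distr M F (\<lambda>\<omega>. \<omega>). AE y in distr M S Y. P (\<omega>, y)"
    by simp
  then have "AE p in distr M F (\<lambda>\<omega>. \<omega>) \<Otimes>\<^sub>M distr M S Y. P p"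
    using \<open>Measurable.pred (distr M F (\<lambda>\<omega>. \<omega>) \<Otimes>\<^sub>M distr M S Y) P\<close>[unfolded pred_def]
    by (intro fy.AE_pair_measure) auto
  then show ?thesis
    unfolding distr_pair_freeze[OF F H indep Y, symmetric]
    using idF YM P by (subst (asm) AE_distr_iff) (auto simp: pred_def)
qed

text \<open>By Fatou's lemma the limit inferior is integrable, hence almost surely finite. It is
  applied to \<open>V\<close>, to the weight \<open>W\<close> that counts hits, and to the ratios
  \<open>J n / n\<close>.\<close>

lemma AE_bounded_infinitely_often:
  fixes u :: "nat \<Rightarrow> 'a \<Rightarrow> ennreal"
  assumes u: "\<And>n. u n \<in> borel_measurable M" and K: "\<And>n. (\<integral>\<^sup>+\<omega>. u n \<omega> \<partial>M) \<le> K" "K < \<infinity>"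
  shows "AE \<omega> in M. \<exists>R :: nat. \<exists>\<^sub>\<infinity>n. u n \<omega> \<le> of_nat R"
proof -
  have "(\<integral>\<^sup>+\<omega>. liminf (\<lambda>n. u n \<omega>) \<partial>M) \<le> liminf (\<lambda>n. \<integral>\<^sup>+\<omega>. u n \<omega> \<partial>M)"
    using u by (rule nn_integral_liminf)
  also have "\<dots> \<le> liminf (\<lambda>n :: nat. K)"
    by (intro Liminf_mono always_eventually allI K)
  also have "\<dots> = K"
    by (simp add: Liminf_const)
  finally have "(\<integral>\<^sup>+\<omega>. liminf (\<lambda>n. u n \<omega>) \<partial>M) \<noteq> \<infinity>"
    using K(2) by auto
  then have "AE \<omega> in M. liminf (\<lambda>n. u n \<omega>) \<noteq> \<infinity>"
    using u by (intro nn_integral_noteq_infinite) auto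
  then show ?thesis
  proof eventually_elim
    case (elim \<omega>)
    then obtain R :: nat where R: "liminf (\<lambda>n. u n \<omega>) < of_nat R"
      using ennreal_Ex_less_of_nat by (auto simp: less_top)
    have "\<exists>\<^sub>F n in sequentially. u n \<omega> \<le> of_nat R"
    proof (rule ccontr)
      assume "\<not> (\<exists>\<^sub>F n in sequentially. u n \<omega> \<le> of_nat R)"
      then have "\<forall>\<^sub>F n in sequentially. of_nat R \<le> u n \<omega>"
        by (auto simp: not_frequently elim!: eventually_mono)
      then have "of_nat R \<le> liminf (\<lambda>n. u n \<omega>)"
        by (rule Liminf_bounded)
      with R show False by simp
    qed
    then show ?case
      by (auto simp: cofinite_eq_sequentially)
  qed
qed

subsection \<open>The chain at deterministic jump times\<close>

text \<open>
  \<open>F c\<close> is the past and \<open>H c\<close> the innovation at step \<open>c\<close>. The \<open>k\<close>-th gap takes three steps: the motion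
  is split into \<open>D1 k\<close> and \<open>D2 k\<close>, with variances \<open>v1 k\<close> and \<open>v2 k\<close>, and then a particle is duplicated.
\<close>

locale gaussian_bees = prob_space M
  for M :: "'w measure" +
  fixes F H :: "nat \<Rightarrow> 'w measure"
    and D1 D2 :: "nat \<Rightarrow> 'w \<Rightarrow> ('d::finite, 'n::finite) config"
    and L :: "nat \<Rightarrow> 'w \<Rightarrow> 'n"
    and v1 v2 :: "nat \<Rightarrow> real"
    and x :: "('d, 'n) config"
  assumes subF: "subalgebra M (F c)" and subH: "subalgebra M (H c)"
    and indep: "indep_set (sets (F c)) (sets (H c))"
    and F_Suc: "sets (F c) \<subseteq> sets (F (Suc c))" and H_Suc: "sets (H c) \<subseteq> sets (F (Suc c))"
    and D1 [measurable]: "D1 k \<in> H (3 * k) \<rightarrow>\<^sub>M borel"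
    and D2 [measurable]: "D2 k \<in> H (3 * k + 1) \<rightarrow>\<^sub>M borel"
    and L [measurable]: "L k \<in> H (3 * k + 2) \<rightarrow>\<^sub>M count_space UNIV"
    and distr_D1: "distr M borel (D1 k) = gauss (v1 k)"
    and distr_D2: "distr M borel (D2 k) = gauss (v2 k)"
    and distr_L: "distr M (count_space UNIV) (L k) = uniform_count_measure UNIV"
    and v1: "0 < v1 k" and v2: "0 < v2 k"
begin

text \<open>An explicit function of the innovations, hence adapted to the past; no measurability is
  assumed of the process \<open>X\<close>.\<close>

fun Z :: "nat \<Rightarrow> 'w \<Rightarrow> ('d, 'n) config" where
  "Z 0 \<omega> = x"
| "Z (Suc k) \<omega> = bee_jump (Z k \<omega> + D1 k \<omega> + D2 k \<omega>) (L k \<omega>)"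

lemma measurable_F_Suc: "f \<in> F c \<rightarrow>\<^sub>M S \<Longrightarrow> f \<in> F (Suc c) \<rightarrow>\<^sub>M S"
  using subF[of c] subF[of "Suc c"] F_Suc[of c]
  by (intro measurable_from_subalg[of "F (Suc c)" "F c"]) (auto simp: subalgebra_def)

lemma measurable_H_Suc: "f \<in> H c \<rightarrow>\<^sub>M S \<Longrightarrow> f \<in> F (Suc c) \<rightarrow>\<^sub>M S"
  using subH[of c] subF[of "Suc c"] H_Suc[of c]
  by (intro measurable_from_subalg[of "F (Suc c)" "H c"]) (auto simp: subalgebra_def)

lemma measurable_F_add: "f \<in> F c \<rightarrow>\<^sub>M S \<Longrightarrow> f \<in> F (c + n) \<rightarrow>\<^sub>M S"
  by (induction n) (auto intro: measurable_F_Suc)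

lemma measurable_F: "f \<in> F c \<rightarrow>\<^sub>M S \<Longrightarrow> f \<in> M \<rightarrow>\<^sub>M S"
  using subF by (rule measurable_from_subalg)

lemma measurable_F_le:
  assumes "c \<le> c'" "f \<in> F c \<rightarrow>\<^sub>M S"
  shows "f \<in> F c' \<rightarrow>\<^sub>M S"
proof -
  have "f \<in> F (c + (c' - c)) \<rightarrow>\<^sub>M S"
    using assms(2) by (rule measurable_F_add)
  then show ?thesis
    using assms(1) by (simp only: le_add_diff_inverse)
qed

lemma measurable_H_less:
  assumes "c < c'" "f \<in> H c \<rightarrow>\<^sub>M S"
  shows "f \<in> F c' \<rightarrow>\<^sub>M S"
  using Suc_leI[OF assms(1)] measurable_H_Suc[OF assms(2)] by (rule measurable_F_le)

lemma D1_F [measurable]: "D1 k \<in> F (3 * k + 1) \<rightarrow>\<^sub>M borel" "D1 k \<in> F (3 * k + 2) \<rightarrow>\<^sub>M borel" "D1 k \<in> F (3 * k + 3) \<rightarrow>\<^sub>M borel"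
  by (rule measurable_H_less[OF _ D1], simp)+

lemma D2_F [measurable]: "D2 k \<in> F (3 * k + 2) \<rightarrow>\<^sub>M borel" "D2 k \<in> F (3 * k + 3) \<rightarrow>\<^sub>M borel"
  by (rule measurable_H_less[OF _ D2], simp)+

lemma L_F [measurable]: "L k \<in> F (3 * k + 3) \<rightarrow>\<^sub>M count_space UNIV"
  by (rule measurable_H_less[OF _ L], simp)

lemma Z_F [measurable]: "Z k \<in> F (3 * k) \<rightarrow>\<^sub>M borel"
proof (induction k)
  case (Suc k)
  have [measurable]: "Z k \<in> F (3 * k + 3) \<rightarrow>\<^sub>M borel"
    by (rule measurable_F_le[OF _ Suc]) simp
  have "(\<lambda>\<omega>. bee_jump (Z k \<omega> + D1 k \<omega> + D2 k \<omega>) (L k \<omega>)) \<in> F (3 * k + 3) \<rightarrow>\<^sub>M borel"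
    by measurable
  then show ?case by (simp add: add.commute)
qed simp

lemma Z_F' [measurable]: "Z k \<in> F (3 * k + 1) \<rightarrow>\<^sub>M borel" "Z k \<in> F (3 * k + 2) \<rightarrow>\<^sub>M borel" "Z k \<in> F (3 * k + 3) \<rightarrow>\<^sub>M borel"
  by (rule measurable_F_le[OF _ Z_F], simp)+

lemma Z_M [measurable]: "Z k \<in> M \<rightarrow>\<^sub>M borel"
  using Z_F by (rule measurable_F)

lemma D_M [measurable]: "D1 k \<in> M \<rightarrow>\<^sub>M borel" "D2 k \<in> M \<rightarrow>\<^sub>M borel" "L k \<in> M \<rightarrow>\<^sub>M count_space UNIV"
  using measurable_F[OF D1_F(1)] measurable_F[OF D2_F(1)] measurable_F[OF L_F] by simp_all

lemma nn_integral_D1: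
  "f \<in> borel_measurable (F (3 * k) \<Otimes>\<^sub>M borel) \<Longrightarrow>
    (\<integral>\<^sup>+\<omega>. f (\<omega>, D1 k \<omega>) \<partial>M) = (\<integral>\<^sup>+\<omega>. \<integral>\<^sup>+y. f (\<omega>, y) \<partial>gauss (v1 k) \<partial>M)"
  using nn_integral_freeze[OF subF subH indep D1] by (simp add: distr_D1)

lemma nn_integral_D2:
  "f \<in> borel_measurable (F (3 * k + 1) \<Otimes>\<^sub>M borel) \<Longrightarrow>
    (\<integral>\<^sup>+\<omega>. f (\<omega>, D2 k \<omega>) \<partial>M) = (\<integral>\<^sup>+\<omega>. \<integral>\<^sup>+y. f (\<omega>, y) \<partial>gauss (v2 k) \<partial>M)"
  using nn_integral_freeze[OF subF subH indep D2] by (simp add: distr_D2)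

lemma nn_integral_L:
  "f \<in> borel_measurable (F (3 * k + 2) \<Otimes>\<^sub>M count_space UNIV) \<Longrightarrow>
    (\<integral>\<^sup>+\<omega>. f (\<omega>, L k \<omega>) \<partial>M) = (\<integral>\<^sup>+\<omega>. (\<Sum>u\<in>UNIV. f (\<omega>, u)) / of_nat CARD('n) \<partial>M)"
proof -
  assume "f \<in> borel_measurable (F (3 * k + 2) \<Otimes>\<^sub>M count_space UNIV)"
  then have "(\<integral>\<^sup>+\<omega>. f (\<omega>, L k \<omega>) \<partial>M) = (\<integral>\<^sup>+\<omega>. \<integral>\<^sup>+u. f (\<omega>, u) \<partial>uniform_count_measure UNIV \<partial>M)"
    using nn_integral_freeze[OF subF subH indep L] by (simp add: distr_L)
  moreover have "(\<integral>\<^sup>+u. g u \<partial>uniform_count_measure UNIV) = (\<Sum>u\<in>UNIV. g u) / of_nat CARD('n)" for g :: "'n \<Rightarrow> ennreal"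
    unfolding uniform_count_measure_def
    by (subst nn_integral_point_measure_finite)
       (auto simp: sum_distrib_right divide_ennreal_def ennreal_of_nat_eq_real_of_nat
         inverse_ennreal mult.commute divide_inverse)
  ultimately show ?thesis by simp
qed

text \<open>The innovations are integrated out in reverse order, each with its past frozen: the
  label yields the contraction factor, and each of the two motions adds dimension times
  variance.\<close>

lemma nn_integral_Z_Suc:
  "(\<integral>\<^sup>+\<omega>. ennreal ((norm (centered (Z (Suc k) \<omega>)))\<^sup>2) \<partial>M) \<le>
    ennreal (contraction TYPE('n)) *
      ((\<integral>\<^sup>+\<omega>. ennreal ((norm (centered (Z k \<omega>)))\<^sup>2) \<partial>M) + ennreal (real DIM(('d, 'n) config) * (v1 k + v2 k)))"
proof -
  let ?C = "real DIM(('d, 'n) config)"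
  let ?\<rho> = "contraction TYPE('n)"
  have step: "(\<Sum>u\<in>UNIV. ennreal ((norm (centered (bee_jump y u)))\<^sup>2)) / of_nat CARD('n) \<le>
      ennreal ?\<rho> * ennreal ((norm (centered y))\<^sup>2)" for y :: "('d, 'n) config"
  proof -
    have "(\<Sum>u\<in>UNIV. (norm (centered (bee_jump y u)))\<^sup>2) / real CARD('n) \<le> ?\<rho> * (norm (centered y))\<^sup>2"
      using sum_norm_centered_bee_jump[of y] by (simp add: divide_le_eq mult_ac)
    then have "ennreal ((\<Sum>u\<in>UNIV. (norm (centered (bee_jump y u)))\<^sup>2) / real CARD('n)) \<le>
        ennreal (?\<rho> * (norm (centered y))\<^sup>2)"
      by (rule ennreal_leI)
    then show ?thesis
      using contraction_bounds(1)[where 'n = 'n]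
      by (simp add: ennreal_mult' sum_ennreal ennreal_of_nat_eq_real_of_nat divide_ennreal sum_nonneg)
  qed
  have m: "(\<lambda>(\<omega>, u). ennreal ((norm (centered (bee_jump (Z k \<omega> + D1 k \<omega> + D2 k \<omega>) u)))\<^sup>2)) \<in>
      borel_measurable (F (3 * k + 2) \<Otimes>\<^sub>M count_space UNIV)"
    by measurable
  have m2: "(\<lambda>(\<omega>, y). ennreal ((norm (centered (Z k \<omega> + D1 k \<omega> + y)))\<^sup>2)) \<in>
      borel_measurable (F (3 * k + 1) \<Otimes>\<^sub>M borel)"
    by measurable
  have m1: "(\<lambda>(\<omega>, y). ennreal ((norm (centered (Z k \<omega> + y)))\<^sup>2)) \<in> borel_measurable (F (3 * k) \<Otimes>\<^sub>M borel)"
    by measurable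
  have "(\<integral>\<^sup>+\<omega>. ennreal ((norm (centered (Z (Suc k) \<omega>)))\<^sup>2) \<partial>M) =
      (\<integral>\<^sup>+\<omega>. (\<Sum>u\<in>UNIV. ennreal ((norm (centered (bee_jump (Z k \<omega> + D1 k \<omega> + D2 k \<omega>) u)))\<^sup>2)) / of_nat CARD('n) \<partial>M)"
    using nn_integral_L[OF m] by simp
  also have "\<dots> \<le> (\<integral>\<^sup>+\<omega>. ennreal ?\<rho> * ennreal ((norm (centered (Z k \<omega> + D1 k \<omega> + D2 k \<omega>)))\<^sup>2) \<partial>M)"
    by (intro nn_integral_mono step)
  also have "\<dots> = ennreal ?\<rho> * (\<integral>\<^sup>+\<omega>. ennreal ((norm (centered (Z k \<omega> + D1 k \<omega> + D2 k \<omega>)))\<^sup>2) \<partial>M)"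
    by (rule nn_integral_cmult) measurable
  also have "(\<integral>\<^sup>+\<omega>. ennreal ((norm (centered (Z k \<omega> + D1 k \<omega> + D2 k \<omega>)))\<^sup>2) \<partial>M) =
      (\<integral>\<^sup>+\<omega>. \<integral>\<^sup>+y. ennreal ((norm (centered (Z k \<omega> + D1 k \<omega> + y)))\<^sup>2) \<partial>gauss (v2 k) \<partial>M)"
    using nn_integral_D2[OF m2] by simp
  also have "\<dots> \<le> (\<integral>\<^sup>+\<omega>. ennreal ((norm (centered (Z k \<omega> + D1 k \<omega>)))\<^sup>2 + ?C * v2 k) \<partial>M)"
    by (intro nn_integral_mono nn_integral_gauss_norm_centered v2)
  also have "\<dots> = (\<integral>\<^sup>+\<omega>. ennreal ((norm (centered (Z k \<omega> + D1 k \<omega>)))\<^sup>2) \<partial>M) + ennreal (?C * v2 k)"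
    using v2[of k] by (simp add: nn_integral_add emeasure_space_1)
  also have "(\<integral>\<^sup>+\<omega>. ennreal ((norm (centered (Z k \<omega> + D1 k \<omega>)))\<^sup>2) \<partial>M) =
      (\<integral>\<^sup>+\<omega>. \<integral>\<^sup>+y. ennreal ((norm (centered (Z k \<omega> + y)))\<^sup>2) \<partial>gauss (v1 k) \<partial>M)"
    using nn_integral_D1[OF m1] by simp
  also have "\<dots> \<le> (\<integral>\<^sup>+\<omega>. ennreal ((norm (centered (Z k \<omega>)))\<^sup>2 + ?C * v1 k) \<partial>M)"
    by (intro nn_integral_mono nn_integral_gauss_norm_centered v1)
  also have "\<dots> = (\<integral>\<^sup>+\<omega>. ennreal ((norm (centered (Z k \<omega>)))\<^sup>2) \<partial>M) + ennreal (?C * v1 k)"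
    using v1[of k] by (simp add: nn_integral_add emeasure_space_1)
  finally show ?thesis
    using v1[of k] v2[of k]
    by (simp add: distrib_left add.assoc mult_left_mono add_mono)
qed

text \<open>The recursion of \<open>nn_integral_Z_Suc\<close> run with equality. It is driven by the
  gap lengths \<open>v1 k + v2 k\<close> and need not be bounded in \<open>k\<close>.\<close>

fun bound :: "nat \<Rightarrow> real" where
  "bound 0 = (norm (centered x))\<^sup>2"
| "bound (Suc k) = contraction TYPE('n) * (bound k + real DIM(('d, 'n) config) * (v1 k + v2 k))"

lemma bound_nonneg: "0 \<le> bound k"
  by (induction k) (auto simp: contraction_bounds v1 v2 less_imp_le add_nonneg_nonneg)

lemma nn_integral_Z: "(\<integral>\<^sup>+\<omega>. ennreal ((norm (centered (Z k \<omega>)))\<^sup>2) \<partial>M) \<le> ennreal (bound k)"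
proof (induction k)
  case (Suc k)
  have "(\<integral>\<^sup>+\<omega>. ennreal ((norm (centered (Z (Suc k) \<omega>)))\<^sup>2) \<partial>M) \<le>
      ennreal (contraction TYPE('n)) * (ennreal (bound k) + ennreal (real DIM(('d, 'n) config) * (v1 k + v2 k)))"
    using nn_integral_Z_Suc[of k] Suc by (meson add_right_mono mult_left_mono order_trans zero_le)
  also have "\<dots> = ennreal (bound (Suc k))"
    using less_imp_le[OF v1[of k]] less_imp_le[OF v2[of k]] bound_nonneg[of k] contraction_bounds(1)[where 'n = 'n]
    by (simp add: ennreal_mult)
  finally show ?case .
qed (simp add: emeasure_space_1)

text \<open>Given the past, the last piece of motion has an absolutely continuous law, and the
  translates of the null set of ties are null. All labels \<open>u\<close> are treated at once, so
  specializing to the random label is immediate.\<close>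

lemma AE_no_tie:
  "AE \<omega> in M. \<forall>k i j. i \<noteq> j \<longrightarrow> \<not> tie (Z k \<omega> + D1 k \<omega> + D2 k \<omega>) (L k \<omega>) i j"
proof -
  have "AE \<omega> in M. \<not> tie (Z k \<omega> + D1 k \<omega> + D2 k \<omega>) u i j" if "i \<noteq> j" for k u i j
  proof -
    let ?T = "{y :: ('d, 'n) config. tie y u i j}"
    have T: "?T \<in> null_sets lborel"
      using that by (rule null_sets_tie)
    then have [measurable]: "?T \<in> sets borel" by auto
    have meas: "{y. z + y \<in> ?T} \<in> sets borel" for z
      by measurable
    have "emeasure (gauss (v2 k)) {y. z + y \<in> ?T} = 0" for z
    proof -
      have "emeasure lborel {y. z + y \<in> ?T} = emeasure (distr lborel borel ((+) z)) ?T"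
        by (subst emeasure_distr) (auto simp: vimage_def)
      also have "\<dots> = 0"
        using T unfolding lborel_distr_plus by (rule null_setsD1)
      finally have "emeasure lborel {y. z + y \<in> ?T} = 0" .
      then have "{y. z + y \<in> ?T} \<in> null_sets lborel"
        using meas[of z] by (simp only: null_sets_def sets_lborel mem_Collect_eq)
      then show ?thesis
        using null_sets_gauss[OF v2] by auto
    qed
    moreover have "(\<integral>\<^sup>+y. indicator ?T (z + y) \<partial>gauss (v2 k)) = (\<integral>\<^sup>+y. indicator {y. z + y \<in> ?T} y \<partial>gauss (v2 k))" for z
      by (simp add: indicator_def)
    ultimately have "(\<integral>\<^sup>+y. indicator ?T (z + y) \<partial>gauss (v2 k)) = 0" for z
      using meas by (simp only: nn_integral_indicator sets_gauss)
    moreover have "(\<lambda>(\<omega>, y). indicator ?T (Z k \<omega> + D1 k \<omega> + y) :: ennreal) \<in>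
        borel_measurable (F (3 * k + 1) \<Otimes>\<^sub>M borel)"
      by measurable
    ultimately have "(\<integral>\<^sup>+\<omega>. indicator ?T (Z k \<omega> + D1 k \<omega> + D2 k \<omega>) \<partial>M) = 0"
      using nn_integral_D2[of "\<lambda>(\<omega>, y). indicator ?T (Z k \<omega> + D1 k \<omega> + y)" k] by (simp only: split_conv) simp
    then have "AE \<omega> in M. indicator ?T (Z k \<omega> + D1 k \<omega> + D2 k \<omega>) = (0 :: ennreal)"
      by (subst (asm) nn_integral_0_iff_AE) auto
    then show ?thesis
      by eventually_elim (simp add: indicator_eq_0_iff)
  qed
  then have "AE \<omega> in M. \<forall>k u i j. i \<noteq> j \<longrightarrow> \<not> tie (Z k \<omega> + D1 k \<omega> + D2 k \<omega>) u i j"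
    by (simp add: AE_all_countable)
  then show ?thesis
    by eventually_elim blast
qed

text \<open>
  The weight \<open>W\<close> is halved by a hit and multiplied by \<open>w > 1\<close> when \<open>V \<le> R\<close>. Its mean is at most \<open>1\<close>,
  so it cannot tend to infinity.
\<close>

lemma hits_if_bounded_infinitely_often:
  assumes [measurable]: "A \<in> sets borel" and q: "0 < q" "q \<le> 1"
    and lower: "\<And>k z. k \<in> I \<Longrightarrow> (norm (centered z))\<^sup>2 \<le> R \<Longrightarrow>
      ennreal q \<le> emeasure (gauss (v1 k)) {y. centered (z + y) \<in> A}"
  shows "AE \<omega> in M. infinite {k \<in> I. (norm (centered (Z k \<omega>)))\<^sup>2 \<le> R} \<longrightarrow>
    infinite {k \<in> I. centered (Z k \<omega> + D1 k \<omega>) \<in> A}"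
proof -
  \<comment> \<open>A hit has conditional probability at least \<open>q\<close> when
    \<open>V \<le> R\<close>, so the mean factor is then at most \<open>w * (1 - q / 2)\<close>.
    This \<open>w\<close> is the largest for which \<open>W\<close> is a supermartingale by that
    estimate.\<close>
  define w where "w = 1 / (1 - q / 2)"
  have w: "w > 1" "w * (1 - q / 2) = 1"
    using q by (simp_all add: w_def field_simps)
  define \<psi> :: "nat \<Rightarrow> 'w \<times> ('d, 'n) config \<Rightarrow> real" where
    "\<psi> k = (\<lambda>(\<omega>, y). (if k \<in> I \<and> centered (Z k \<omega> + y) \<in> A then 1 / 2 else 1) *
      (if k \<in> I \<and> (norm (centered (Z k \<omega>)))\<^sup>2 \<le> R then w else 1))" for k
  define W where "W n \<omega> = (\<Prod>k<n. \<psi> k (\<omega>, D1 k \<omega>))" for n \<omega>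
  have \<psi>_nonneg: "0 \<le> \<psi> k p" for k p
    using w by (auto simp: \<psi>_def split: prod.split)
  have W_nonneg: "0 \<le> W n \<omega>" for n \<omega>
    unfolding W_def by (intro prod_nonneg \<psi>_nonneg)
  have \<psi>_F [measurable]: "\<psi> k \<in> borel_measurable (F (3 * k) \<Otimes>\<^sub>M borel)" for k
    unfolding \<psi>_def by measurable
  have W_F [measurable]: "W n \<in> borel_measurable (F (3 * n))" for n
    unfolding W_def
  proof (rule borel_measurable_prod)
    fix k assume "k \<in> {..<n}"
    then have le: "3 * k + 1 \<le> 3 * n" "3 * k < 3 * n" by auto
    have [measurable]: "D1 k \<in> F (3 * n) \<rightarrow>\<^sub>M borel" "Z k \<in> F (3 * n) \<rightarrow>\<^sub>M borel"
      using le by (auto intro: measurable_F_le[OF _ Z_F] measurable_H_less[OF _ D1])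
    show "(\<lambda>\<omega>. \<psi> k (\<omega>, D1 k \<omega>)) \<in> borel_measurable (F (3 * n))"
      unfolding \<psi>_def by measurable
  qed
  have step: "(\<integral>\<^sup>+y. ennreal (\<psi> k (\<omega>, y)) \<partial>gauss (v1 k)) \<le> 1" for k \<omega>
  proof -
    interpret G: prob_space "gauss (v1 k) :: ('d, 'n) config measure"
      using v1 by (rule prob_space_gauss)
    show ?thesis
    proof (cases "k \<in> I \<and> (norm (centered (Z k \<omega>)))\<^sup>2 \<le> R")
      case False
      then have "(\<integral>\<^sup>+y. ennreal (\<psi> k (\<omega>, y)) \<partial>gauss (v1 k)) \<le> (\<integral>\<^sup>+y. 1 \<partial>(gauss (v1 k) :: ('d, 'n) config measure))"
        by (intro nn_integral_mono) (auto simp: \<psi>_def)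
      then show ?thesis
        by (simp add: G.emeasure_space_1[simplified])
    next
      case True
      let ?B = "{y. centered (Z k \<omega> + y) \<in> A}"
      have [measurable]: "?B \<in> sets borel" by measurable
      have "ennreal q \<le> emeasure (gauss (v1 k)) ?B"
        using True by (intro lower) auto
      then have qB: "q \<le> G.prob ?B"
        by (simp add: G.emeasure_eq_measure)
      have int: "integrable (gauss (v1 k)) (\<lambda>y. w * (1 - indicator ?B y / 2))"
        by (intro G.integrable_const_bound[where B = w]) (use w in \<open>auto simp: indicator_def\<close>)
      have "(\<integral>\<^sup>+y. ennreal (\<psi> k (\<omega>, y)) \<partial>gauss (v1 k)) = (\<integral>\<^sup>+y. ennreal (w * (1 - indicator ?B y / 2)) \<partial>gauss (v1 k))"
        using True by (intro nn_integral_cong) (auto simp: \<psi>_def indicator_def)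
      also have "\<dots> = ennreal (\<integral>y. w * (1 - indicator ?B y / 2) \<partial>gauss (v1 k))"
        using int w by (intro nn_integral_eq_integral) (auto simp: indicator_def)
      also have "(\<integral>y. w * (1 - indicator ?B y / 2) \<partial>gauss (v1 k)) = w * (1 - G.prob ?B / 2)"
      proof -
        have i: "integrable (gauss (v1 k)) (\<lambda>y. indicator ?B y / 2 :: real)"
          by (intro G.integrable_const_bound[where B = 1]) (auto simp: indicator_def)
        have "(\<integral>y. 1 - (indicator ?B y :: real) / 2 \<partial>gauss (v1 k)) =
            (\<integral>y. 1 \<partial>(gauss (v1 k) :: ('d, 'n) config measure)) - (\<integral>y. indicator ?B y / 2 \<partial>gauss (v1 k))"
          using i by (intro Bochner_Integration.integral_diff) auto
        also have "\<dots> = 1 - G.prob ?B / 2"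
          by (simp add: G.prob_space[simplified])
        finally show ?thesis
          by (simp only: integral_mult_right_zero)
      qed
      also have "\<dots> \<le> w * (1 - q / 2)"
        using qB w by (intro mult_left_mono) auto
      finally show ?thesis
        using w by (simp add: ennreal_leI)
    qed
  qed
  have W_int: "(\<integral>\<^sup>+\<omega>. ennreal (W n \<omega>) \<partial>M) \<le> 1" for n
  proof (induction n)
    case 0
    then show ?case by (simp add: W_def emeasure_space_1)
  next
    case (Suc n)
    have m: "(\<lambda>p. ennreal (W n (fst p)) * ennreal (\<psi> n p)) \<in> borel_measurable (F (3 * n) \<Otimes>\<^sub>M borel)"
      by measurable
    have m': "(\<lambda>y. ennreal (\<psi> n (\<omega>, y))) \<in> borel_measurable (gauss (v1 n))" for \<omega>
      unfolding \<psi>_def split_conv by measurable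
    have "(\<integral>\<^sup>+\<omega>. ennreal (W (Suc n) \<omega>) \<partial>M) = (\<integral>\<^sup>+\<omega>. ennreal (W n \<omega>) * ennreal (\<psi> n (\<omega>, D1 n \<omega>)) \<partial>M)"
      by (simp add: W_def ennreal_mult prod_nonneg \<psi>_nonneg)
    also have "\<dots> = (\<integral>\<^sup>+\<omega>. \<integral>\<^sup>+y. ennreal (W n \<omega>) * ennreal (\<psi> n (\<omega>, y)) \<partial>gauss (v1 n) \<partial>M)"
      using nn_integral_D1[OF m] by simp
    also have "\<dots> = (\<integral>\<^sup>+\<omega>. ennreal (W n \<omega>) * (\<integral>\<^sup>+y. ennreal (\<psi> n (\<omega>, y)) \<partial>gauss (v1 n)) \<partial>M)"
      by (intro nn_integral_cong nn_integral_cmult m')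
    also have "\<dots> \<le> (\<integral>\<^sup>+\<omega>. ennreal (W n \<omega>) * 1 \<partial>M)"
      by (intro nn_integral_mono mult_left_mono step) simp
    also have "\<dots> \<le> 1"
      using Suc by simp
    finally show ?case .
  qed
  have W_eq: "W n \<omega> = (1 / 2) ^ card {k \<in> {..<n}. k \<in> I \<and> centered (Z k \<omega> + D1 k \<omega>) \<in> A} *
      w ^ card {k \<in> {..<n}. k \<in> I \<and> (norm (centered (Z k \<omega>)))\<^sup>2 \<le> R}" for n \<omega>
    unfolding W_def \<psi>_def by (simp only: split_conv prod.distrib prod.inter_filter[symmetric] finite_lessThan prod_constant)
  have "AE \<omega> in M. \<exists>R' :: nat. \<exists>\<^sub>\<infinity>n. ennreal (W n \<omega>) \<le> of_nat R'"
    by (rule AE_bounded_infinitely_often[OF _ W_int]) (auto intro!: measurable_compose[OF measurable_F[OF W_F]])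
  then show ?thesis
  proof eventually_elim
    case (elim \<omega>)
    show ?case
    proof (intro impI notI)
      assume inf: "infinite {k \<in> I. (norm (centered (Z k \<omega>)))\<^sup>2 \<le> R}" (is "infinite ?G")
        and fin: "finite {k \<in> I. centered (Z k \<omega> + D1 k \<omega>) \<in> A}" (is "finite ?H")
      obtain R' :: nat where R': "\<exists>\<^sub>\<infinity>n. ennreal (W n \<omega>) \<le> of_nat R'"
        using elim by blast
      \<comment> \<open>With at most \<open>card ?H\<close> halvings, \<open>m\<close> occasions
        with \<open>V \<le> R\<close> keep \<open>W\<close> above \<open>R'\<close> from some time
        on, against \<open>W \<le> R'\<close> infinitely often.\<close>
      obtain m where m: "real R' * 2 ^ card ?H < w ^ m"
        using real_arch_pow[OF w(1)] by blast
      obtain B where B: "finite B" "card B = m" "B \<subseteq> ?G"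
        using infinite_arbitrarily_large[OF inf] by blast
      obtain n0 where n0: "\<forall>k\<in>B. k < n0"
        using B(1) by (meson finite_nat_set_iff_bounded)
      obtain n where n: "n \<ge> n0" "ennreal (W n \<omega>) \<le> of_nat R'"
        using R' unfolding INFM_nat_le by blast
      have "m \<le> card {k \<in> {..<n}. k \<in> I \<and> (norm (centered (Z k \<omega>)))\<^sup>2 \<le> R}"
        unfolding B(2)[symmetric] using B(3) n0 n(1) by (intro card_mono) auto
      then have "w ^ m \<le> w ^ card {k \<in> {..<n}. k \<in> I \<and> (norm (centered (Z k \<omega>)))\<^sup>2 \<le> R}"
        using w by (intro power_increasing) auto
      moreover have "card {k \<in> {..<n}. k \<in> I \<and> centered (Z k \<omega> + D1 k \<omega>) \<in> A} \<le> card ?H"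
        using fin by (intro card_mono) auto
      then have "(1 / 2 :: real) ^ card ?H \<le> (1 / 2) ^ card {k \<in> {..<n}. k \<in> I \<and> centered (Z k \<omega> + D1 k \<omega>) \<in> A}"
        by (intro power_decreasing) auto
      ultimately have "(1 / 2) ^ card ?H * w ^ m \<le> W n \<omega>"
        unfolding W_eq using w by (intro mult_mono) auto
      moreover have "W n \<omega> \<le> real R'"
        using n(2) W_nonneg[of n \<omega>] by (simp add: ennreal_of_nat_eq_real_of_nat)
      ultimately have "(1 / 2) ^ card ?H * w ^ m \<le> real R'"
        by simp
      then have "2 ^ card ?H * ((1 / 2) ^ card ?H * w ^ m) \<le> 2 ^ card ?H * real R'"
        by (rule mult_left_mono) simp
      also have "2 ^ card ?H * ((1 / 2) ^ card ?H * w ^ m) = w ^ m"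
        by (simp add: power_one_over)
      finally show False
        using m by (simp add: mult.commute)
    qed
  qed
qed

text \<open>The means are controlled on \<open>I\<close> only, so Fatou's lemma is applied along the
  enumeration of \<open>I\<close>.\<close>

lemma bounded_infinitely_often:
  assumes I: "infinite I" and K: "\<And>k. k \<in> I \<Longrightarrow> bound k \<le> K"
  shows "AE \<omega> in M. \<exists>R :: nat. infinite {k \<in> I. (norm (centered (Z k \<omega>)))\<^sup>2 \<le> real R}"
proof -
  have "AE \<omega> in M. \<exists>R :: nat. \<exists>\<^sub>\<infinity>n. ennreal ((norm (centered (Z (enumerate I n) \<omega>)))\<^sup>2) \<le> of_nat R"
  proof (rule AE_bounded_infinitely_often)
    show "(\<integral>\<^sup>+\<omega>. ennreal ((norm (centered (Z (enumerate I n) \<omega>)))\<^sup>2) \<partial>M) \<le> ennreal K" for n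
      using nn_integral_Z[of "enumerate I n"] K[OF enumerate_in_set[OF I]] by (meson ennreal_leI order_trans)
  qed auto
  then show ?thesis
  proof eventually_elim
    case (elim \<omega>)
    then obtain R :: nat where R: "infinite {n. ennreal ((norm (centered (Z (enumerate I n) \<omega>)))\<^sup>2) \<le> of_nat R}"
      by (auto simp: INFM_iff_infinite)
    have "inj (enumerate I)"
      using strict_mono_enumerate[OF I] by (rule strict_mono_imp_inj_on)
    then have "infinite (enumerate I ` {n. ennreal ((norm (centered (Z (enumerate I n) \<omega>)))\<^sup>2) \<le> of_nat R})"
      using R by (metis finite_imageD inj_on_subset subset_UNIV)
    moreover have "enumerate I ` {n. ennreal ((norm (centered (Z (enumerate I n) \<omega>)))\<^sup>2) \<le> of_nat R} \<subseteq>
        {k \<in> I. (norm (centered (Z k \<omega>)))\<^sup>2 \<le> real R}"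
      using enumerate_in_set[OF I] by (auto simp: ennreal_of_nat_eq_real_of_nat)
    ultimately show ?case
      using finite_subset by blast
  qed
qed

end

text \<open>Centering ignores a common translation, so \<open>z\<close> may be replaced by
  \<open>centered z\<close>, of norm at most \<open>sqrt \<bar>R\<bar>\<close>. It is a hit if
  \<open>centered z + y\<close> falls into \<open>?D\<close>. This describes a translate of
  \<open>?D\<close>, with the same Lebesgue measure and inside the ball of radius \<open>r\<close>,
  where the Gaussian density is bounded below uniformly in \<open>z\<close>.\<close>

lemma gauss_centered_lower_bound:
  fixes A :: "('d::finite, 'n::finite) config set"
  assumes v: "0 < v" and [measurable]: "A \<in> sets borel"
    and pos: "0 < emeasure lborel (cball 0 1 \<inter> centered -` A)"
  shows "\<exists>q>0. q \<le> 1 \<and> (\<forall>z. (norm (centered z))\<^sup>2 \<le> R \<longrightarrow> ennreal q \<le> emeasure (gauss v) {y. centered (z + y) \<in> A})"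
proof -
  let ?D = "cball 0 1 \<inter> centered -` A"
  have [measurable]: "?D \<in> sets borel"
    using measurable_sets[OF borel_measurable_centered, of A] by auto
  define r where "r = 1 + sqrt \<bar>R\<bar>"
  define \<kappa> where "\<kappa> = normal_density 0 (sqrt v) r ^ DIM(('d, 'n) config)"
  have \<kappa>: "0 < \<kappa>"
    unfolding \<kappa>_def using v by (intro zero_less_power normal_density_pos) simp
  have lower: "ennreal \<kappa> * emeasure lborel ?D \<le> emeasure (gauss v) {y. centered (z + y) \<in> A}"
    if z: "(norm (centered z))\<^sup>2 \<le> R" for z
  proof -
    let ?E = "(+) (centered z) -` ?D"
    have E [measurable]: "?E \<in> sets borel"
      using measurable_sets[of "(+) (centered z)" borel borel ?D] by simp
    have "norm (centered z) \<le> sqrt \<bar>R\<bar>"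
      using z by (intro real_le_rsqrt) auto
    then have "norm y \<le> r" if "norm (centered z + y) \<le> 1" for y
      using that norm_triangle_ineq4[of "centered z + y" "centered z"] by (simp add: r_def)
    then have "?E \<subseteq> cball 0 r"
      by auto
    then have "ennreal \<kappa> * emeasure lborel ?E \<le> emeasure (gauss v) ?E"
      unfolding \<kappa>_def by (intro gauss_lower_bound v E)
    moreover have "emeasure lborel ?E = emeasure (distr lborel borel ((+) (centered z))) ?D"
      by (subst emeasure_distr) auto
    moreover have "?E \<subseteq> {y. centered (z + y) \<in> A}"
      by (auto simp: linear_add[OF linear_centered] centered_centered)
    then have "emeasure (gauss v) ?E \<le> emeasure (gauss v) {y. centered (z + y) \<in> A}"
      by (intro emeasure_mono) measurable
    ultimately show ?thesis
      unfolding lborel_distr_plus by simp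
  qed
  have "emeasure lborel ?D \<le> emeasure lborel (cball (0 :: ('d, 'n) config) 1)"
    by (intro emeasure_mono) auto
  also have "\<dots> < \<infinity>"
    using emeasure_lborel_cball_finite by auto
  finally have fin: "emeasure lborel ?D < \<infinity>" .
  define e where "e = measure lborel ?D"
  have e: "emeasure lborel ?D = ennreal e" "0 \<le> e"
    unfolding e_def using fin by (simp_all add: emeasure_eq_ennreal_measure)
  have "0 < e"
    using pos unfolding e(1) by simp
  show ?thesis
  proof (intro exI[of _ "min 1 (\<kappa> * e)"] conjI allI impI)
    fix z :: "('d, 'n) config" assume z: "(norm (centered z))\<^sup>2 \<le> R"
    have "ennreal (min 1 (\<kappa> * e)) \<le> ennreal (\<kappa> * e)"
      by (intro ennreal_leI) simp
    also have "\<dots> = ennreal \<kappa> * emeasure lborel ?D"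
      using \<kappa> e(2) unfolding e(1) by (simp add: ennreal_mult)
    also have "\<dots> \<le> emeasure (gauss v) {y. centered (z + y) \<in> A}"
      using z by (rule lower)
    finally show "ennreal (min 1 (\<kappa> * e)) \<le> emeasure (gauss v) {y. centered (z + y) \<in> A}" .
  qed (use \<kappa> \<open>0 < e\<close> in auto)
qed

theorem (in gaussian_bees) AE_infinitely_many_hits:
  assumes I: "infinite I" and K: "\<And>k. k \<in> I \<Longrightarrow> bound k \<le> K" and v: "\<And>k. k \<in> I \<Longrightarrow> v1 k = s"
    and A: "A \<in> sets borel" and pos: "0 < emeasure lborel (cball 0 1 \<inter> centered -` A)"
  shows "AE \<omega> in M. infinite {k \<in> I. centered (Z k \<omega> + D1 k \<omega>) \<in> A}"
proof -
  obtain k where "k \<in> I"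
    using I infinite_imp_nonempty by blast
  then have s: "0 < s"
    using v v1 by metis
  \<comment> \<open>The level \<open>R\<close> below which \<open>V\<close> returns depends on
    chance, while \<open>q\<close> depends on \<open>R\<close>. So the implication is proved for
    every natural \<open>R\<close>, and countably many null sets are discarded.\<close>
  have "AE \<omega> in M. infinite {k \<in> I. (norm (centered (Z k \<omega>)))\<^sup>2 \<le> real R} \<longrightarrow>
      infinite {k \<in> I. centered (Z k \<omega> + D1 k \<omega>) \<in> A}" for R :: nat
  proof -
    obtain q where "q > 0" "q \<le> 1"
      "\<And>z. (norm (centered z))\<^sup>2 \<le> real R \<Longrightarrow> ennreal q \<le> emeasure (gauss s) {y. centered (z + y) \<in> A}"
      using gauss_centered_lower_bound[OF s A pos, of "real R"] by blast
    then show ?thesis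
      using v by (intro hits_if_bounded_infinitely_often[OF A, of q]) auto
  qed
  then have "AE \<omega> in M. \<forall>R :: nat. infinite {k \<in> I. (norm (centered (Z k \<omega>)))\<^sup>2 \<le> real R} \<longrightarrow>
      infinite {k \<in> I. centered (Z k \<omega> + D1 k \<omega>) \<in> A}"
    by (subst AE_all_countable) blast
  moreover have "AE \<omega> in M. \<exists>R :: nat. infinite {k \<in> I. (norm (centered (Z k \<omega>)))\<^sup>2 \<le> real R}"
    using I K by (rule bounded_infinitely_often)
  ultimately show ?thesis
    by eventually_elim blast
qed

subsection \<open>The jump times\<close>

text \<open>Suppose \<open>a k > K\<close> at all late long gaps. A gap shorter than
  \<open>2\<close> cannot lift \<open>a\<close> above \<open>K\<close>, so a late value below
  \<open>K\<close> would persist until the next long gap; hence \<open>a > K\<close> at all late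
  steps. Summing the recursion bounds \<open>1 - \<rho>\<close> times the sum of \<open>a\<close> by
  a constant plus \<open>C\<close> times the sum of the gaps, which is too small infinitely
  often.\<close>

lemma bounded_at_long_gaps:
  fixes a g :: "nat \<Rightarrow> real"
  assumes \<rho>: "0 \<le> \<rho>" "\<rho> < 1" and C: "0 \<le> C"
    and rec: "\<And>k. a (Suc k) = \<rho> * (a k + C * g k)" and a0: "0 \<le> a 0" and g: "\<And>k. 0 \<le> g k"
    and sparse: "\<exists>\<^sub>\<infinity>n. (\<Sum>k<n. g k) \<le> real R * real n"
    and long: "infinite {k. 2 \<le> g k}"
  shows "\<exists>K. infinite {k. 2 \<le> g k \<and> a k \<le> K}"
proof (rule ccontr)
  assume *: "\<nexists>K. infinite {k. 2 \<le> g k \<and> a k \<le> K}"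
  \<comment> \<open>In \<open>(1 - \<rho>) * K\<close>, the term \<open>2 * C\<close> makes the
    level \<open>K\<close> stable under gaps shorter than \<open>2\<close>,
    \<open>C * real R\<close> is the mean drift allowed by \<open>sparse\<close>, and
    \<open>1\<close> makes the final comparison strict.\<close>
  define K where "K = (C * real R + 2 * C + 1) / (1 - \<rho>)"
  have K: "(1 - \<rho>) * K = C * real R + 2 * C + 1"
    using \<rho> by (simp add: K_def)
  have "finite {k. 2 \<le> g k \<and> a k \<le> K}"
    using * by blast
  then obtain n0 where n0: "\<And>k. 2 \<le> g k \<Longrightarrow> a k \<le> K \<Longrightarrow> k < n0"
    by (auto simp: finite_nat_set_iff_bounded)
  have above: "K < a k" if "n0 \<le> k" for k
  proof (rule ccontr)
    assume "\<not> K < a k"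
    have "a (k + i) \<le> K" for i
    proof (induction i)
      case (Suc i)
      then have "g (k + i) < 2"
        using n0[of "k + i"] that by (meson leD le_add1 not_le order_trans)
      then have "a (Suc (k + i)) \<le> \<rho> * (K + C * 2)"
        unfolding rec using Suc \<rho> C by (intro mult_left_mono add_mono) auto
      also have "\<dots> \<le> K"
      proof -
        have "\<rho> * (C * 2) \<le> 1 * (C * 2)"
          using \<rho> C by (intro mult_right_mono) auto
        then have "\<rho> * (C * 2) \<le> (1 - \<rho>) * K"
          using mult_nonneg_nonneg[OF C, of "real R"] unfolding K mult_1 by linarith
        then show ?thesis
          by (simp add: algebra_simps)
      qed
      finally show ?case by simp
    qed (use \<open>\<not> K < a k\<close> in simp)
    moreover obtain l where "l \<ge> max k n0" "2 \<le> g l"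
      using long unfolding infinite_nat_iff_unbounded_le by blast
    ultimately show False
      using n0[of l] by (metis le_add_diff_inverse leD max.bounded_iff)
  qed
  have sum: "a n + (1 - \<rho>) * (\<Sum>k<n. a k) \<le> a 0 + C * (\<Sum>k<n. g k)" for n
  proof (induction n)
    case (Suc n)
    have "\<rho> * (C * g n) \<le> 1 * (C * g n)"
      using \<rho> C g[of n] by (intro mult_right_mono) auto
    then show ?case
      using Suc by (simp add: rec algebra_simps)
  qed simp
  have a_nonneg: "0 \<le> a n" for n
    by (induction n) (use a0 \<rho> C g in \<open>auto simp: rec\<close>)
  have lower: "K * (real n - real n0) \<le> (\<Sum>k<n. a k)" for n
  proof (induction n)
    case (Suc n)
    show ?case
    proof (cases "n0 \<le> n")
      case True
      then show ?thesis using Suc above[OF True] by (simp add: algebra_simps)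
    next
      case False
      have "0 \<le> K"
        using \<rho> C by (simp add: K_def)
      then have "K * (real (Suc n) - real n0) \<le> 0"
        using False by (intro mult_nonneg_nonpos) auto
      also have "\<dots> \<le> (\<Sum>k<Suc n. a k)"
        by (intro sum_nonneg a_nonneg)
      finally show ?thesis .
    qed
  qed (use \<rho> C in \<open>simp add: K_def mult_nonneg_nonneg\<close>)
  obtain m :: nat where m: "a 0 + (1 - \<rho>) * K * real n0 < real m"
    using reals_Archimedean2 by blast
  obtain n where n: "n \<ge> m" "(\<Sum>k<n. g k) \<le> real R * real n"
    using sparse unfolding INFM_nat_le by blast
  have "(1 - \<rho>) * (K * (real n - real n0)) \<le> (1 - \<rho>) * (\<Sum>k<n. a k)"
    using lower \<rho> by (intro mult_left_mono) auto
  also have "\<dots> \<le> a 0 + C * (\<Sum>k<n. g k)"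
    using sum[of n] a_nonneg[of n] by linarith
  also have "\<dots> \<le> a 0 + C * (real R * real n)"
    using n C by (intro add_left_mono mult_left_mono) auto
  finally have "(1 - \<rho>) * K * real n \<le> a 0 + (1 - \<rho>) * K * real n0 + C * real R * real n"
    by (simp add: algebra_simps)
  then have "(2 * C + 1) * real n \<le> a 0 + (1 - \<rho>) * K * real n0"
    unfolding K by (simp add: algebra_simps)
  moreover have "1 * real n \<le> (2 * C + 1) * real n"
    using C by (intro mult_right_mono) auto
  ultimately show False
    using m n by simp
qed

section \<open>Almost sure properties of the Poisson jump times\<close>

lemma (in prob_space) poisson_card_measurable:
  assumes "poisson_point_process r P" and A: "A \<in> sets borel" "bounded A" "A \<subseteq> {0..}"
  shows "(\<lambda>\<omega>. card (P \<omega> \<inter> A)) \<in> M \<rightarrow>\<^sub>M count_space UNIV"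
proof -
  \<comment> \<open>Measurability of a single count is contained in the independence clause, applied
    to \<open>A\<close> followed by empty sets.\<close>
  have "indep_vars (\<lambda>_. count_space UNIV) (\<lambda>m \<omega>. card (P \<omega> \<inter> (if m = 0 then A else {}))) (UNIV :: nat set)"
    using assms unfolding poisson_point_process_def by (auto simp: disjoint_family_on_def)
  then show ?thesis
    unfolding indep_vars_def by (auto dest!: spec[of _ 0])
qed

text \<open>Voids in disjoint windows of length \<open>2\<close> are independent, so by the zero-one
  law almost surely infinitely many or almost surely finitely many occur. The second case is
  excluded because the union of the events from \<open>n\<close> on always has probability at least
  \<open>exp (- (r * 2))\<close>.\<close>

lemma (in prob_space) poisson_void_infinitely_often:
  assumes P: "poisson_point_process r P"
  shows "AE \<omega> in M. infinite {n :: nat. card (P \<omega> \<inter> {2 * real n<..2 * real n + 2}) = 0}"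
proof -
  let ?A = "\<lambda>n :: nat. {2 * real n<..2 * real n + 2}"
  let ?E = "\<lambda>n. {\<omega> \<in> space M. card (P \<omega> \<inter> ?A n) = 0}"
  have disj: "disjoint_family ?A"
    unfolding disjoint_family_on_def
  proof (intro ballI impI)
    fix m n :: nat assume "m \<noteq> n"
    then have "real m + 1 \<le> real n \<or> real n + 1 \<le> real m" by linarith
    then show "?A m \<inter> ?A n = {}" by auto
  qed
  have bounded: "bounded (?A n)" for n
    by (rule bounded_subset[OF bounded_closed_interval[of "2 * real n" "2 * real n + 2"]]) auto
  have vars: "indep_vars (\<lambda>_. count_space UNIV) (\<lambda>n \<omega>. card (P \<omega> \<inter> ?A n)) UNIV"
  proof -
    have sets: "\<forall>m. ?A m \<in> sets borel \<and> bounded (?A m) \<and> ?A m \<subseteq> {0..}"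
      using bounded by auto
    have indep: "\<And>A :: nat \<Rightarrow> real set. (\<forall>m. A m \<in> sets borel \<and> bounded (A m) \<and> A m \<subseteq> {0..}) \<Longrightarrow>
        disjoint_family A \<Longrightarrow> indep_vars (\<lambda>_. count_space UNIV) (\<lambda>m \<omega>. card (P \<omega> \<inter> A m)) UNIV"
      using P unfolding poisson_point_process_def by simp
    show ?thesis
      by (rule indep[OF sets disj])
  qed
  then have "indep_sets (\<lambda>n. {(\<lambda>\<omega>. card (P \<omega> \<inter> ?A n)) -` B \<inter> space M |B. B \<in> sets (count_space UNIV)}) UNIV"
    unfolding indep_vars_def2 by auto
  then have "indep_sets (\<lambda>n. {?E n}) UNIV"
    by (rule indep_sets_mono_sets) (auto intro!: exI[of _ "{0}"])
  then have "indep_events ?E UNIV"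
    by (simp add: indep_events_def_alt)
  then consider "AE \<omega> in M. infinite {n. card (P \<omega> \<inter> ?A n) = 0}" | "AE \<omega> in M. finite {n. card (P \<omega> \<inter> ?A n) = 0}"
    using borel_0_1_law_AE[of "\<lambda>n \<omega>. card (P \<omega> \<inter> ?A n) = 0"] by blast
  then show ?thesis
  proof cases
    case 2
    have [measurable]: "?E n \<in> events" for n
    proof -
      have [measurable]: "(\<lambda>\<omega>. card (P \<omega> \<inter> ?A n)) \<in> M \<rightarrow>\<^sub>M count_space UNIV"
        using bounded by (intro poisson_card_measurable[OF P]) auto
      show ?thesis by measurable
    qed
    define B where "B n = (\<Union>m\<in>{n..}. ?E m)" for n
    have [measurable]: "B n \<in> events" for n
      unfolding B_def by measurable
    have "decseq B"
      unfolding B_def decseq_def by (intro allI impI UN_mono) auto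
    then have "(\<lambda>n. prob (B n)) \<longlonglongrightarrow> prob (\<Inter>n. B n)"
      by (intro finite_Lim_measure_decseq) auto
    moreover have "prob (\<Inter>n. B n) = 0"
    proof -
      have "AE \<omega> in M. \<omega> \<notin> (\<Inter>n. B n)"
        using 2
      proof eventually_elim
        case (elim \<omega>)
        then obtain n0 where n0: "\<And>n. card (P \<omega> \<inter> ?A n) = 0 \<Longrightarrow> n < n0"
          by (auto simp: finite_nat_set_iff_bounded)
        have "\<omega> \<notin> B n0"
        proof (intro notI)
          assume "\<omega> \<in> B n0"
          then obtain m where "n0 \<le> m" "card (P \<omega> \<inter> ?A m) = 0"
            unfolding B_def by blast
          then show False
            using n0[of m] by simp
        qed
        then show ?case by blast
      qed
      then show ?thesis
        by (subst (asm) AE_iff_measurable[of "\<Inter>n. B n"]) (auto simp: measure_def B_def)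
    qed
    moreover have "exp (- (r * 2)) \<le> prob (B n)" for n
    proof -
      have "exp (- (r * 2)) = prob (?E n)"
      proof -
        have "prob {\<omega> \<in> space M. card (P \<omega> \<inter> A) = k} =
            (r * measure lborel A) ^ k / fact k * exp (- (r * measure lborel A))"
          if "A \<in> sets borel" "bounded A" "A \<subseteq> {0..}" for A k
          using P that unfolding poisson_point_process_def by simp
        moreover have "?A n \<subseteq> {0..}" by auto
        ultimately show ?thesis
          using bounded[of n] by (simp del: card_eq_0_iff card_0_eq)
      qed
      also have "\<dots> \<le> prob (B n)"
        by (intro finite_measure_mono) (auto simp: B_def)
      finally show ?thesis .
    qed
    ultimately have "exp (- (r * 2)) \<le> 0"
      by (intro LIMSEQ_le_const) auto
    then show ?thesis by simp
  qed
qed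

text \<open>The mean is the integral of the tail probabilities. If \<open>J m\<close> exceeds
  \<open>t\<close>, there are fewer than \<open>m\<close> points up to \<open>t\<close>, and the
  probability of exactly \<open>k\<close> points is an Erlang density divided by \<open>r\<close>.
  Each of the \<open>m\<close> terms integrates to \<open>1 / r\<close>.\<close>

lemma (in prob_space) nn_integral_poisson_jump:
  assumes P: "poisson_point_process r (\<lambda>\<omega>. {J i \<omega> |i. i \<ge> 1})" and r: "0 < r"
    and mono: "AE \<omega> in M. J 0 \<omega> = 0 \<and> strict_mono (\<lambda>i. J i \<omega>)"
    and [measurable]: "\<And>i. random_variable borel (J i)"
  shows "(\<integral>\<^sup>+\<omega>. ennreal (J m \<omega>) \<partial>M) \<le> ennreal (real m / r)"
proof -
  let ?P = "\<lambda>\<omega>. {J i \<omega> |i. i \<ge> 1}"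
  interpret L: pair_sigma_finite M "lborel :: real measure"
    by (intro pair_sigma_finite.intro) (unfold_locales)
  have tail: "emeasure M {\<omega> \<in> space M. t < J m \<omega>} \<le> (\<Sum>k<m. ennreal (erlang_density k r t / r))" if t: "0 \<le> t" for t
  proof -
    let ?E = "\<lambda>k. {\<omega> \<in> space M. card (?P \<omega> \<inter> {0..t}) = k}"
    have [measurable]: "(\<lambda>\<omega>. card (?P \<omega> \<inter> {0..t})) \<in> M \<rightarrow>\<^sub>M count_space UNIV"
      by (intro poisson_card_measurable[OF P]) auto
    have E: "?E k \<in> events" for k
      by measurable
    have "AE \<omega> in M. t < J m \<omega> \<longrightarrow> \<omega> \<in> (\<Union>k<m. ?E k)"
      using mono AE_space
    proof eventually_elim
      case (elim \<omega>)
      show ?case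
      proof
        assume "t < J m \<omega>"
        have "?P \<omega> \<inter> {0..t} \<subseteq> (\<lambda>i. J i \<omega>) ` {1..<m}"
        proof
          fix s assume "s \<in> ?P \<omega> \<inter> {0..t}"
          then obtain i where i: "i \<ge> 1" "s = J i \<omega>" "J i \<omega> < J m \<omega>"
            using \<open>t < J m \<omega>\<close> by auto
          then have "i < m"
            using elim(1) by (meson strict_mono_less)
          with i show "s \<in> (\<lambda>i. J i \<omega>) ` {1..<m}" by auto
        qed
        then have "card (?P \<omega> \<inter> {0..t}) \<le> card ((\<lambda>i. J i \<omega>) ` {1..<m})"
          by (intro card_mono) auto
        also have "\<dots> \<le> m - 1"
          using card_image_le[of "{1..<m}" "\<lambda>i. J i \<omega>"] by simp
        finally have "card (?P \<omega> \<inter> {0..t}) \<le> m - 1" .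
        moreover have "m \<noteq> 0"
          using \<open>t < J m \<omega>\<close> t elim(1) by (metis not_less)
        ultimately show "\<omega> \<in> (\<Union>k<m. ?E k)"
          using elim(2) by auto
      qed
    qed
    then have "emeasure M {\<omega> \<in> space M. t < J m \<omega>} \<le> emeasure M (\<Union>k<m. ?E k)"
      by (intro emeasure_mono_AE sets.finite_UN E) auto
    also have "\<dots> \<le> (\<Sum>k<m. emeasure M (?E k))"
      using E by (intro emeasure_subadditive_finite) blast+
    also have "\<dots> = (\<Sum>k<m. ennreal (erlang_density k r t / r))"
    proof (rule sum.cong[OF refl])
      fix k
      have "prob (?E k) = (r * t) ^ k / fact k * exp (- (r * t))"
        using P t unfolding poisson_point_process_def
        by (auto dest!: spec[of _ "{0..t}"] spec[of _ k])
      also have "\<dots> = erlang_density k r t / r"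
        using t r by (simp add: erlang_density_def power_mult_distrib)
      finally show "emeasure M (?E k) = ennreal (erlang_density k r t / r)"
        by (simp add: emeasure_eq_measure)
    qed
    finally show ?thesis .
  qed
  have "(\<integral>\<^sup>+\<omega>. ennreal (J m \<omega>) \<partial>M) = (\<integral>\<^sup>+\<omega>. \<integral>\<^sup>+t. indicator {0..} t * indicator {..<J m \<omega>} t \<partial>lborel \<partial>M)"
  proof (rule nn_integral_cong_AE)
    show "AE \<omega> in M. ennreal (J m \<omega>) = (\<integral>\<^sup>+t. indicator {0..} t * indicator {..<J m \<omega>} t \<partial>lborel)"
      using mono
    proof eventually_elim
      case (elim \<omega>)
      then have "0 \<le> J m \<omega>"
        by (metis le0 strict_mono_less_eq)
      have "(\<integral>\<^sup>+t. indicator {0..} t * indicator {..<J m \<omega>} t \<partial>lborel) = (\<integral>\<^sup>+t. indicator {0..<J m \<omega>} t \<partial>lborel)"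
        by (intro nn_integral_cong) (auto simp: indicator_def)
      then show ?case
        using \<open>0 \<le> J m \<omega>\<close> by simp
    qed
  qed
  also have "\<dots> = (\<integral>\<^sup>+t. \<integral>\<^sup>+\<omega>. indicator {0..} t * indicator {..<J m \<omega>} t \<partial>M \<partial>lborel)"
    by (rule L.Fubini'[symmetric]) (auto simp: indicator_def)
  also have "\<dots> \<le> (\<integral>\<^sup>+t. (\<Sum>k<m. ennreal (erlang_density k r t / r)) \<partial>lborel)"
  proof (rule nn_integral_mono)
    fix t :: real
    have "(\<integral>\<^sup>+\<omega>. indicator {0..} t * indicator {..<J m \<omega>} t \<partial>M) = indicator {0..} t * (\<integral>\<^sup>+\<omega>. indicator {\<omega> \<in> space M. t < J m \<omega>} \<omega> \<partial>M)"
      by (subst nn_integral_cmult[symmetric]) (auto intro!: nn_integral_cong simp: indicator_def)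
    also have "(\<integral>\<^sup>+\<omega>. indicator {\<omega> \<in> space M. t < J m \<omega>} \<omega> \<partial>M) = emeasure M {\<omega> \<in> space M. t < J m \<omega>}"
      by (rule nn_integral_indicator) measurable
    also have "indicator {0..} t * emeasure M {\<omega> \<in> space M. t < J m \<omega>} \<le> (\<Sum>k<m. ennreal (erlang_density k r t / r))"
      using tail[of t] by (cases "0 \<le> t") simp_all
    finally show "(\<integral>\<^sup>+\<omega>. indicator {0..} t * indicator {..<J m \<omega>} t \<partial>M) \<le> (\<Sum>k<m. ennreal (erlang_density k r t / r))" .
  qed
  also have "\<dots> = (\<Sum>k<m. \<integral>\<^sup>+t. ennreal (erlang_density k r t / r) \<partial>lborel)"
    by (rule nn_integral_sum) auto
  also have "\<dots> = (\<Sum>k<m. ennreal (1 / r))"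
  proof (rule sum.cong[OF refl])
    fix k
    have "(\<integral>\<^sup>+t. ennreal (erlang_density k r t / r) \<partial>lborel) = (\<integral>\<^sup>+t. ennreal (1 / r) * ennreal (erlang_density k r t) \<partial>lborel)"
      using r by (intro nn_integral_cong) (simp add: ennreal_mult'[symmetric] mult.commute)
    also have "\<dots> = ennreal (1 / r) * (\<integral>\<^sup>+t. ennreal (erlang_density k r t) \<partial>lborel)"
      by (rule nn_integral_cmult) auto
    also have "(\<integral>\<^sup>+t. ennreal (erlang_density k r t) \<partial>lborel) = 1"
      using nn_integral_erlang_ith_moment[OF r, of k 0] by simp
    finally show "(\<integral>\<^sup>+t. ennreal (erlang_density k r t / r) \<partial>lborel) = ennreal (1 / r)" by simp
  qed
  also have "\<dots> = ennreal (real m / r)"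
    using r by (simp add: ennreal_of_nat_eq_real_of_nat ennreal_mult'[symmetric])
  finally show ?thesis .
qed

text \<open>The growth condition only concerns a subsequence, which Fatou's lemma yields without a
  law of large numbers. All quantifiers range over naturals, which makes the predicate
  measurable.\<close>

definition good_times :: "(nat \<Rightarrow> real) \<Rightarrow> bool" where
  "good_times j \<longleftrightarrow> j 0 = 0 \<and> (\<forall>i. j i < j (Suc i)) \<and>
     (\<exists>R :: nat. \<forall>m. \<exists>n\<ge>m. j n \<le> real R * real n) \<and> (\<forall>m. \<exists>k\<ge>m. 2 \<le> j (Suc k) - j k)"

lemma measurable_good_times [measurable]: "Measurable.pred (Pi\<^sub>M UNIV (\<lambda>_. borel)) good_times"
  unfolding good_times_def by measurable

lemma (in bbb_process) J_measurable: "(\<lambda>\<omega> i. J i \<omega>) \<in> M \<rightarrow>\<^sub>M Pi\<^sub>M UNIV (\<lambda>_. borel)"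
proof (rule measurableI)
  fix A assume A: "A \<in> sets (Pi\<^sub>M UNIV (\<lambda>_ :: nat. borel :: real measure))"
  have "(\<lambda>\<omega> i. J i \<omega>) -` A \<inter> space M \<in> source_events M J U B Jumps"
    using A by (auto intro: in_vimage_algebra)
  then show "(\<lambda>\<omega> i. J i \<omega>) -` A \<inter> space M \<in> events"
    using independent by (auto simp: indep_sets_def)
qed (simp add: space_PiM)

lemma (in bbb_process) J_component_measurable [measurable]: "random_variable borel (J i)"
  using measurable_compose[OF J_measurable measurable_component_singleton[of i UNIV]] by simp

lemma (in bbb_process) AE_good_times: "AE \<omega> in M. good_times (\<lambda>i. J i \<omega>)"
proof -
  let ?r = "real CARD('n)"
  let ?P = "\<lambda>\<omega>. {J i \<omega> |i. i \<ge> 1}"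
  have "AE \<omega> in M. \<exists>R :: nat. \<exists>\<^sub>\<infinity>n. ennreal (J n \<omega> / real n) \<le> of_nat R"
  proof (rule AE_bounded_infinitely_often)
    show "(\<integral>\<^sup>+\<omega>. ennreal (J n \<omega> / real n) \<partial>M) \<le> ennreal (1 / ?r)" for n
    proof (cases "n = 0")
      case False
      have "(\<integral>\<^sup>+\<omega>. ennreal (J n \<omega> / real n) \<partial>M) = (\<integral>\<^sup>+\<omega>. ennreal (1 / real n) * ennreal (J n \<omega>) \<partial>M)"
        by (intro nn_integral_cong) (simp add: ennreal_mult'[symmetric])
      also have "\<dots> = ennreal (1 / real n) * (\<integral>\<^sup>+\<omega>. ennreal (J n \<omega>) \<partial>M)"
        by (rule nn_integral_cmult) auto
      also have "\<dots> \<le> ennreal (1 / real n) * ennreal (real n / ?r)"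
        using nn_integral_poisson_jump[OF jumps_poisson _ jumps_ordered, of n] by (intro mult_left_mono) auto
      also have "\<dots> = ennreal (1 / ?r)"
        using False by (simp add: ennreal_mult'[symmetric])
      finally show ?thesis .
    qed simp
  qed auto
  moreover have "AE \<omega> in M. \<forall>t. finite (?P \<omega> \<inter> {0..t})"
    using jumps_poisson unfolding poisson_point_process_def by auto
  ultimately show ?thesis
    using jumps_ordered poisson_void_infinitely_often[OF jumps_poisson]
  proof eventually_elim
    case (elim \<omega>)
    have J0: "J 0 \<omega> = 0" and mono: "strict_mono (\<lambda>i. J i \<omega>)"
      using elim(3) by auto
    have unbounded: "\<exists>i. t < J i \<omega>" for t
    proof (rule ccontr)
      assume "\<nexists>i. t < J i \<omega>"
      then have "(\<lambda>i. J i \<omega>) ` {1..} \<subseteq> ?P \<omega> \<inter> {0..t}"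
        using strict_mono_less_eq[OF mono, of 0] J0 by (auto simp: not_less)
      then have "finite ((\<lambda>i. J i \<omega>) ` {1..})"
        using elim(2) finite_subset by blast
      then show False
        using strict_mono_imp_inj_on[OF mono] by (auto dest!: finite_imageD intro: inj_on_subset simp: infinite_Ici)
    qed
    obtain R :: nat where R: "\<exists>\<^sub>\<infinity>n. ennreal (J n \<omega> / real n) \<le> of_nat R"
      using elim(1) by blast
    have "\<exists>n\<ge>m. J n \<omega> \<le> real R * real n" for m
    proof -
      \<comment> \<open>\<open>n \<ge> 1\<close> is enforced because the ratio at
        \<open>n = 0\<close> is \<open>0\<close> by the convention on division.\<close>
      obtain n where n: "n \<ge> max m 1" "ennreal (J n \<omega> / real n) \<le> of_nat R"
        using R unfolding INFM_nat_le by blast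
      then have "J n \<omega> / real n \<le> real R"
        by (simp add: ennreal_of_nat_eq_real_of_nat ennreal_le_iff)
      then show ?thesis
        using n by (intro exI[of _ n]) (auto simp: divide_le_eq)
    qed
    moreover have "\<exists>k\<ge>m. 2 \<le> J (Suc k) \<omega> - J k \<omega>" for m
    proof -
      obtain n0 :: nat where n0: "J m \<omega> \<le> real n0"
        using real_arch_simple by blast
      obtain n where n: "n \<ge> n0" "card (?P \<omega> \<inter> {2 * real n<..2 * real n + 2}) = 0"
        using elim(4) unfolding infinite_nat_iff_unbounded_le by blast
      \<comment> \<open>\<open>card\<close> is also \<open>0\<close> on infinite sets, so the window
        is void only in view of local finiteness.\<close>
      have "finite (?P \<omega> \<inter> {2 * real n<..2 * real n + 2})"
        using elim(2) by (rule finite_subset[rotated, OF spec[of _ "2 * real n + 2"]]) auto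
      then have void: "?P \<omega> \<inter> {2 * real n<..2 * real n + 2} = {}"
        using n(2) by simp
      \<comment> \<open>The first jump after \<open>2 * real n\<close> must avoid the void window
        and so lies beyond its right end, while the preceding jump is not beyond its left end. The
        gap between them thus has length at least \<open>2\<close>.\<close>
      define l where "l = (LEAST i. 2 * real n < J i \<omega>)"
      have l: "2 * real n < J l \<omega>"
        unfolding l_def using unbounded by (rule LeastI_ex)
      then obtain k where k: "l = Suc k"
        using J0 by (cases l) auto
      have "\<not> 2 * real n < J k \<omega>"
        using not_less_Least[of k "\<lambda>i. 2 * real n < J i \<omega>"] k by (simp add: l_def)
      moreover have "J l \<omega> \<notin> {2 * real n<..2 * real n + 2}"
      proof -
        have "J l \<omega> \<in> ?P \<omega>"
          using k by (auto intro!: exI[of _ l])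
        then show ?thesis using void by blast
      qed
      moreover have "J m \<omega> < J l \<omega>"
        using n0 n(1) l by simp
      then have "m \<le> k"
        using strict_mono_less[OF mono] k by auto
      ultimately show ?thesis
        using l k by (intro exI[of _ k]) auto
    qed
    ultimately show ?case
      unfolding good_times_def using J0 mono by (auto simp: strict_mono_Suc_iff)
  qed
qed

subsection \<open>Brownian increments over a fixed sequence of times\<close>

lemma (in prob_space) indep_sets_reindex:
  assumes f: "inj_on f A" and G: "indep_sets G (f ` A)"
  shows "indep_sets (\<lambda>i. G (f i)) A"
  unfolding indep_sets_def
proof (intro conjI ballI allI impI)
  show "G (f i) \<subseteq> events" if "i \<in> A" for i
    using G that by (auto simp: indep_sets_def)
next
  fix L E assume L: "L \<subseteq> A" "L \<noteq> {}" "finite L" and E: "E \<in> (\<Pi> i\<in>L. G (f i))"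
  define E' where "E' p = E (inv_into L f p)" for p
  have inj: "inj_on f L"
    using f L(1) by (rule inj_on_subset)
  have E': "E' (f i) = E i" if "i \<in> L" for i
    using inj that by (simp add: E'_def)
  have "prob (\<Inter>p\<in>f ` L. E' p) = (\<Prod>p\<in>f ` L. prob (E' p))"
    using L E E' by (intro indep_setsD[OF G]) auto
  then show "prob (\<Inter>i\<in>L. E i) = (\<Prod>i\<in>L. prob (E i))"
    using E' inj by (simp add: prod.reindex)
qed

lemma (in prob_space) indep_sets_singleton:
  assumes "F i \<subseteq> events"
  shows "indep_sets F {i}"
  unfolding indep_sets_def using assms by (auto simp: subset_singleton_iff)

lemma Basis_config: "(Basis :: ('d::finite, 'n::finite) config set) = (\<lambda>(n, d). axis n (axis d 1)) ` UNIV"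
  by (auto simp: Basis_vec_def)

lemma inj_axis_axis: "inj (\<lambda>(n, d). axis n (axis d (1 :: real)) :: ('d::finite, 'n::finite) config)"
  by (auto simp: inj_on_def axis_eq_axis)

text \<open>The coordinates are independent as whole paths, and the increments of one coordinate are
  independent events of its path.\<close>

lemma (in prob_space) indep_sets_increments:
  fixes W :: "real \<Rightarrow> 'a \<Rightarrow> real ^ 'd::finite"
  assumes W: "std_brownian_motion_vec W" and \<tau>: "0 \<le> \<tau> 0" "mono \<tau>"
  shows "indep_sets (\<lambda>(d, m). {(\<lambda>\<omega>. W (\<tau> (Suc m)) \<omega> $ d - W (\<tau> m) \<omega> $ d) -` A \<inter> space M |A. A \<in> sets borel}) UNIV"
proof -
  let ?path = "\<lambda>d \<omega>. \<lambda>t\<in>{0..}. W t \<omega> $ d"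
  let ?PM = "Pi\<^sub>M {0::real..} (\<lambda>_. borel :: real measure)"
  let ?F = "\<lambda>d m. {(\<lambda>\<omega>. W (\<tau> (Suc m)) \<omega> $ d - W (\<tau> m) \<omega> $ d) -` A \<inter> space M |A. A \<in> sets borel}"
  have \<tau>_nonneg: "0 \<le> \<tau> m" for m
    using \<tau> monoD[OF \<tau>(2), of 0 m] by simp
  have "indep_sets (\<lambda>(d, m). ?F d m) (Sigma UNIV (\<lambda>_. UNIV))"
  proof (rule indep_sets_nested)
    show "indep_sets (\<lambda>d. sigma_sets (space M) {?path d -` A \<inter> space M |A. A \<in> sets ?PM}) UNIV"
      using W by (auto simp: std_brownian_motion_vec_def indep_vars_def)
    show "sigma_algebra (space M) (sigma_sets (space M) {?path d -` A \<inter> space M |A. A \<in> sets ?PM})" for d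
      by (rule sigma_algebra_sigma_sets) auto
    show "indep_sets (?F d) UNIV" for d
    proof -
      have "std_brownian_motion (\<lambda>t \<omega>. W t \<omega> $ d)"
        using W by (auto simp: std_brownian_motion_vec_def)
      then have "indep_vars (\<lambda>_. borel) (\<lambda>m \<omega>. W (\<tau> (Suc m)) \<omega> $ d - W (\<tau> m) \<omega> $ d) UNIV"
        using \<tau> unfolding std_brownian_motion_def by blast
      then show ?thesis
        unfolding indep_vars_def2 by blast
    qed
    show "?F d m \<subseteq> sigma_sets (space M) {?path d -` A \<inter> space M |A. A \<in> sets ?PM}" for d m
    proof -
      have "?path d \<in> vimage_algebra (space M) (?path d) ?PM \<rightarrow>\<^sub>M ?PM"
        by (rule measurable_vimage_algebra1) (auto simp: space_PiM)
      moreover have "(\<lambda>w. w (\<tau> (Suc m)) - w (\<tau> m)) \<in> borel_measurable ?PM"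
        using \<tau>_nonneg by (intro borel_measurable_diff measurable_component_singleton) auto
      ultimately have "(\<lambda>\<omega>. ?path d \<omega> (\<tau> (Suc m)) - ?path d \<omega> (\<tau> m)) \<in>
          borel_measurable (vimage_algebra (space M) (?path d) ?PM)"
        by (rule measurable_compose)
      then have "(\<lambda>\<omega>. W (\<tau> (Suc m)) \<omega> $ d - W (\<tau> m) \<omega> $ d) \<in>
          borel_measurable (vimage_algebra (space M) (?path d) ?PM)"
        using \<tau>_nonneg by simp
      from measurable_sets[OF this] show ?thesis
        by (auto simp: sets_vimage_algebra)
    qed
  qed
  then show ?thesis by simp
qed

lemma source_events_Motion:
  assumes f: "f \<in> Pi\<^sub>M {0..} (\<lambda>_. borel) \<rightarrow>\<^sub>M N" and A: "A \<in> sets N"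
  shows "(\<lambda>\<omega>. f (\<lambda>t\<in>{0..}. B n t \<omega>)) -` A \<inter> space M \<in> source_events M J U B (Motion n)"
proof -
  have "(\<lambda>\<omega>. \<lambda>t\<in>{0..}. B n t \<omega>) \<in>
      vimage_algebra (space M) (\<lambda>\<omega>. \<lambda>t\<in>{0..}. B n t \<omega>) (Pi\<^sub>M {0..} (\<lambda>_. borel)) \<rightarrow>\<^sub>M Pi\<^sub>M {0..} (\<lambda>_. borel)"
    by (rule measurable_vimage_algebra1) (auto simp: space_PiM)
  from measurable_sets[OF measurable_compose[OF this f] A] show ?thesis
    by simp
qed

lemma sigma_algebra_source_events: "sigma_algebra (space M) (source_events M J U B s)"
proof (cases s)
  case Jumps
  then show ?thesis
    using sets.sigma_algebra_axioms[of "vimage_algebra (space M) (\<lambda>\<omega> i. J i \<omega>) (Pi\<^sub>M UNIV (\<lambda>_. borel))"] by simp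
next
  case (Label i)
  then show ?thesis
    using sets.sigma_algebra_axioms[of "vimage_algebra (space M) (U i) (count_space UNIV)"] by simp
next
  case (Motion n)
  then show ?thesis
    using sets.sigma_algebra_axioms[of "vimage_algebra (space M) (\<lambda>\<omega>. \<lambda>t\<in>{0..}. B n t \<omega>) (Pi\<^sub>M {0..} (\<lambda>_. borel))"] by simp
qed

lemma Int_stable_vimages: "Int_stable {f -` A \<inter> \<Omega> |A. A \<in> sets N}"
proof (rule Int_stableI)
  fix a b assume "a \<in> {f -` A \<inter> \<Omega> |A. A \<in> sets N}" "b \<in> {f -` A \<inter> \<Omega> |A. A \<in> sets N}"
  then obtain A B where "a = f -` A \<inter> \<Omega>" "b = f -` B \<inter> \<Omega>" "A \<in> sets N" "B \<in> sets N" by blast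
  then show "a \<inter> b \<in> {f -` A \<inter> \<Omega> |A. A \<in> sets N}"
    by (intro CollectI exI[of _ "A \<inter> B"]) auto
qed

text \<open>The grid is deterministic and unrelated to \<open>J\<close>. It will interleave frozen
  jump times with observation times.\<close>

locale bbb_grid = bbb_process M J U B x X
  for M :: "'w measure" and J and U :: "nat \<Rightarrow> 'w \<Rightarrow> 'n::finite"
    and B :: "'n \<Rightarrow> real \<Rightarrow> 'w \<Rightarrow> real ^ 'd::finite" and x X +
  fixes \<tau> :: "nat \<Rightarrow> real"
  assumes \<tau>_0: "0 \<le> \<tau> 0" and \<tau>_mono: "strict_mono \<tau>"
begin

lemma \<tau>_nonneg: "0 \<le> \<tau> m"
  using \<tau>_0 strict_mono_less_eq[OF \<tau>_mono, of 0 m] by simp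

definition increment :: "nat \<Rightarrow> 'w \<Rightarrow> ('d, 'n) config" where
  "increment m \<omega> = (\<chi> n. B n (\<tau> (Suc m)) \<omega> - B n (\<tau> m) \<omega>)"

text \<open>
  Every innovation is a pair of a source and a detail: a coordinate and a step number for the motions,
  a dummy for the labels.
\<close>

fun events_of :: "'n source \<times> 'd \<times> nat \<Rightarrow> 'w set set" where
  "events_of (Jumps, d, m) = {}"
| "events_of (Label i, d, m) = source_events M J U B (Label i)"
| "events_of (Motion n, d, m) = {(\<lambda>\<omega>. increment m \<omega> $ n $ d) -` A \<inter> space M |A. A \<in> sets borel}"

definition innovations :: "('n source \<times> 'd \<times> nat) set" where
  "innovations = Sigma (Label ` {1..} \<union> range Motion) (\<lambda>s. case s of Motion n \<Rightarrow> UNIV | _ \<Rightarrow> {(undefined, 0)})"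

text \<open>
  The \<open>k\<close>-th gap consists of the steps \<open>2 k\<close> and \<open>2 k + 1\<close> of the motion, followed by label \<open>k + 1\<close>.
\<close>

fun clock :: "'n source \<times> 'd \<times> nat \<Rightarrow> nat" where
  "clock (Jumps, d, m) = 0"
| "clock (Label i, d, m) = 3 * i - 1"
| "clock (Motion n, d, m) = m + m div 2"

text \<open>The second use of \<open>indep_sets_nested\<close>: the outer groups are the labels and
  the motions of whole particles, the inner ones the increments of the coordinates of one
  particle.\<close>

lemma indep_innovations: "indep_sets events_of innovations"
proof -
  have "indep_sets (\<lambda>(s, k). events_of (s, k)) innovations"
    unfolding innovations_def
  proof (rule indep_sets_nested)
    show "indep_sets (source_events M J U B) (Label ` {1..} \<union> range Motion)"
      using independent by (rule indep_sets_mono_index[rotated]) auto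
    show "sigma_algebra (space M) (source_events M J U B s)" for s
      by (rule sigma_algebra_source_events)
    fix s :: "'n source" assume s: "s \<in> Label ` {1..} \<union> range Motion"
    show "indep_sets (\<lambda>k. events_of (s, k)) (case s of Motion n \<Rightarrow> UNIV | _ \<Rightarrow> {(undefined, 0)})"
    proof (cases s)
      case (Motion n)
      have "(\<lambda>k. events_of (s, k)) =
          (\<lambda>(d, m). {(\<lambda>\<omega>. B n (\<tau> (Suc m)) \<omega> $ d - B n (\<tau> m) \<omega> $ d) -` A \<inter> space M |A. A \<in> sets borel})"
        by (rule ext) (simp add: Motion increment_def split: prod.split)
      then show ?thesis
        using indep_sets_increments[OF brownian[of n] \<tau>_0 strict_mono_mono[OF \<tau>_mono]] Motion by simp
    next
      case (Label i)
      have "source_events M J U B (Label i) \<subseteq> events"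
      proof -
        have "s \<in> {Jumps} \<union> Label ` {1..} \<union> range Motion"
          using s by blast
        then show ?thesis
          using independent unfolding indep_sets_def Label by blast
      qed
      then show ?thesis
        using Label by (simp add: indep_sets_singleton)
    qed (use s in auto)
    fix k assume "k \<in> (case s of Motion n \<Rightarrow> UNIV :: ('d \<times> nat) set | _ \<Rightarrow> {(undefined, 0)})"
    show "events_of (s, k) \<subseteq> source_events M J U B s"
    proof (cases s)
      case (Motion n)
      obtain d m where k: "k = (d, m)" by (cases k)
      have comp: "(\<lambda>w. w t $ d) \<in> borel_measurable (Pi\<^sub>M {0..} (\<lambda>_. borel :: (real ^ 'd) measure))" if "0 \<le> t" for t :: real
        using measurable_compose[OF measurable_component_singleton[of t "{0..}" "\<lambda>_. borel :: (real ^ 'd) measure"]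
          borel_measurable_vec_component[of d]] that by simp
      have "(\<lambda>w. w (\<tau> (Suc m)) $ d - w (\<tau> m) $ d) \<in> borel_measurable (Pi\<^sub>M {0..} (\<lambda>_. borel :: (real ^ 'd) measure))"
        using \<tau>_nonneg by (intro borel_measurable_diff comp) auto
      from source_events_Motion[OF this, of _ B n M J U] show ?thesis
        using \<tau>_nonneg by (auto simp: Motion k increment_def simp del: source_events.simps)
    qed (cases k; simp del: source_events.simps)+
  qed
  then show ?thesis
    by (simp add: case_prod_eta)
qed

lemma Int_stable_events_of: "Int_stable (events_of p)"
proof (cases p rule: events_of.cases)
  case (1 d m)
  then show ?thesis by (simp add: Int_stable_def)
next
  case (2 i d m)
  have "Int_stable (sets N)" for N :: "'w measure"
    by (intro Int_stableI sets.Int)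
  then show ?thesis
    using 2 by simp
next
  case (3 n d m)
  then show ?thesis
    by (simp only: events_of.simps Int_stable_vimages)
qed

definition Past :: "nat \<Rightarrow> 'w measure" where
  "Past c = history events_of {p \<in> innovations. clock p < c}"

definition Now :: "nat \<Rightarrow> 'w measure" where
  "Now c = history events_of {p \<in> innovations. clock p = c}"

lemma increment_Now:
  assumes "clock (Motion undefined, undefined, m) = c"
  shows "increment m \<in> Now c \<rightarrow>\<^sub>M borel"
proof -
  have "(\<lambda>\<omega>. increment m \<omega> $ n $ d) \<in> borel_measurable (Now c)" for n d
  proof (rule measurableI)
    fix A assume A: "A \<in> sets (borel :: real measure)"
    have p: "(Motion n, d, m) \<in> {p \<in> innovations. clock p = c}"
      using assms by (auto simp: innovations_def)
    have "(\<lambda>\<omega>. increment m \<omega> $ n $ d) -` A \<inter> space M \<in> events_of (Motion n, d, m)"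
      using A by auto
    then show "(\<lambda>\<omega>. increment m \<omega> $ n $ d) -` A \<inter> space (Now c) \<in> sets (Now c)"
      unfolding Now_def space_history using p
      by (subst sets_history[OF indep_innovations]) (blast intro: sigma_sets.Basic)+
  qed simp
  then show ?thesis
    by (subst borel_measurable_euclidean_space) (auto simp: Basis_config inner_axis)
qed

lemma label_Now: "U (Suc k) \<in> Now (3 * k + 2) \<rightarrow>\<^sub>M count_space UNIV"
proof (rule measurableI)
  fix A :: "'n set"
  have p: "(Label (Suc k), undefined, 0) \<in> {p \<in> innovations. clock p = 3 * k + 2}"
    by (auto simp: innovations_def)
  have "U (Suc k) -` A \<inter> space M \<in> events_of (Label (Suc k), undefined, 0)"
    by (auto intro: in_vimage_algebra)
  then show "U (Suc k) -` A \<inter> space (Now (3 * k + 2)) \<in> sets (Now (3 * k + 2))"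
    unfolding Now_def space_history using p
    by (subst sets_history[OF indep_innovations]) (blast intro: sigma_sets.Basic)+
qed simp

lemma distr_increment: "distr M borel (increment m) = gauss (\<tau> (Suc m) - \<tau> m)"
proof (rule distr_eq_gauss)
  have "subalgebra M (Now (m + m div 2))"
    unfolding Now_def by (rule subalgebra_history[OF indep_innovations]) auto
  then show rv: "random_variable borel (increment m)"
    by (rule measurable_from_subalg) (rule increment_Now, simp)
  let ?e = "\<lambda>(n, d). axis n (axis d (1 :: real)) :: ('d, 'n) config"
  \<comment> \<open>\<open>f\<close> sends a basis vector to the innovation that is the
    corresponding coordinate of the increment, so independence over \<open>Basis\<close> is a
    reindexed part of \<open>indep_innovations\<close>.\<close>
  define f where "f b = (let (n, d) = inv ?e b in (Motion n :: 'n source, d :: 'd, m))" for b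
  have f: "f (axis n (axis d 1)) = (Motion n, d, m)" for n d
    using inv_f_f[OF inj_axis_axis, of "(n, d)"] by (simp add: f_def)
  have inj: "inj_on f Basis"
    unfolding Basis_config by (auto simp: inj_on_def f)
  have "f ` Basis \<subseteq> innovations"
    unfolding Basis_config by (auto simp: f innovations_def)
  then have "indep_sets (\<lambda>b. events_of (f b)) Basis"
    by (rule indep_sets_reindex[OF inj indep_sets_mono_index[OF _ indep_innovations]])
  then have "indep_sets (\<lambda>b. {(\<lambda>\<omega>. increment m \<omega> \<bullet> b) -` A \<inter> space M |A. A \<in> sets borel}) Basis"
    by (rule indep_sets_mono_sets) (clarsimp simp: Basis_config f inner_axis, blast)
  then show "indep_vars (\<lambda>_. borel) (\<lambda>b \<omega>. increment m \<omega> \<bullet> b) Basis"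
    unfolding indep_vars_def2 using rv by auto
  fix b :: "('d, 'n) config" assume "b \<in> Basis"
  then obtain n d where b: "b = axis n (axis d 1)"
    by (auto simp: Basis_config)
  have "std_brownian_motion (\<lambda>t \<omega>. B n t \<omega> $ d)"
    using brownian[of n] by (auto simp: std_brownian_motion_vec_def)
  then have "distributed M lborel (\<lambda>\<omega>. B n (\<tau> (Suc m)) \<omega> $ d - B n (\<tau> m) \<omega> $ d) (normal_density 0 (sqrt (\<tau> (Suc m) - \<tau> m)))"
    using \<tau>_nonneg strict_monoD[OF \<tau>_mono, of m "Suc m"] unfolding std_brownian_motion_def by blast
  then show "distributed M lborel (\<lambda>\<omega>. increment m \<omega> \<bullet> b) (normal_density 0 (sqrt (\<tau> (Suc m) - \<tau> m)))"
    by (simp add: b inner_axis increment_def)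
qed

sublocale gaussian_bees M Past Now "\<lambda>k. increment (2 * k)" "\<lambda>k. increment (2 * k + 1)" "\<lambda>k. U (Suc k)"
  "\<lambda>k. \<tau> (2 * k + 1) - \<tau> (2 * k)" "\<lambda>k. \<tau> (2 * k + 2) - \<tau> (2 * k + 1)" x
proof
  fix c k
  show "subalgebra M (Past c)" "subalgebra M (Now c)"
    unfolding Past_def Now_def by (rule subalgebra_history[OF indep_innovations]; auto)+
  show "indep_set (sets (Past c)) (sets (Now c))"
    unfolding Past_def Now_def
    by (rule indep_set_history[OF indep_innovations]) (auto simp: Int_stable_events_of)
  show "sets (Past c) \<subseteq> sets (Past (Suc c))" "sets (Now c) \<subseteq> sets (Past (Suc c))"
    unfolding Past_def Now_def by (rule sets_history_mono[OF indep_innovations]; auto)+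
  show "increment (2 * k) \<in> Now (3 * k) \<rightarrow>\<^sub>M borel" "increment (2 * k + 1) \<in> Now (3 * k + 1) \<rightarrow>\<^sub>M borel"
    by (rule increment_Now; simp)+
  show "U (Suc k) \<in> Now (3 * k + 2) \<rightarrow>\<^sub>M count_space UNIV"
    by (rule label_Now)
  show "distr M borel (increment (2 * k)) = gauss (\<tau> (2 * k + 1) - \<tau> (2 * k))"
    "distr M borel (increment (2 * k + 1)) = gauss (\<tau> (2 * k + 2) - \<tau> (2 * k + 1))"
    using distr_increment[of "2 * k"] distr_increment[of "2 * k + 1"] by simp_all
  show "distr M (count_space UNIV) (U (Suc k)) = uniform_count_measure UNIV"
    by (rule labels_uniform) simp
  show "0 < \<tau> (2 * k + 1) - \<tau> (2 * k)" "0 < \<tau> (2 * k + 2) - \<tau> (2 * k + 1)"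
    using strict_monoD[OF \<tau>_mono, of "2 * k" "2 * k + 1"] strict_monoD[OF \<tau>_mono, of "2 * k + 1" "2 * k + 2"] by auto
qed

end

subsection \<open>Random jump times\<close>

text \<open>Rounding up keeps the times nonnegative. At each level only countably many times occur,
  which makes the approximations of \<open>W\<close> jointly measurable.\<close>

definition dyadic :: "nat \<Rightarrow> real \<Rightarrow> real" where
  "dyadic k t = real (nat \<lceil>2 ^ k * t\<rceil>) / 2 ^ k"

lemma dyadic_nonneg: "0 \<le> dyadic k t"
  by (simp add: dyadic_def)

lemma dyadic_tendsto:
  assumes "0 \<le> t"
  shows "(\<lambda>k. dyadic k t) \<longlonglongrightarrow> t"
proof (rule real_tendsto_sandwich)
  have eq: "dyadic k t = real_of_int \<lceil>2 ^ k * t\<rceil> / 2 ^ k" for k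
    using assms by (simp add: dyadic_def)
  show "\<forall>\<^sub>F k in sequentially. t \<le> dyadic k t"
    by (intro always_eventually allI) (simp add: eq divide_simps mult.commute le_of_int_ceiling)
  show "\<forall>\<^sub>F k in sequentially. dyadic k t \<le> t + (1 / 2) ^ k"
  proof (intro always_eventually allI)
    fix k
    have "real_of_int \<lceil>2 ^ k * t\<rceil> \<le> 2 ^ k * t + 1"
      by linarith
    then have "real_of_int \<lceil>2 ^ k * t\<rceil> / 2 ^ k \<le> (2 ^ k * t + 1) / 2 ^ k"
      by (rule divide_right_mono) simp
    then show "dyadic k t \<le> t + (1 / 2) ^ k"
      unfolding eq by (simp add: add_divide_distrib power_one_over)
  qed
  show "(\<lambda>k. t + (1 / 2) ^ k) \<longlonglongrightarrow> t"
    using tendsto_add[OF tendsto_const LIMSEQ_power_zero[of "1 / 2 :: real"], of t] by simp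
qed simp

lemma measurable_tie [measurable (raw)]:
  assumes [measurable]: "f \<in> N \<rightarrow>\<^sub>M borel" and g: "g \<in> N \<rightarrow>\<^sub>M count_space UNIV"
  shows "Measurable.pred N (\<lambda>p. tie (f p :: ('d::finite, 'n::finite) config) (g p) i j)"
proof (rule measurable_compose_countable[OF _ g])
  show "Measurable.pred N (\<lambda>p. tie (f p) u i j)" for u
    unfolding tie_def by measurable
qed

text \<open>The recursion of the chain \<open>Z\<close> as a functional of times, labels and paths,
  so that it can be evaluated both at frozen and at random jump times.\<close>

fun skeleton :: "('d::finite, 'n::finite) config \<Rightarrow> (nat \<Rightarrow> real) \<Rightarrow> (nat \<Rightarrow> 'n) \<Rightarrow> (real \<Rightarrow> ('d, 'n) config)
    \<Rightarrow> nat \<Rightarrow> ('d, 'n) config" where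
  "skeleton x j u w 0 = x"
| "skeleton x j u w (Suc k) = bee_jump (skeleton x j u w k + w (j (Suc k)) - w (j k)) (u (Suc k))"

lemma Int_stable_source_events: "Int_stable (source_events M J U B s)"
proof -
  have "Int_stable (sets N)" for N :: "'a measure"
    by (intro Int_stableI sets.Int)
  then show ?thesis
    by (cases s) simp_all
qed

context bbb_process
begin

text \<open>A version of the motions that is jointly measurable in time and chance.\<close>

definition W :: "real \<Rightarrow> 'w \<Rightarrow> ('d, 'n) config" where
  "W t \<omega> = lim (\<lambda>k. \<chi> n. B n (dyadic k t) \<omega>)"

text \<open>All randomness except the jump times, which are independent of it.\<close>

definition Driving :: "'w measure" where
  "Driving = history (source_events M J U B) (Label ` {1..} \<union> range Motion)"

lemma sets_Driving: "s \<in> Label ` {1..} \<union> range Motion \<Longrightarrow> source_events M J U B s \<subseteq> sets Driving"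
proof -
  assume s: "s \<in> Label ` {1..} \<union> range Motion"
  have "sets Driving = sigma_sets (space M) (\<Union>s\<in>Label ` {1..} \<union> range Motion. source_events M J U B s)"
    unfolding Driving_def by (rule sets_history[OF independent]) auto
  then show ?thesis
    using UN_upper[OF s, of "source_events M J U B"] sigma_sets_superset_generator by (metis order_trans)
qed

lemma space_Driving [simp]: "space Driving = space M"
  by (simp add: Driving_def)

lemma subalgebra_Driving: "subalgebra M Driving"
  unfolding Driving_def by (rule subalgebra_history[OF independent]) auto

lemma U_Driving: "U (Suc i) \<in> Driving \<rightarrow>\<^sub>M count_space UNIV"
proof (rule measurableI)
  fix A :: "'n set"
  have "U (Suc i) -` A \<inter> space M \<in> source_events M J U B (Label (Suc i))"
    by (auto intro: in_vimage_algebra)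
  then show "U (Suc i) -` A \<inter> space Driving \<in> sets Driving"
    using sets_Driving[of "Label (Suc i)"] by auto
qed simp

lemma B_Driving:
  assumes "0 \<le> t"
  shows "B n t \<in> borel_measurable Driving"
proof (rule measurableI)
  fix A assume "A \<in> sets (borel :: (real ^ 'd) measure)"
  moreover have "(\<lambda>w. w t) \<in> Pi\<^sub>M {0..} (\<lambda>_. borel :: (real ^ 'd) measure) \<rightarrow>\<^sub>M borel"
    using assms by (intro measurable_component_singleton) auto
  ultimately have "(\<lambda>\<omega>. (\<lambda>t\<in>{0..}. B n t \<omega>) t) -` A \<inter> space M \<in> source_events M J U B (Motion n)"
    by (intro source_events_Motion)
  then show "B n t -` A \<inter> space Driving \<in> sets Driving"
    using sets_Driving[of "Motion n"] assms by (auto simp del: source_events.simps)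
qed simp

lemma W_measurable: "(\<lambda>p. W (fst p) (snd p)) \<in> borel_measurable (borel \<Otimes>\<^sub>M Driving)"
  unfolding W_def
proof (rule borel_measurable_lim_metric)
  fix k
  have "(\<lambda>p. \<chi> n. B n (real i / 2 ^ k) (snd p)) \<in> borel_measurable (borel \<Otimes>\<^sub>M Driving)" for i
  proof (subst borel_measurable_euclidean_space, rule ballI)
    fix b :: "('d, 'n) config" assume "b \<in> Basis"
    then obtain n d where b: "b = axis n (axis d 1)"
      by (auto simp: Basis_config)
    have [measurable]: "B n (real i / 2 ^ k) \<in> borel_measurable Driving"
      by (rule B_Driving) simp
    show "(\<lambda>p. (\<chi> n. B n (real i / 2 ^ k) (snd p)) \<bullet> b) \<in> borel_measurable (borel \<Otimes>\<^sub>M Driving)"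
      by (simp add: b inner_axis) measurable
  qed
  then show "(\<lambda>p. \<chi> n. B n (dyadic k (fst p)) (snd p)) \<in> borel_measurable (borel \<Otimes>\<^sub>M Driving)"
    unfolding dyadic_def
    by (rule measurable_compose_countable[where f = "\<lambda>i p. \<chi> n. B n (real i / 2 ^ k) (snd p)"]) measurable
qed

lemma W_compose [measurable (raw)]:
  assumes "f \<in> borel_measurable N" "g \<in> N \<rightarrow>\<^sub>M Driving"
  shows "(\<lambda>p. W (f p) (g p)) \<in> borel_measurable N"
  using measurable_compose[OF measurable_Pair[OF assms] W_measurable] by simp

lemma AE_W:
  "AE \<omega> in M. (\<forall>n. continuous_on {0..} (\<lambda>t. B n t \<omega>)) \<and> (\<forall>t\<ge>0. W t \<omega> = (\<chi> n. B n t \<omega>))"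
proof -
  have "AE \<omega> in M. \<forall>n d. continuous_on {0..} (\<lambda>t. B n t \<omega> $ d)"
    using brownian by (simp add: AE_all_countable std_brownian_motion_vec_def std_brownian_motion_def)
  then show ?thesis
  proof eventually_elim
    case (elim \<omega>)
    have cont: "continuous_on {0..} (\<lambda>t. B n t \<omega>)" for n
    proof -
      have "continuous_on {0..} (\<lambda>t. \<chi> d. B n t \<omega> $ d)"
        using elim by (intro continuous_on_vec_lambda) auto
      then show ?thesis by simp
    qed
    moreover have "W t \<omega> = (\<chi> n. B n t \<omega>)" if "0 \<le> t" for t
      unfolding W_def
    proof (intro limI tendsto_vec_lambda)
      fix n
      show "(\<lambda>k. B n (dyadic k t) \<omega>) \<longlonglongrightarrow> B n t \<omega>"
        using that by (intro continuous_on_tendsto_compose[OF cont dyadic_tendsto])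
          (auto simp: dyadic_nonneg)
    qed
    ultimately show ?case by blast
  qed
qed

abbreviation skel :: "'w \<Rightarrow> (nat \<Rightarrow> real) \<Rightarrow> nat \<Rightarrow> ('d, 'n) config" where
  "skel \<omega> j \<equiv> skeleton x j (\<lambda>i. U i \<omega>) (\<lambda>t. W t \<omega>)"

abbreviation tie_free :: "'w \<Rightarrow> (nat \<Rightarrow> real) \<Rightarrow> bool" where
  "tie_free \<omega> j \<equiv> \<forall>k i i'. i \<noteq> i' \<longrightarrow> \<not> tie (skel \<omega> j k + W (j (Suc k)) \<omega> - W (j k) \<omega>) (U (Suc k) \<omega>) i i'"

abbreviation hits :: "('d, 'n) config set \<Rightarrow> real \<Rightarrow> 'w \<Rightarrow> (nat \<Rightarrow> real) \<Rightarrow> bool" where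
  "hits A s \<omega> j \<equiv> \<forall>m. \<exists>k\<ge>m. 2 \<le> j (Suc k) - j k \<and> centered (skel \<omega> j k + W (j k + s) \<omega> - W (j k) \<omega>) \<in> A"

lemma AE_fixed_times:
  assumes j: "good_times j" and A: "A \<in> sets borel" and pos: "0 < emeasure lborel (cball 0 1 \<inter> centered -` A)"
    and s: "0 < s" "s < 1"
  shows "AE \<omega> in M. tie_free \<omega> j \<and> hits A s \<omega> j"
proof -
  define g where "g k = j (Suc k) - j k" for k
  have g: "0 < g k" for k
    using j by (simp add: good_times_def g_def)
  define \<tau> where "\<tau> m = (if even m then j (m div 2) else j (m div 2) + min s (g (m div 2) / 2))" for m
  have \<tau>_even: "\<tau> (2 * k) = j k" and \<tau>_odd: "\<tau> (2 * k + 1) = j k + min s (g k / 2)" for k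
    by (simp_all add: \<tau>_def)
  have \<tau>_even': "\<tau> (2 * k + 2) = j (Suc k)" for k
    using \<tau>_even[of "Suc k"] by simp
  have "\<tau> m < \<tau> (Suc m)" for m
  proof (cases "even m")
    case True
    then obtain k where "m = 2 * k" by blast
    then show ?thesis
      using \<tau>_even[of k] \<tau>_odd[of k] g[of k] s by simp
  next
    case False
    then obtain k where "m = 2 * k + 1" by (rule oddE)
    moreover have "min s (g k / 2) < j (Suc k) - j k"
    proof -
      have "min s (g k / 2) \<le> g k / 2" by (rule min.cobounded2)
      also have "\<dots> < g k" using g[of k] by simp
      finally show ?thesis by (simp add: g_def)
    qed
    ultimately show ?thesis
      using \<tau>_even'[of k] \<tau>_odd[of k] by simp
  qed
  then have "strict_mono \<tau>"
    by (simp add: strict_mono_Suc_iff)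
  moreover have "\<tau> 0 = 0"
    using j by (simp add: \<tau>_def good_times_def)
  ultimately interpret G: bbb_grid M J U B x X \<tau>
    by unfold_locales auto
  have "\<exists>K. infinite {k. 2 \<le> g k \<and> G.bound k \<le> K}"
  proof (rule bounded_at_long_gaps)
    show "0 \<le> contraction TYPE('n)" "contraction TYPE('n) < 1"
      by (rule contraction_bounds)+
    show "G.bound (Suc k) = contraction TYPE('n) * (G.bound k + real DIM(('d, 'n) config) * g k)" for k
    proof -
      have "\<tau> (2 * k + 1) - \<tau> (2 * k) + (\<tau> (2 * k + 2) - \<tau> (2 * k + 1)) = g k"
        unfolding \<tau>_even \<tau>_even' g_def by simp
      then show ?thesis by (simp only: G.bound.simps(2))
    qed
    show "0 \<le> g k" for k
      using g less_imp_le by blast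
    have sum: "(\<Sum>k<n. g k) = j n" for n
      using j by (simp add: g_def sum_lessThan_telescope good_times_def)
    obtain R :: nat where "\<forall>m. \<exists>n\<ge>m. j n \<le> real R * real n"
      using j by (auto simp: good_times_def)
    then show "\<exists>\<^sub>\<infinity>n. (\<Sum>k<n. g k) \<le> real (SOME R :: nat. \<forall>m. \<exists>n\<ge>m. j n \<le> real R * real n) * real n"
      unfolding sum INFM_nat_le by (rule someI)
    show "infinite {k. 2 \<le> g k}"
      using j by (simp add: infinite_nat_iff_unbounded_le good_times_def g_def)
    show "0 \<le> G.bound 0"
      by (rule G.bound_nonneg)
  qed simp
  then obtain K where K: "infinite {k. 2 \<le> g k \<and> G.bound k \<le> K}" (is "infinite ?I")
    by blast
  have "AE \<omega> in M. infinite {k \<in> ?I. centered (G.Z k \<omega> + G.increment (2 * k) \<omega>) \<in> A}"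
    using s \<tau>_even \<tau>_odd by (intro G.AE_infinitely_many_hits[OF K _ _ A pos, of _ s]) auto
  then show ?thesis
    using G.AE_no_tie AE_W
  proof eventually_elim
    case (elim \<omega>)
    have j_nonneg: "0 \<le> j k" for k
      using G.\<tau>_nonneg[of "2 * k"] \<tau>_even by simp
    have W: "W t \<omega> = (\<chi> n. B n t \<omega>)" if "0 \<le> t" for t
      using elim(3) that by blast
    have inc: "G.increment m \<omega> = W (\<tau> (Suc m)) \<omega> - W (\<tau> m) \<omega>" for m
      by (simp add: W G.\<tau>_nonneg G.increment_def vec_eq_iff)
    have step: "G.increment (2 * k) \<omega> + G.increment (2 * k + 1) \<omega> = W (j (Suc k)) \<omega> - W (j k) \<omega>" for k
    proof -
      have "Suc (2 * k + 1) = 2 * k + 2" by simp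
      then have "G.increment (2 * k + 1) \<omega> = W (j (Suc k)) \<omega> - W (\<tau> (2 * k + 1)) \<omega>"
        using inc[of "2 * k + 1"] \<tau>_even'[of k] by metis
      moreover have "G.increment (2 * k) \<omega> = W (\<tau> (2 * k + 1)) \<omega> - W (j k) \<omega>"
        using inc[of "2 * k"] \<tau>_even[of k] by (metis Suc_eq_plus1)
      moreover have "p - q + (r - p) = r - q" for p q r :: "('d, 'n) config"
        by simp
      ultimately show ?thesis
        by (simp only:)
    qed
    have Z: "G.Z k \<omega> = skel \<omega> j k" for k
    proof (induction k)
      case 0
      show ?case by (simp only: G.Z.simps skeleton.simps)
    next
      case (Suc k)
      show ?case
        by (simp only: G.Z.simps skeleton.simps Suc add.assoc step add_diff_eq)
    qed
    have "tie_free \<omega> j"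
    proof (intro allI impI)
      fix k and i i' :: 'n assume "i \<noteq> i'"
      then have "\<not> tie (G.Z k \<omega> + G.increment (2 * k) \<omega> + G.increment (2 * k + 1) \<omega>) (U (Suc k) \<omega>) i i'"
        using elim(2) by blast
      then show "\<not> tie (skel \<omega> j k + W (j (Suc k)) \<omega> - W (j k) \<omega>) (U (Suc k) \<omega>) i i'"
        by (simp only: Z add.assoc step add_diff_eq not_False_eq_True)
    qed
    moreover have "hits A s \<omega> j"
    proof
      fix m
      obtain k where k: "k \<ge> m" "2 \<le> g k" "centered (G.Z k \<omega> + G.increment (2 * k) \<omega>) \<in> A"
        using elim(1) unfolding infinite_nat_iff_unbounded_le by blast
      have "\<tau> (Suc (2 * k)) = j k + s"
        using \<tau>_odd[of k] k(2) s by simp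
      then have "G.increment (2 * k) \<omega> = W (j k + s) \<omega> - W (j k) \<omega>"
        by (simp only: inc \<tau>_even)
      then have "centered (skel \<omega> j k + W (j k + s) \<omega> - W (j k) \<omega>) \<in> A"
        using k(3) by (simp only: Z add_diff_eq)
      then show "\<exists>k\<ge>m. 2 \<le> j (Suc k) - j k \<and> centered (skel \<omega> j k + W (j k + s) \<omega> - W (j k) \<omega>) \<in> A"
        using k(1,2) unfolding g_def by blast
    qed
    ultimately show ?case by blast
  qed
qed

section \<open>Joint measurability and the return to random jump times\<close>

lemma skel_measurable [measurable]:
  "(\<lambda>p. skel (fst p) (snd p) k) \<in> borel_measurable (Driving \<Otimes>\<^sub>M Pi\<^sub>M UNIV (\<lambda>_. borel))"
proof (induction k)
  case (Suc k)
  note [measurable] = Suc U_Driving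
  show ?case by simp measurable
qed simp

lemma tie_free_measurable: "Measurable.pred (Driving \<Otimes>\<^sub>M Pi\<^sub>M UNIV (\<lambda>_. borel)) (\<lambda>p. tie_free (fst p) (snd p))"
proof -
  note [measurable] = U_Driving
  show ?thesis by measurable
qed

lemma hits_measurable:
  assumes [measurable]: "A \<in> sets borel"
  shows "Measurable.pred (borel \<Otimes>\<^sub>M (Driving \<Otimes>\<^sub>M Pi\<^sub>M UNIV (\<lambda>_. borel)))
    (\<lambda>p. hits A (fst p) (fst (snd p)) (snd (snd p)))"
proof -
  have [measurable]: "(\<lambda>p. skel (fst (snd p)) (snd (snd p)) k) \<in>
      borel_measurable (borel \<Otimes>\<^sub>M (Driving \<Otimes>\<^sub>M Pi\<^sub>M UNIV (\<lambda>_. borel)))" for k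
    using measurable_compose[OF measurable_snd skel_measurable[of k]] by simp
  show ?thesis by measurable
qed

end

context bbb_process
begin

lemma hits_compose:
  assumes A: "A \<in> sets borel" and f: "f \<in> borel_measurable N" and g: "g \<in> N \<rightarrow>\<^sub>M Driving"
    and h: "h \<in> N \<rightarrow>\<^sub>M Pi\<^sub>M UNIV (\<lambda>_. borel)"
  shows "Measurable.pred N (\<lambda>p. hits A (f p) (g p) (h p))"
  using measurable_compose[OF measurable_Pair[OF f measurable_Pair[OF g h]] hits_measurable[OF A]]
  by (simp only: fst_conv snd_conv)

text \<open>Almost every realization of the jump times is good, so \<open>AE_fixed_times\<close>
  applies to it, and \<open>AE_freeze\<close> treats the whole sequence as one innovation
  independent of \<open>Driving\<close>.\<close>

lemma AE_random_times:
  assumes A: "A \<in> sets borel" and pos: "0 < emeasure lborel (cball 0 1 \<inter> centered -` A)"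
    and s: "0 < s" "s < 1"
  shows "AE \<omega> in M. tie_free \<omega> (\<lambda>i. J i \<omega>) \<and> hits A s \<omega> (\<lambda>i. J i \<omega>)"
proof -
  let ?S = "Pi\<^sub>M UNIV (\<lambda>_ :: nat. borel :: real measure)"
  let ?H = "history (source_events M J U B) {Jumps}"
  have H: "subalgebra M ?H"
    by (rule subalgebra_history[OF independent]) auto
  have indep: "indep_set (sets Driving) (sets ?H)"
    unfolding Driving_def
  proof (rule indep_set_history[OF independent])
    show "Int_stable (source_events M J U B s)" for s
      by (rule Int_stable_source_events)
  qed auto
  have J_H: "(\<lambda>\<omega> i. J i \<omega>) \<in> ?H \<rightarrow>\<^sub>M ?S"
  proof (rule measurableI)
    fix E assume "E \<in> sets ?S"
    then have "(\<lambda>\<omega> i. J i \<omega>) -` E \<inter> space M \<in> source_events M J U B Jumps"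
      by (auto intro: in_vimage_algebra)
    then show "(\<lambda>\<omega> i. J i \<omega>) -` E \<inter> space ?H \<in> sets ?H"
      unfolding space_history
      by (subst sets_history[OF independent]) (auto intro: sigma_sets.Basic simp del: source_events.simps)
  qed (simp add: space_PiM)
  have meas: "Measurable.pred (Driving \<Otimes>\<^sub>M ?S) (\<lambda>p. tie_free (fst p) (snd p) \<and> hits A s (fst p) (snd p))"
    by (rule pred_intros_logic(3)[OF tie_free_measurable hits_compose[OF A borel_measurable_const measurable_fst measurable_snd]])
  have "AE j in distr M ?S (\<lambda>\<omega> i. J i \<omega>). good_times j"
  proof (subst AE_distr_iff[OF J_measurable])
    show "{j \<in> space ?S. good_times j} \<in> sets ?S"
      by (rule measurable_good_times[unfolded pred_def])
    show "AE \<omega> in M. good_times (\<lambda>i. J i \<omega>)"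
      by (rule AE_good_times)
  qed
  then have "AE j in distr M ?S (\<lambda>\<omega> i. J i \<omega>). AE \<omega> in M. tie_free (fst (\<omega>, j)) (snd (\<omega>, j)) \<and> hits A s (fst (\<omega>, j)) (snd (\<omega>, j))"
  proof eventually_elim
    case (elim j)
    then show ?case
      unfolding fst_conv snd_conv by (rule AE_fixed_times[OF _ A pos s])
  qed
  from AE_freeze[OF subalgebra_Driving H indep J_H meas this] show ?thesis
    by (simp only: fst_conv snd_conv)
qed

text \<open>The exceptional null set depends on \<open>s\<close>, which ranges over uncountably many
  values. Fubini's theorem exchanges the quantifiers at the price of a null set of offsets, which
  does not affect the later integral.\<close>

lemma AE_almost_all_offsets:
  assumes A: "A \<in> sets borel" and pos: "0 < emeasure lborel (cball 0 1 \<inter> centered -` A)"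
  shows "AE \<omega> in M. AE s in lborel. 1 / 2 < s \<and> s < 1 \<longrightarrow> hits A s \<omega> (\<lambda>i. J i \<omega>)"
proof -
  interpret L: pair_sigma_finite "lborel :: real measure" M
    by (intro pair_sigma_finite.intro) unfold_locales
  have id: "(\<lambda>\<omega>. \<omega>) \<in> M \<rightarrow>\<^sub>M Driving"
    by (intro measurable_from_subalg[OF subalgebra_Driving] measurable_ident_sets) simp
  have hits: "Measurable.pred (lborel \<Otimes>\<^sub>M M) (\<lambda>p. hits A (fst p) (snd p) (\<lambda>i. J i (snd p)))"
    by (rule hits_compose[OF A _ measurable_compose[OF measurable_snd id] measurable_compose[OF measurable_snd J_measurable]])
       simp
  have "Measurable.pred (lborel \<Otimes>\<^sub>M M) (\<lambda>p. (1 / 2 :: real) < fst p \<and> fst p < 1)"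
    by measurable
  then have "Measurable.pred (lborel \<Otimes>\<^sub>M M) (\<lambda>p. 1 / 2 < fst p \<and> fst p < 1 \<longrightarrow> hits A (fst p) (snd p) (\<lambda>i. J i (snd p)))"
    by (rule pred_intros_logic(4)[OF _ hits])
  then have "(AE s in lborel. AE \<omega> in M. 1 / 2 < s \<and> s < 1 \<longrightarrow> hits A s \<omega> (\<lambda>i. J i \<omega>)) \<longleftrightarrow>
      (AE \<omega> in M. AE s in lborel. 1 / 2 < s \<and> s < 1 \<longrightarrow> hits A s \<omega> (\<lambda>i. J i \<omega>))"
    unfolding pred_def by (rule L.AE_commute)
  moreover have "AE \<omega> in M. 1 / 2 < s \<and> s < 1 \<longrightarrow> hits A s \<omega> (\<lambda>i. J i \<omega>)" for s
  proof (cases "1 / 2 < s \<and> s < 1")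
    case True
    then have "0 < s" "s < 1" by auto
    from AE_random_times[OF A pos this] show ?thesis
      by (rule eventually_mono) (rule impI, erule conjunct2)
  next
    case False
    show ?thesis
      by (intro always_eventually allI impI) (erule notE[OF False])
  qed
  then have "AE s in lborel. AE \<omega> in M. 1 / 2 < s \<and> s < 1 \<longrightarrow> hits A s \<omega> (\<lambda>i. J i \<omega>)"
    by (rule AE_I2)
  ultimately show ?thesis
    by (rule iffD1)
qed

end

subsection \<open>Occupation times\<close>

text \<open>This is deterministic. Continuity identifies the left limit in \<open>bbb_path\<close>
  with the endpoint of the motion, and without ties the maximizer is strict, so the jump is
  \<open>bee_jump\<close>.\<close>

lemma bbb_path_eq_skeleton:
  fixes x :: "('d::finite, 'n::finite) config"
  assumes path: "bbb_path x j u b Y" and j: "j 0 = 0" "\<And>i. j i < j (Suc i)"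
    and cont: "\<And>n. continuous_on {0..} (b n)" and w: "\<And>t. 0 \<le> t \<Longrightarrow> w t = (\<chi> n. b n t)"
    and ties: "\<And>k i i'. i \<noteq> i' \<Longrightarrow> \<not> tie (skeleton x j u w k + w (j (Suc k)) - w (j k)) (u (Suc k)) i i'"
  shows "t \<in> {j k..<j (Suc k)} \<Longrightarrow> Y t = skeleton x j u w k + w t - w (j k)"
proof -
  have j_nonneg: "0 \<le> j i" for i
    by (induction i) (use j in \<open>auto intro: order_trans less_imp_le\<close>)
  have between: "Y t = Y (j k) + w t - w (j k)" if "t \<in> {j k..<j (Suc k)}" for t k
    using path that j_nonneg[of k] by (auto simp: bbb_path_def w vec_eq_iff)
  have main: "Y (j k) = skeleton x j u w k" for k
  proof (induction k)
    case 0
    then show ?case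
      using path j by (simp add: bbb_path_def)
  next
    case (Suc k)
    let ?s = "j (Suc k)"
    let ?y = "Y (j k) + w ?s - w (j k)"
    have s: "0 < ?s"
      using j_nonneg[of k] j(2)[of k] by linarith
    have "continuous_on {0..} (\<lambda>t. \<chi> n. b n t)"
      using cont by (rule continuous_on_vec_lambda)
    then have "continuous_on {0..} w"
      using w by (subst continuous_on_cong[OF refl, of _ _ "\<lambda>t. \<chi> n. b n t"]) auto
    then have "isCont w ?s"
      by (rule continuous_on_interior) (use s in simp)
    then have "(w \<longlongrightarrow> w ?s) (at_left ?s)"
      unfolding isCont_def by (rule tendsto_mono[OF at_le[OF subset_UNIV]])
    then have lim: "((\<lambda>t. Y (j k) + w t - w (j k)) \<longlongrightarrow> ?y) (at_left ?s)"
      by (intro tendsto_intros)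
    have "\<forall>\<^sub>F t in at_left ?s. Y (j k) + w t - w (j k) = Y t"
    proof (rule eventually_at_leftI)
      show "Y (j k) + w t - w (j k) = Y t" if "t \<in> {j k<..<?s}" for t
        using that by (intro between[symmetric]) simp
    qed (rule j)
    with lim have lim_Y: "(Y \<longlongrightarrow> ?y) (at_left ?s)"
      by (rule Lim_transform_eventually)
    have "\<forall>i\<ge>1. \<exists>y l. (Y \<longlongrightarrow> y) (at_left (j i)) \<and>
        is_arg_max (\<lambda>n. norm (y $ n - barycenter_with_newborn y (u i))) (\<lambda>_. True) l \<and>
        Y (j i) $ l = y $ u i \<and> (\<forall>n. n \<noteq> l \<longrightarrow> Y (j i) $ n = y $ n)"
      using path unfolding bbb_path_def by (elim conjE)
    from this[rule_format, of "Suc k"] obtain y l where y: "(Y \<longlongrightarrow> y) (at_left ?s)"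
      and l: "is_arg_max (\<lambda>n. norm (y $ n - barycenter_with_newborn y (u (Suc k)))) (\<lambda>_. True) l"
      and Y_l: "Y ?s $ l = y $ u (Suc k)" and Y_n: "\<And>n. n \<noteq> l \<Longrightarrow> Y ?s $ n = y $ n"
      by auto
    have y_eq: "y = ?y"
      using trivial_limit_at_left_real y lim_Y by (rule tendsto_unique)
    have "farthest y (u (Suc k)) l"
      using ties[of _ _ k] l unfolding y_eq Suc by (intro ex_farthest) auto
    then have "bee_jump y (u (Suc k)) = replace y (u (Suc k)) l"
      by (rule bee_jump_eq)
    moreover have "Y ?s = replace y (u (Suc k)) l"
      using Y_l Y_n by (simp add: vec_eq_iff replace_def)
    ultimately show ?case
      by (simp add: y_eq Suc)
  qed
  assume "t \<in> {j k..<j (Suc k)}"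
  then show ?thesis
    using between[of t k] main[of k] by simp
qed

lemma suminf_indicator_infinite:
  assumes "infinite (S :: nat set)"
  shows "(\<Sum>k. indicator S k :: ennreal) = \<infinity>"
  using assms nn_integral_count_space_nat[of "indicator S"] by simp

text \<open>In each long gap the window between \<open>1 / 2\<close> and \<open>1\<close> after the
  jump is examined. These windows lie in different gaps and are disjoint, so the occupation time is
  at least the integral over \<open>s\<close> of the number of long gaps hit at offset
  \<open>s\<close>, which is infinite for almost every such \<open>s\<close>.\<close>

lemma (in bbb_process) occupation_time_infinite:
  assumes A [measurable]: "A \<in> sets borel"
    and offsets: "AE s in lborel. 1 / 2 < s \<and> s < 1 \<longrightarrow> hits A s \<omega> (\<lambda>i. J i \<omega>)"
    and ties: "tie_free \<omega> (\<lambda>i. J i \<omega>)"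
    and good: "good_times (\<lambda>i. J i \<omega>)"
    and cont: "\<forall>n. continuous_on {0..} (\<lambda>t. B n t \<omega>)"
    and W: "\<forall>t\<ge>0. W t \<omega> = (\<chi> n. B n t \<omega>)"
    and path: "bbb_path x (\<lambda>i. J i \<omega>) (\<lambda>i. U i \<omega>) (\<lambda>n t. B n t \<omega>) (\<lambda>t. X t \<omega>)"
    and space: "\<omega> \<in> space M"
  shows "(\<integral>\<^sup>+t\<in>{0..}. indicator A (centered (X t \<omega>)) \<partial>lborel) = \<infinity>"
proof -
  define j where "j i = J i \<omega>" for i
  define w where "w t = W t \<omega>" for t
  define Z where "Z = skeleton x j (\<lambda>i. U i \<omega>) w"
  have j: "j 0 = 0" "j i < j (Suc i)" for i
    using good by (auto simp: good_times_def j_def)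
  have j_nonneg: "0 \<le> j i" for i
    by (induction i) (use j in \<open>auto intro: order_trans less_imp_le\<close>)
  have mono: "j i \<le> j i'" if "i \<le> i'" for i i'
    by (rule lift_Suc_mono_le[of j, OF less_imp_le[OF j(2)] that])
  have X: "X t \<omega> = Z k + w t - w (j k)" if "t \<in> {j k..<j (Suc k)}" for t k
    unfolding Z_def
  proof (rule bbb_path_eq_skeleton[OF _ j _ _ _ that])
    show "bbb_path x j (\<lambda>i. U i \<omega>) (\<lambda>n t. B n t \<omega>) (\<lambda>t. X t \<omega>)"
      using path by (simp add: j_def[abs_def])
    show "continuous_on {0..} (\<lambda>t. B n t \<omega>)" for n
      using cont by blast
    show "w t = (\<chi> n. B n t \<omega>)" if "0 \<le> t" for t
      using W that by (simp add: w_def)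
    show "\<not> tie (skeleton x j (\<lambda>i. U i \<omega>) w k + w (j (Suc k)) - w (j k)) (U (Suc k) \<omega>) i i'"
      if "i \<noteq> i'" for k i i'
      using ties that unfolding w_def[abs_def] j_def[abs_def] by blast
  qed
  have [measurable]: "w \<in> borel_measurable borel"
  proof -
    have "(\<lambda>t. W t \<omega>) \<in> borel_measurable borel"
      using space by (intro W_compose) auto
    then show ?thesis by (simp add: w_def[abs_def])
  qed
  define I where "I = {k. 2 \<le> j (Suc k) - j k}"
  \<comment> \<open>Expressed through \<open>Z\<close> and \<open>w\<close> rather than
    \<open>X\<close>, since joint measurability of \<open>W\<close> makes \<open>w\<close>
    measurable in time.\<close>
  define h :: "nat \<Rightarrow> real \<Rightarrow> ennreal" where
    "h k t = indicator I k * (indicator {j k + 1 / 2<..<j k + 1} t * indicator A (centered (Z k + w t - w (j k))))" for k t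
  have [measurable]: "h k \<in> borel_measurable borel" for k
    unfolding h_def by measurable
  have inside: "t \<in> {j k..<j (Suc k)} \<and> centered (X t \<omega>) \<in> A \<and> h k t = 1" if "h k t \<noteq> 0" for k t
  proof -
    have k: "k \<in> I" "j k + 1 / 2 < t" "t < j k + 1" "centered (Z k + w t - w (j k)) \<in> A"
      using that by (auto simp: h_def indicator_def split: if_splits)
    then have "t \<in> {j k..<j (Suc k)}"
      by (auto simp: I_def)
    then show ?thesis
      using k X[of t k] by (auto simp: h_def)
  qed
  have "(\<Sum>k. h k t) \<le> indicator A (centered (X t \<omega>)) * indicator {0..} t" for t
  proof (cases "\<exists>k. h k t \<noteq> 0")
    case True
    then obtain k where k: "h k t \<noteq> 0" by blast
    have "h k' t = 0" if "k' \<noteq> k" for k'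
    proof (rule ccontr)
      assume "h k' t \<noteq> 0"
      then have "j k \<le> t" "t < j (Suc k)" "j k' \<le> t" "t < j (Suc k')"
        using inside[OF k] inside[of k' t] by auto
      then show False
        using mono[of "Suc k" k'] mono[of "Suc k'" k] that by (cases "k < k'") auto
    qed
    then have "(\<Sum>k. h k t) = h k t"
      by (subst suminf_finite[of "{k}"]) auto
    then show ?thesis
      using inside[OF k] j_nonneg[of k] by auto
  qed auto
  then have "(\<integral>\<^sup>+t. (\<Sum>k. h k t) \<partial>lborel) \<le> (\<integral>\<^sup>+t\<in>{0..}. indicator A (centered (X t \<omega>)) \<partial>lborel)"
    by (intro nn_integral_mono) auto
  moreover have "(\<integral>\<^sup>+t. (\<Sum>k. h k t) \<partial>lborel) = \<infinity>"
  proof -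
    \<comment> \<open>Moving every window to the common interval of offsets lets the sum count the
      gaps hit at one offset.\<close>
    have shift: "(\<integral>\<^sup>+t. h k t \<partial>lborel) = (\<integral>\<^sup>+s. h k (j k + s) \<partial>lborel)" for k
    proof -
      have "(\<integral>\<^sup>+t. h k t \<partial>lborel) = (\<integral>\<^sup>+t. h k t \<partial>distr lborel borel ((+) (j k)))"
        by (simp add: lborel_distr_plus)
      also have "\<dots> = (\<integral>\<^sup>+s. h k (j k + s) \<partial>lborel)"
        by (rule nn_integral_distr) auto
      finally show ?thesis .
    qed
    have [measurable]: "(\<lambda>s. h k (j k + s)) \<in> borel_measurable borel" for k
      by measurable
    have "(\<integral>\<^sup>+t. (\<Sum>k. h k t) \<partial>lborel) = (\<Sum>k. \<integral>\<^sup>+t. h k t \<partial>lborel)"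
      by (rule nn_integral_suminf) simp
    also have "\<dots> = (\<Sum>k. \<integral>\<^sup>+s. h k (j k + s) \<partial>lborel)"
      by (simp only: shift)
    also have "\<dots> = (\<integral>\<^sup>+s. (\<Sum>k. h k (j k + s)) \<partial>lborel)"
      by (rule nn_integral_suminf[symmetric]) simp
    also have "\<dots> = (\<integral>\<^sup>+s. \<infinity> * indicator {1 / 2<..<1} s \<partial>(lborel :: real measure))"
    proof (rule nn_integral_cong_AE)
      show "AE s in lborel. (\<Sum>k. h k (j k + s)) = \<infinity> * indicator {1 / 2<..<1} s"
        using offsets
      proof eventually_elim
        case (elim s)
        show ?case
        proof (cases "1 / 2 < s \<and> s < 1")
          case True
          let ?S = "{k. 2 \<le> j (Suc k) - j k \<and> centered (Z k + w (j k + s) - w (j k)) \<in> A}"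
          have "infinite ?S"
            using elim True unfolding infinite_nat_iff_unbounded_le mem_Collect_eq Z_def w_def[abs_def] j_def[abs_def]
            by blast
          moreover have "(\<lambda>k. h k (j k + s)) = indicator ?S"
            using True by (auto simp: h_def I_def indicator_def fun_eq_iff)
          ultimately show ?thesis
            using True suminf_indicator_infinite[of ?S] by simp
        next
          case False
          then have "h k (j k + s) = 0" for k
            by (auto simp: h_def indicator_def)
          then show ?thesis
            using False by auto
        qed
      qed
    qed
    also have "\<dots> = \<infinity>"
      by (subst nn_integral_cmult_indicator) (auto simp: ennreal_top_mult)
    finally show ?thesis .
  qed
  ultimately show ?thesis
    by (simp add: top.extremum_unique)
qed

lemma (in bbb_process) AE_occupation_time:
  assumes A: "A \<in> sets borel" and pos: "0 < emeasure lborel (cball 0 1 \<inter> centered -` A)"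
  shows "AE \<omega> in M. (\<integral>\<^sup>+t\<in>{0..}. indicator A (centered (X t \<omega>)) \<partial>lborel) = \<infinity>"
proof -
  \<comment> \<open>The absence of ties does not involve the offset; \<open>1 / 2\<close> is just
    one admissible value.\<close>
  have "AE \<omega> in M. tie_free \<omega> (\<lambda>i. J i \<omega>) \<and> hits A (1 / 2) \<omega> (\<lambda>i. J i \<omega>)"
    by (rule AE_random_times[OF A pos]) simp_all
  then have "AE \<omega> in M. tie_free \<omega> (\<lambda>i. J i \<omega>)"
    by (rule eventually_mono) (rule conjunct1)
  from AE_conjI[OF AE_almost_all_offsets[OF A pos] AE_conjI[OF this AE_conjI[OF AE_good_times
      AE_conjI[OF AE_W AE_conjI[OF path AE_space]]]]]
  show ?thesis
    by (rule eventually_mono) (elim conjE, rule occupation_time_infinite[OF A])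
qed

theorem theorem1p3:
  "\<exists>\<phi> :: (('d::finite, 'n::finite) config) measure.
     sets \<phi> = sets borel \<and> sigma_finite_measure \<phi> \<and> emeasure \<phi> UNIV \<noteq> 0 \<and>
     (\<forall>A \<in> sets borel. emeasure \<phi> A > 0 \<longrightarrow>
       (\<forall>x (M :: 'w measure) J U B X. bbb_process M J U B x X \<longrightarrow>
         (AE \<omega> in M. (\<integral>\<^sup>+ t \<in> {0..}. indicator A (centered (X t \<omega>)) \<partial>lborel) = \<infinity>)))"
proof -
  \<comment> \<open>Centering ignores common translations, so the image of the full Lebesgue measure
    takes only the values \<open>0\<close> and \<open>\<infinity>\<close> and is not
    \<sigma>-finite. Restricting to the unit ball first makes it finite.\<close>
  let ?\<nu> = "density lborel (indicator (cball 0 1)) :: ('d, 'n) config measure"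
  define \<phi> where "\<phi> = distr ?\<nu> borel centered"
  have \<phi>: "emeasure \<phi> A = emeasure lborel (cball 0 1 \<inter> centered -` A)" if A [measurable]: "A \<in> sets borel" for A
  proof -
    have "centered -` A \<in> sets borel"
      using measurable_sets[OF borel_measurable_centered A] by simp
    then have "emeasure \<phi> A = (\<integral>\<^sup>+y. indicator (cball 0 1) y * indicator (centered -` A) y \<partial>lborel)"
      unfolding \<phi>_def by (subst emeasure_distr, simp, simp, subst emeasure_density) (auto intro!: borel_measurable_indicator)
    also have "\<dots> = (\<integral>\<^sup>+y. indicator (cball 0 1 \<inter> centered -` A) y \<partial>lborel)"
      by (simp add: indicator_inter_arith)
    also have "\<dots> = emeasure lborel (cball 0 1 \<inter> centered -` A)"
      using \<open>centered -` A \<in> sets borel\<close> by (intro nn_integral_indicator) auto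
    finally show ?thesis .
  qed
  have UNIV: "emeasure \<phi> UNIV = emeasure lborel (cball (0 :: ('d, 'n) config) 1)"
    by (subst \<phi>) auto
  have "finite_measure \<phi>"
    by (rule finite_measureI) (use UNIV emeasure_lborel_cball_finite[of "0 :: ('d, 'n) config" 1] in \<open>simp add: \<phi>_def\<close>)
  then have "sigma_finite_measure \<phi>"
    by (rule finite_measure.axioms(1))
  moreover have "emeasure \<phi> UNIV \<noteq> 0"
    unfolding UNIV using content_cball_pos[of 1 "0 :: ('d, 'n) config"] by (auto simp: measure_def)
  moreover have "sets \<phi> = sets borel"
    by (simp add: \<phi>_def)
  moreover have "AE \<omega> in M. (\<integral>\<^sup>+ t \<in> {0..}. indicator A (centered (X t \<omega>)) \<partial>lborel) = \<infinity>"
    if "A \<in> sets borel" "emeasure \<phi> A > 0" "bbb_process M J U B x X"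
    for A and x :: "('d, 'n) config" and M :: "'w measure" and J U B X
  proof -
    interpret bbb_process M J U B x X by fact
    show ?thesis
      using that by (intro AE_occupation_time) (simp_all add: \<phi>)
  qed
  ultimately show ?thesis
    by (intro exI[of _ \<phi>]) blast
qed

end
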